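(* The manifold $S^3\times S^3$, regarded as the Lie group $\mathrm{SU}(2)\times\mathrm{SU}(2)$, does not admit left invariant coupled $\mathrm{SU}(3)$-structures $(\omega,\psi_+)$ inducing an $\mathrm{Ad}(S^1)$-invariant Einstein metric.
   Context: Stable forms. Let $V$ be a 6-dimensional real vector space. A $k$-form on $V$ is stable if its orbit under the natural action of $\mathrm{GL}(V)$ on $\Lambda^k(V^* )$ is open. A 2-form $\omega$ on $V$ is stable if and only if $\omega^3\neq 0$. Let $A:\Lambda^5(V^* )\to V\otimes\Lambda^6(V^* )$ be the isomorphism $A(\gamma)=v\otimes\Omega$ where $i_v\Omega=\gamma$. For $\rho\in\Lambda^3(V^* )$ put $K_\rho:V\to V\otimes\Lambda^6(V^* )$, $K_\rho(v)=A((i_v\rho)\wedge\rho)$, and $\lambda(\rho)=\frac16\mathrm{tr}K_\rho^2\in(\Lambda^6(V^* ))^{\otimes 2}$. A 3-form $\rho$ is stable if and only if $\lambda(\rho)\neq 0$. Given a stable 2-form $\omega$ and a stable 3-form $\rho$, orient $V$ so that $\omega^3$ is positive, and let $\sqrt{|\lambda(\rho)|}\in\Lambda^6(V^* )$ be the corresponding positive volume form; then $J_\rho=-\frac{1}{\sqrt{|\lambda(\rho)|}}K_\rho$ is an almost complex structure when $\lambda(\rho)<0$. $\mathrm{SU}(3)$-structures. An $\mathrm{SU}(3)$-structure on a 6-dimensional manifold $N$ is a pair $(\omega,\psi_+)$ of a 2-form and a 3-form on $N$ which at each point are stable with $\lambda(\psi_+)<0$, are compatible ($\omega\wedge\psi_+=0$),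 satisfy the normalization condition $\psi_+\wedge\psi_-=\frac23\omega^3$, where $J=J_{\psi_+}$ and $\psi_-=J^*\psi_+$, and are such that $h(\cdot,\cdot)=\omega(\cdot,J\cdot)$ is a Riemannian metric, called the metric induced by $(\omega,\psi_+)$. Classes. An $\mathrm{SU}(3)$-structure is half-flat if $d\psi_+=0$ and $d(\omega\wedge\omega)=0$. A half-flat $\mathrm{SU}(3)$-structure is coupled if $d\omega=c\,\psi_+$ for some non-vanishing smooth function $c$. Left invariance. A left invariant $\mathrm{SU}(3)$-structure on $\mathrm{SU}(2)\times\mathrm{SU}(2)$ is one for which $\omega$ and $\psi_+$ are left invariant forms; its induced metric is then left invariant, and a left invariant metric is identified with an inner product on $\mathfrak{su}(2)\oplus\mathfrak{su}(2)$. A left invariant metric is called $\mathrm{Ad}(S^1)$-invariant if, for some embedding $S^1\subset\mathrm{SU}(2)\times\mathrm{SU}(2)$, this inner product is preserved by $\mathrm{Ad}(g)$ for all $g\in S^1$. A metric $h$ is Einstein if $\mathrm{Ric}(h)=\mu h$ for some real number $\mu$.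
   Formalization: Coupled structures are additionally required not to be nearly Kähler, since the homogeneous nearly Kähler structure on SU(2)×SU(2) is left invariant and coupled and induces an Ad(S^1)-invariant Einstein metric, contradicting the literal claim. *)

theory Defs
  imports "HOL-Analysis.Analysis"
begin

section \<open>Embedded submanifolds of a Euclidean space\<close>

text \<open>Manifolds are embedded submanifolds \<open>M\<close> of a Euclidean space \<open>'a\<close>. Tangent vectors are
  vectors of \<open>'a\<close>, and only the values of fields and forms at points of \<open>M\<close> are relevant.\<close>

primrec Ck_on :: "nat \<Rightarrow> 'a set \<Rightarrow> ('a::euclidean_space \<Rightarrow> 'b::euclidean_space) \<Rightarrow> bool" where
  "Ck_on 0 U f \<longleftrightarrow> continuous_on U f"
| "Ck_on (Suc k) U f \<longleftrightarrow>
     (\<forall>x\<in>U. f differentiable (at x)) \<and> (\<forall>v. Ck_on k U (\<lambda>x. frechet_derivative f (at x) v))"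

definition smooth_map :: "'a set \<Rightarrow> ('a::euclidean_space \<Rightarrow> 'b::euclidean_space) \<Rightarrow> bool" where
  "smooth_map M f \<longleftrightarrow>
     (\<forall>p\<in>M. \<exists>U F. open U \<and> p \<in> U \<and> (\<forall>k. Ck_on k U F) \<and> (\<forall>x\<in>U \<inter> M. F x = f x))"

definition tangent_space :: "'a::euclidean_space set \<Rightarrow> 'a \<Rightarrow> 'a set" where
  "tangent_space M p =
     {v. \<exists>\<gamma>. (\<forall>t::real. \<gamma> t \<in> M) \<and> \<gamma> 0 = p \<and> (\<gamma> has_vector_derivative v) (at 0)}"

text \<open>The derivative of \<open>f\<close> within \<open>M\<close> is a linear map on the whole ambient space which is uniquely
  determined only on the tangent space; \<open>deriv_along\<close> is used for tangent \<open>v\<close> only.\<close>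

definition deriv_along ::
    "'a set \<Rightarrow> ('a::euclidean_space \<Rightarrow> 'b::euclidean_space) \<Rightarrow> 'a \<Rightarrow> 'a \<Rightarrow> 'b" where
  "deriv_along M f p v = frechet_derivative f (at p within M) v"

definition vector_field :: "'a::euclidean_space set \<Rightarrow> ('a \<Rightarrow> 'a) \<Rightarrow> bool" where
  "vector_field M X \<longleftrightarrow> smooth_map M X \<and> (\<forall>p\<in>M. X p \<in> tangent_space M p)"

definition lie_bracket ::
    "'a::euclidean_space set \<Rightarrow> ('a \<Rightarrow> 'a) \<Rightarrow> ('a \<Rightarrow> 'a) \<Rightarrow> 'a \<Rightarrow> 'a" where
  "lie_bracket M X Y p = deriv_along M Y p (X p) - deriv_along M X p (Y p)"


section \<open>Exterior forms on a subspace\<close>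

text \<open>A \<open>k\<close>-form on a subspace \<open>V\<close> is a function on lists of vectors that is \<open>0\<close> on every list that
  is not a list of \<open>k\<close> vectors of \<open>V\<close>. Hence equality of forms is equality of functions.\<close>

definition forms :: "nat \<Rightarrow> 'a::euclidean_space set \<Rightarrow> ('a list \<Rightarrow> real) set" where
  "forms k V = {\<alpha>.
     (\<forall>vs. \<not> (length vs = k \<and> set vs \<subseteq> V) \<longrightarrow> \<alpha> vs = 0) \<and>
     (\<forall>us ws. \<forall>x\<in>V. \<forall>y\<in>V. \<forall>a b. length us + length ws + 1 = k \<and> set us \<subseteq> V \<and> set ws \<subseteq> V \<longrightarrow>
        \<alpha> (us @ (a *\<^sub>R x + b *\<^sub>R y) # ws) = a * \<alpha> (us @ x # ws) + b * \<alpha> (us @ y # ws)) \<and>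
     (\<forall>vs. \<not> distinct vs \<longrightarrow> \<alpha> vs = 0)}"

text \<open>\<open>wedge k \<alpha> \<beta>\<close>, with \<open>\<alpha>\<close> of degree \<open>k\<close>, sums over the shuffles, given by the set \<open>S\<close> of
  positions passed to \<open>\<alpha>\<close>; the exponent is the number of inversions of the shuffle.\<close>

definition wedge :: "nat \<Rightarrow> ('a list \<Rightarrow> real) \<Rightarrow> ('a list \<Rightarrow> real) \<Rightarrow> 'a list \<Rightarrow> real" where
  "wedge k \<alpha> \<beta> vs =
     (\<Sum>S | S \<subseteq> {..<length vs} \<and> card S = k.
        (-1) ^ card {(i, j). i \<in> S \<and> j \<in> {..<length vs} - S \<and> j < i} *
        \<alpha> (nths vs S) * \<beta> (nths vs (- S)))"

definition contract :: "'a \<Rightarrow> ('a list \<Rightarrow> real) \<Rightarrow> 'a list \<Rightarrow> real" where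
  "contract v \<alpha> vs = \<alpha> (v # vs)"

definition pullback :: "'a set \<Rightarrow> ('a \<Rightarrow> 'a) \<Rightarrow> ('a list \<Rightarrow> real) \<Rightarrow> 'a list \<Rightarrow> real" where
  "pullback V g \<alpha> vs = (if set vs \<subseteq> V then \<alpha> (map g vs) else 0)"

text \<open>The topology on functions is that of pointwise convergence; on the finite-dimensional space
  \<open>forms k V\<close> it induces the usual vector space topology.\<close>

definition stable :: "nat \<Rightarrow> 'a::euclidean_space set \<Rightarrow> ('a list \<Rightarrow> real) \<Rightarrow> bool" where
  "stable k V \<alpha> \<longleftrightarrow> \<alpha> \<in> forms k V \<and>
     openin (top_of_set (forms k V)) {pullback V g \<alpha> | g. linear g \<and> bij_betw g V V}"

definition trace_on :: "'a::euclidean_space set \<Rightarrow> ('a \<Rightarrow> 'a) \<Rightarrow> real" where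
  "trace_on V f =
     (let B = (SOME B. independent B \<and> span B = V) in \<Sum>b\<in>B. representation B (f b) b)"

text \<open>A nonzero \<open>\<Omega>\<close> in \<open>forms 6 V\<close> trivialises \<open>\<Lambda>\<^sup>6(V\<^sup>*)\<close>: the map \<open>K\<^sub>\<rho>\<close> with values in
  \<open>V \<otimes> \<Lambda>\<^sup>6(V\<^sup>*)\<close> is \<open>v \<mapsto> hitchin_K V \<Omega> \<rho> v \<otimes> \<Omega>\<close>, and \<open>\<lambda>(\<rho>)\<close> is
  \<open>hitchin_lambda V \<Omega> \<rho>\<close> times \<open>\<Omega> \<otimes> \<Omega>\<close>, so that the sign of \<open>hitchin_lambda\<close> is independent
  of \<open>\<Omega>\<close>. The positive root of \<open>\<bar>\<lambda>(\<rho>)\<bar>\<close> is \<open>sqrt \<bar>hitchin_lambda V \<Omega> \<rho>\<bar>\<close> times \<open>\<Omega>\<close> when \<open>\<Omega>\<close>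
  is positive, and then \<open>J\<^sub>\<rho>\<close> is \<open>hitchin_J V \<Omega> \<rho>\<close>.\<close>

definition hitchin_K ::
    "'a set \<Rightarrow> ('a list \<Rightarrow> real) \<Rightarrow> ('a list \<Rightarrow> real) \<Rightarrow> 'a::euclidean_space \<Rightarrow> 'a" where
  "hitchin_K V \<Omega> \<rho> v = (THE u. u \<in> V \<and> contract u \<Omega> = wedge 2 (contract v \<rho>) \<rho>)"

definition hitchin_lambda ::
    "'a::euclidean_space set \<Rightarrow> ('a list \<Rightarrow> real) \<Rightarrow> ('a list \<Rightarrow> real) \<Rightarrow> real" where
  "hitchin_lambda V \<Omega> \<rho> = 1/6 * trace_on V (hitchin_K V \<Omega> \<rho> \<circ> hitchin_K V \<Omega> \<rho>)"

definition hitchin_J ::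
    "'a set \<Rightarrow> ('a list \<Rightarrow> real) \<Rightarrow> ('a list \<Rightarrow> real) \<Rightarrow> 'a::euclidean_space \<Rightarrow> 'a" where
  "hitchin_J V \<Omega> \<rho> v = (- 1 / sqrt \<bar>hitchin_lambda V \<Omega> \<rho>\<bar>) *\<^sub>R hitchin_K V \<Omega> \<rho> v"

definition cube :: "('a list \<Rightarrow> real) \<Rightarrow> 'a list \<Rightarrow> real" where
  "cube \<omega> = wedge 4 (wedge 2 \<omega> \<omega>) \<omega>"


section \<open>Differential forms\<close>

definition differential_form ::
    "'a::euclidean_space set \<Rightarrow> nat \<Rightarrow> ('a \<Rightarrow> 'a list \<Rightarrow> real) \<Rightarrow> bool" where
  "differential_form M k \<alpha> \<longleftrightarrow>
     (\<forall>p\<in>M. \<alpha> p \<in> forms k (tangent_space M p)) \<and>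
     (\<forall>Xs. length Xs = k \<and> (\<forall>X\<in>set Xs. vector_field M X) \<longrightarrow>
        smooth_map M (\<lambda>p. \<alpha> p (map (\<lambda>X. X p) Xs)))"

text \<open>\<open>has_ext_deriv M k \<alpha> \<beta>\<close> says \<open>d\<alpha> = \<beta>\<close> for a \<open>k\<close>-form \<open>\<alpha>\<close>, where \<open>d\<close> is characterised by the
  invariant (Palais) formula on vector fields \<open>X\<^sub>0, \<dots>, X\<^sub>k\<close>.\<close>

definition has_ext_deriv ::
    "'a::euclidean_space set \<Rightarrow> nat \<Rightarrow> ('a \<Rightarrow> 'a list \<Rightarrow> real) \<Rightarrow> ('a \<Rightarrow> 'a list \<Rightarrow> real) \<Rightarrow> bool" where
  "has_ext_deriv M k \<alpha> \<beta> \<longleftrightarrow>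
     (\<forall>Xs. length Xs = k + 1 \<and> (\<forall>X\<in>set Xs. vector_field M X) \<longrightarrow>
       (\<forall>p\<in>M. \<beta> p (map (\<lambda>X. X p) Xs) =
          (\<Sum>i\<le>k. (-1) ^ i *
             deriv_along M (\<lambda>q. \<alpha> q (map (\<lambda>X. X q) (nths Xs (- {i})))) p ((Xs ! i) p)) +
          (\<Sum>i\<le>k. \<Sum>j\<in>{i<..k}. (-1) ^ (i + j) *
             \<alpha> p (map (\<lambda>X. X p) (lie_bracket M (Xs ! i) (Xs ! j) # nths Xs (- {i, j}))))))"


section \<open>Einstein metrics\<close>

definition riemannian_metric :: "'a::euclidean_space set \<Rightarrow> ('a \<Rightarrow> 'a \<Rightarrow> 'a \<Rightarrow> real) \<Rightarrow> bool" where
  "riemannian_metric M h \<longleftrightarrow>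
     (\<forall>p\<in>M. let V = tangent_space M p in
        (\<forall>x\<in>V. \<forall>y\<in>V. \<forall>z\<in>V. \<forall>a b. h p (a *\<^sub>R x + b *\<^sub>R y) z = a * h p x z + b * h p y z) \<and>
        (\<forall>x\<in>V. \<forall>y\<in>V. h p x y = h p y x) \<and>
        (\<forall>x\<in>V. x \<noteq> 0 \<longrightarrow> h p x x > 0)) \<and>
     (\<forall>X Y. vector_field M X \<and> vector_field M Y \<longrightarrow> smooth_map M (\<lambda>p. h p (X p) (Y p)))"

definition connection ::
    "'a::euclidean_space set \<Rightarrow> (('a \<Rightarrow> 'a) \<Rightarrow> ('a \<Rightarrow> 'a) \<Rightarrow> 'a \<Rightarrow> 'a) \<Rightarrow> bool" where
  "connection M D \<longleftrightarrow>
     (\<forall>X Y. vector_field M X \<and> vector_field M Y \<longrightarrow> vector_field M (D X Y)) \<and>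
     (\<forall>X Y Z f. vector_field M X \<and> vector_field M Y \<and> vector_field M Z \<and>
          smooth_map M (f :: 'a \<Rightarrow> real) \<longrightarrow>
        (\<forall>p\<in>M.
           D (\<lambda>q. X q + Y q) Z p = D X Z p + D Y Z p \<and>
           D (\<lambda>q. f q *\<^sub>R X q) Z p = f p *\<^sub>R D X Z p \<and>
           D X (\<lambda>q. Y q + Z q) p = D X Y p + D X Z p \<and>
           D X (\<lambda>q. f q *\<^sub>R Y q) p = deriv_along M f p (X p) *\<^sub>R Y p + f p *\<^sub>R D X Y p))"

definition levi_civita ::
    "'a::euclidean_space set \<Rightarrow> ('a \<Rightarrow> 'a \<Rightarrow> 'a \<Rightarrow> real) \<Rightarrow>
       (('a \<Rightarrow> 'a) \<Rightarrow> ('a \<Rightarrow> 'a) \<Rightarrow> 'a \<Rightarrow> 'a) \<Rightarrow> bool" where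
  "levi_civita M h D \<longleftrightarrow> connection M D \<and>
     (\<forall>X Y Z. vector_field M X \<and> vector_field M Y \<and> vector_field M Z \<longrightarrow>
        (\<forall>p\<in>M.
           D X Y p - D Y X p = lie_bracket M X Y p \<and>
           deriv_along M (\<lambda>q. h q (Y q) (Z q)) p (X p) =
             h p (D X Y p) (Z p) + h p (Y p) (D X Z p)))"

definition curvature_tensor ::
    "'a::euclidean_space set \<Rightarrow> (('a \<Rightarrow> 'a) \<Rightarrow> ('a \<Rightarrow> 'a) \<Rightarrow> 'a \<Rightarrow> 'a) \<Rightarrow>
       ('a \<Rightarrow> 'a \<Rightarrow> 'a \<Rightarrow> 'a \<Rightarrow> 'a) \<Rightarrow> bool" where
  "curvature_tensor M D R \<longleftrightarrow>
     (\<forall>X Y Z. vector_field M X \<and> vector_field M Y \<and> vector_field M Z \<longrightarrow>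
        (\<forall>p\<in>M. R p (X p) (Y p) (Z p) =
           D X (D Y Z) p - D Y (D X Z) p - D (lie_bracket M X Y) Z p))"

definition ricci ::
    "'a::euclidean_space set \<Rightarrow> ('a \<Rightarrow> 'a \<Rightarrow> 'a \<Rightarrow> 'a \<Rightarrow> 'a) \<Rightarrow> 'a \<Rightarrow> 'a \<Rightarrow> 'a \<Rightarrow> real" where
  "ricci M R p y z = trace_on (tangent_space M p) (\<lambda>x. R p x y z)"

text \<open>The Levi-Civita connection and its curvature tensor exist and are unique (on fields tangent to
  \<open>M\<close> and at points of \<open>M\<close>), so the first two existential quantifiers merely name them.\<close>

definition einstein :: "'a::euclidean_space set \<Rightarrow> ('a \<Rightarrow> 'a \<Rightarrow> 'a \<Rightarrow> real) \<Rightarrow> bool" where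
  "einstein M h \<longleftrightarrow> (\<exists>D R. levi_civita M h D \<and> curvature_tensor M D R \<and>
     (\<exists>\<mu>::real. \<forall>p\<in>M. \<forall>y\<in>tangent_space M p. \<forall>z\<in>tangent_space M p. ricci M R p y z = \<mu> * h p y z))"


section \<open>SU(3)-structures on 6-dimensional manifolds\<close>

text \<open>The almost complex structure of the pair; \<open>cube (\<omega> p)\<close> is the positive volume form.\<close>

definition su3_J ::
    "'a::euclidean_space set \<Rightarrow> ('a \<Rightarrow> 'a list \<Rightarrow> real) \<Rightarrow> ('a \<Rightarrow> 'a list \<Rightarrow> real) \<Rightarrow> 'a \<Rightarrow> 'a \<Rightarrow> 'a" where
  "su3_J M \<omega> \<psi> p = hitchin_J (tangent_space M p) (cube (\<omega> p)) (\<psi> p)"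

definition psi_minus ::
    "'a::euclidean_space set \<Rightarrow> ('a \<Rightarrow> 'a list \<Rightarrow> real) \<Rightarrow> ('a \<Rightarrow> 'a list \<Rightarrow> real) \<Rightarrow>
       'a \<Rightarrow> 'a list \<Rightarrow> real" where
  "psi_minus M \<omega> \<psi> p = pullback (tangent_space M p) (su3_J M \<omega> \<psi> p) (\<psi> p)"

definition su3_metric ::
    "'a::euclidean_space set \<Rightarrow> ('a \<Rightarrow> 'a list \<Rightarrow> real) \<Rightarrow> ('a \<Rightarrow> 'a list \<Rightarrow> real) \<Rightarrow>
       'a \<Rightarrow> 'a \<Rightarrow> 'a \<Rightarrow> real" where
  "su3_metric M \<omega> \<psi> p x y = \<omega> p [x, su3_J M \<omega> \<psi> p y]"

definition su3_structure ::
    "'a::euclidean_space set \<Rightarrow> ('a \<Rightarrow> 'a list \<Rightarrow> real) \<Rightarrow> ('a \<Rightarrow> 'a list \<Rightarrow> real) \<Rightarrow> bool" where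
  "su3_structure M \<omega> \<psi> \<longleftrightarrow>
     differential_form M 2 \<omega> \<and> differential_form M 3 \<psi> \<and>
     (\<forall>p\<in>M. let V = tangent_space M p in
        stable 2 V (\<omega> p) \<and> stable 3 V (\<psi> p) \<and>
        hitchin_lambda V (cube (\<omega> p)) (\<psi> p) < 0 \<and>
        wedge 2 (\<omega> p) (\<psi> p) = (\<lambda>_. 0) \<and>
        wedge 3 (\<psi> p) (psi_minus M \<omega> \<psi> p) = (\<lambda>vs. 2/3 * cube (\<omega> p) vs)) \<and>
     riemannian_metric M (su3_metric M \<omega> \<psi>)"

definition half_flat ::
    "'a::euclidean_space set \<Rightarrow> ('a \<Rightarrow> 'a list \<Rightarrow> real) \<Rightarrow> ('a \<Rightarrow> 'a list \<Rightarrow> real) \<Rightarrow> bool" where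
  "half_flat M \<omega> \<psi> \<longleftrightarrow>
     has_ext_deriv M 3 \<psi> (\<lambda>_ _. 0) \<and>
     has_ext_deriv M 4 (\<lambda>p. wedge 2 (\<omega> p) (\<omega> p)) (\<lambda>_ _. 0)"

definition coupled ::
    "'a::euclidean_space set \<Rightarrow> ('a \<Rightarrow> 'a list \<Rightarrow> real) \<Rightarrow> ('a \<Rightarrow> 'a list \<Rightarrow> real) \<Rightarrow> bool" where
  "coupled M \<omega> \<psi> \<longleftrightarrow> half_flat M \<omega> \<psi> \<and>
     (\<exists>c. smooth_map M c \<and> (\<forall>p\<in>M. c p \<noteq> 0) \<and>
        has_ext_deriv M 2 \<omega> (\<lambda>p vs. c p * \<psi> p vs))"

text \<open>Nearly Kaehler structures, \<open>d\<omega> = - 3/2 w \<psi>\<^sub>+\<close> and \<open>d\<psi>\<^sub>- = w \<omega> \<and> \<omega>\<close> with \<open>w \<noteq> 0\<close> constant, form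
  a degenerate subclass of the coupled structures; their metrics are always Einstein. On
  \<open>SU(2) \<times> SU(2)\<close> there is a left invariant one, with a metric that is \<open>Ad\<close>-invariant under the
  diagonal \<open>SU(2)\<close>, so nonexistence of coupled structures with such a metric can only concern
  coupled structures that are not nearly Kaehler.\<close>

definition nearly_kaehler ::
    "'a::euclidean_space set \<Rightarrow> ('a \<Rightarrow> 'a list \<Rightarrow> real) \<Rightarrow> ('a \<Rightarrow> 'a list \<Rightarrow> real) \<Rightarrow> bool" where
  "nearly_kaehler M \<omega> \<psi> \<longleftrightarrow>
     (\<exists>w::real. w \<noteq> 0 \<and>
        has_ext_deriv M 2 \<omega> (\<lambda>p vs. - 3/2 * w * \<psi> p vs) \<and>
        has_ext_deriv M 3 (psi_minus M \<omega> \<psi>) (\<lambda>p vs. w * wedge 2 (\<omega> p) (\<omega> p) vs))"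


section \<open>The Lie group SU(2) x SU(2)\<close>

type_synonym mat2 = "complex^2^2"

definition SU2 :: "mat2 set" where
  "SU2 = {A. A ** (\<chi> i j. cnj (A $ j $ i)) = mat 1 \<and> det A = 1}"

definition SU2xSU2 :: "(mat2 \<times> mat2) set" where
  "SU2xSU2 = SU2 \<times> SU2"

definition gmult :: "mat2 \<times> mat2 \<Rightarrow> mat2 \<times> mat2 \<Rightarrow> mat2 \<times> mat2" where
  "gmult g x = (fst g ** fst x, snd g ** snd x)"

definition ginv :: "mat2 \<times> mat2 \<Rightarrow> mat2 \<times> mat2" where
  "ginv g = (matrix_inv (fst g), matrix_inv (snd g))"

definition gone :: "mat2 \<times> mat2" where
  "gone = (mat 1, mat 1)"

text \<open>Left translation by \<open>g\<close> is the restriction of the linear map \<open>gmult g\<close>, which is therefore also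
  its differential at every point; likewise for conjugation and \<open>Ad\<close>.\<close>

definition left_invariant :: "(mat2 \<times> mat2 \<Rightarrow> (mat2 \<times> mat2) list \<Rightarrow> real) \<Rightarrow> bool" where
  "left_invariant \<alpha> \<longleftrightarrow>
     (\<forall>g\<in>SU2xSU2. \<forall>p\<in>SU2xSU2. \<forall>vs. set vs \<subseteq> tangent_space SU2xSU2 p \<longrightarrow>
        \<alpha> (gmult g p) (map (gmult g) vs) = \<alpha> p vs)"

definition Ad :: "mat2 \<times> mat2 \<Rightarrow> mat2 \<times> mat2 \<Rightarrow> mat2 \<times> mat2" where
  "Ad g x = gmult (gmult g x) (ginv g)"

text \<open>A continuous injective homomorphism from the circle group is automatically a smooth embedding.\<close>

definition circle_embedding :: "(complex \<Rightarrow> mat2 \<times> mat2) \<Rightarrow> bool" where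
  "circle_embedding \<phi> \<longleftrightarrow>
     continuous_on (sphere 0 1) \<phi> \<and> inj_on \<phi> (sphere 0 1) \<and> \<phi> ` sphere 0 1 \<subseteq> SU2xSU2 \<and>
     (\<forall>z\<in>sphere 0 1. \<forall>w\<in>sphere 0 1. \<phi> (z * w) = gmult (\<phi> z) (\<phi> w))"

definition Ad_circle_invariant ::
    "(mat2 \<times> mat2 \<Rightarrow> mat2 \<times> mat2 \<Rightarrow> mat2 \<times> mat2 \<Rightarrow> real) \<Rightarrow> bool" where
  "Ad_circle_invariant h \<longleftrightarrow>
     (\<exists>\<phi>. circle_embedding \<phi> \<and>
        (\<forall>z\<in>sphere 0 1. \<forall>x\<in>tangent_space SU2xSU2 gone. \<forall>y\<in>tangent_space SU2xSU2 gone.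
           h gone (Ad (\<phi> z) x) (Ad (\<phi> z) y) = h gone x y))"

end

theory Submission
  imports Defs
begin

text \<open>Let \<open>(\<omega>, \<psi>)\<close> be a left invariant coupled structure, \<open>d\<omega> = c \<psi>\<close>. The idea is that \<open>\<omega>\<close> alone determines
  the metric, that \<open>\<omega>\<close> depends, up to automorphisms of the Lie algebra, on three positive
  numbers only, and that these are the sides of a triangle whose angles carry the metric. The Einstein
  equation then says that the triangle is equilateral, which is the nearly Kaehler case.

  Normal form (\<open>coupled_normal_form\<close>). The compatibility \<open>\<omega> \<and> \<psi> = 0\<close> gives \<open>\<omega> \<and> d\<omega> = 0\<close>. Rotations of the
  two factors of \<open>su(2) \<oplus> su(2)\<close> are automorphisms and diagonalise the mixed part of \<open>\<omega>\<close>, by a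
  singular value decomposition. Then \<open>\<omega> \<and> d\<omega> = 0\<close> and non-degeneracy remove the parts of \<open>\<omega>\<close> on the
  factors. With \<open>s\<close> and \<open>t\<close> the symmetric and antisymmetric combinations of the factors,
  \<open>\<omega> = \<Sum>i. a\<^sub>i s\<^sup>i \<and> t\<^sup>i\<close> with all \<open>a\<^sub>i > 0\<close>.

  Metric (\<open>frame6.hitchin_J_frame\<close>, \<open>frame6.metric_frame\<close>). As \<open>\<psi> = d\<omega> / c\<close>, the almost complex structure
  is explicit: it exchanges the lines spanned by \<open>s\<^sub>i\<close> and \<open>t\<^sub>i\<close>. So the metric is diagonal, and its
  entries are proportional to \<open>1 - x\<^sub>i\<close> and \<open>1 + x\<^sub>i\<close>, where \<open>x\<^sub>i\<close> is the cosine of the angle opposite to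
  \<open>a\<^sub>i\<close> in the triangle with sides \<open>a\<^sub>1, a\<^sub>2, a\<^sub>3\<close>. This triangle exists because the metric is positive.

  Einstein equation (\<open>ricci_nf_diagonal\<close>, \<open>einstein_equal_sides\<close>). The Ricci tensor is diagonal as well. The ratio
  of the equations for \<open>s\<^sub>i\<close> and \<open>t\<^sub>i\<close> does not contain the Einstein constant, and with the relation
  \<open>x\<^sub>1\<^sup>2 + x\<^sub>2\<^sup>2 + x\<^sub>3\<^sup>2 + 2 x\<^sub>1 x\<^sub>2 x\<^sub>3 = 1\<close> between the cosines it becomes
  \<open>q\<^sup>2 + (T - 1) q + 2 T\<^sup>2 + T = 0\<close> for \<open>q = x\<^sub>i\<^sup>2\<close> and \<open>T = x\<^sub>1 x\<^sub>2 x\<^sub>3\<close>. The three squares are roots of one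
  quadratic polynomial; this forces \<open>x\<^sub>i\<^sup>2 = 1/4\<close>, and the triangle is equilateral.

  Equal sides (\<open>coupled_frame.nearly_kaehler_if_equal\<close>). Now \<open>\<psi>\<^sub>-\<close> is explicit, its exterior derivative is a multiple
  of \<open>\<omega> \<and> \<omega>\<close>, and the normalisation of \<open>\<psi> \<and> \<psi>\<^sub>-\<close> fixes \<open>c\<^sup>2\<close> so that the multiple is the one in the
  definition of a nearly Kaehler structure.\<close>

section \<open>Exterior forms as functions on lists\<close>

lemma finite_wedge_index: "finite {S. S \<subseteq> {..<n::nat} \<and> card S = k}"
  by (rule finite_subset[of _ "Pow {..<n}"]) auto

lemma wedge_0: "wedge 0 \<alpha> \<beta> vs = \<alpha> [] * \<beta> vs"
proof -
  have "{S. S \<subseteq> {..<length vs} \<and> card S = 0} = {{}}"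
    by (auto simp: card_eq_0_iff dest: finite_subset)
  then show ?thesis by (simp add: wedge_def nths_all)
qed

lemma wedge_Suc_Nil: "wedge (Suc k) \<alpha> \<beta> [] = 0"
proof -
  have "{S. S \<subseteq> {..<0::nat} \<and> card S = Suc k} = {}" by auto
  then show ?thesis by (simp add: wedge_def)
qed

lemma nths_Cons_insert: "nths (v # vs) (insert 0 (Suc ` S)) = v # nths vs S"
  by (simp add: nths_Cons image_iff)

lemma nths_Cons_image: "nths (v # vs) (Suc ` S) = nths vs S"
  by (simp add: nths_Cons image_iff)

lemma nths_Cons_compl_insert: "nths (v # vs) (- insert 0 (Suc ` S)) = nths vs (- S)"
  by (simp add: nths_Cons image_iff) (rule arg_cong[where f = "nths vs"], auto)

lemma nths_Cons_compl_image: "nths (v # vs) (- (Suc ` S)) = v # nths vs (- S)"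
  by (simp add: nths_Cons image_iff) (rule arg_cong[where f = "nths vs"], auto)

text \<open>The recursion for the wedge product below splits the sets of positions by whether they contain
  the first one. Moving all positions up by one keeps the inversions; if the first position goes to
  \<open>\<beta>\<close>, it is in addition inverted with every position of \<open>\<alpha>\<close>.\<close>

lemma inversions_insert:
  "card {(i, j). i \<in> insert 0 (Suc ` S) \<and> j \<in> {..<Suc n} - insert 0 (Suc ` S) \<and> j < i} =
   card {(i, j). i \<in> S \<and> j \<in> {..<n} - S \<and> j < i}"
proof -
  have "{(i, j). i \<in> insert 0 (Suc ` S) \<and> j \<in> {..<Suc n} - insert 0 (Suc ` S) \<and> j < i} =
     map_prod Suc Suc ` {(i, j). i \<in> S \<and> j \<in> {..<n} - S \<and> j < i}" (is "?L = ?R")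
  proof (rule set_eqI, rule iffI)
    fix z assume "z \<in> ?L"
    then obtain i j where z: "z = (i, j)" "i = 0 \<or> i \<in> Suc ` S" "j < Suc n" "j \<noteq> 0"
        "j \<notin> Suc ` S" "j < i"
      by auto
    then obtain i' j' where "i = Suc i'" "j = Suc j'" by (metis not0_implies_Suc not_less0)
    with z have "z = (Suc i', Suc j')" "i' \<in> S" "j' < n" "j' \<notin> S" "j' < i'" by auto
    then show "z \<in> ?R" by (auto simp: image_iff)
  next
    fix z assume "z \<in> ?R" then show "z \<in> ?L" by auto
  qed
  then show ?thesis by (simp add: card_image inj_on_def)
qed

lemma inversions_image:
  assumes "finite S"
  shows "card {(i, j). i \<in> Suc ` S \<and> j \<in> {..<Suc n} - Suc ` S \<and> j < i} =
   card {(i, j). i \<in> S \<and> j \<in> {..<n} - S \<and> j < i} + card S"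
proof -
  have eq: "{(i, j). i \<in> Suc ` S \<and> j \<in> {..<Suc n} - Suc ` S \<and> j < i} =
     map_prod Suc Suc ` {(i, j). i \<in> S \<and> j \<in> {..<n} - S \<and> j < i} \<union> (\<lambda>i. (Suc i, 0)) ` S"
    (is "?L = ?R \<union> ?T")
  proof (rule set_eqI, rule iffI)
    fix z assume "z \<in> ?L"
    then obtain i j where z: "z = (Suc i, j)" "i \<in> S" "j < Suc n" "j \<notin> Suc ` S" "j < Suc i"
      by auto
    then show "z \<in> ?R \<union> ?T" by (cases j) (auto simp: image_iff)
  next
    fix z assume "z \<in> ?R \<union> ?T" then show "z \<in> ?L" by auto
  qed
  have fin: "finite {(i, j). i \<in> S \<and> j \<in> {..<n} - S \<and> j < i}"
    by (rule finite_subset[of _ "S \<times> {..<n}"]) (use assms in auto)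
  have "card (?R \<union> ?T) = card ?R + card ?T"
    by (rule card_Un_disjoint) (use assms fin in auto)
  also have "card ?R = card {(i, j). i \<in> S \<and> j \<in> {..<n} - S \<and> j < i}"
    by (rule card_image) (auto simp: inj_on_def)
  also have "card ?T = card S" by (rule card_image) (auto simp: inj_on_def)
  finally show ?thesis using eq by simp
qed

lemma shuffle_index_Suc:
  "{S. S \<subseteq> {..<Suc n} \<and> card S = Suc k} =
     (\<lambda>S. insert 0 (Suc ` S)) ` {S. S \<subseteq> {..<n} \<and> card S = k} \<union>
     (\<lambda>S. Suc ` S) ` {S. S \<subseteq> {..<n} \<and> card S = Suc k}" (is "?L = ?A \<union> ?B")
proof (rule set_eqI, rule iffI)
  fix S assume S: "S \<in> ?L"
  define T where "T = Suc -` S"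
  have finS: "finite S" using S finite_subset by blast
  have T: "T \<subseteq> {..<n}" using S by (auto simp: T_def)
  have ST: "S = (if 0 \<in> S then insert 0 (Suc ` T) else Suc ` T)"
  proof (rule set_eqI)
    fix x show "x \<in> S \<longleftrightarrow> x \<in> (if 0 \<in> S then insert 0 (Suc ` T) else Suc ` T)"
      by (cases x) (auto simp: T_def image_iff)
  qed
  show "S \<in> ?A \<union> ?B"
  proof (cases "0 \<in> S")
    case True
    then have e: "S = insert 0 (Suc ` T)" using ST by simp
    have "card S = Suc (card T)"
      using finite_subset[OF T] by (subst e) (simp add: card_image)
    then have "T \<in> {S. S \<subseteq> {..<n} \<and> card S = k}" using T S by simp
    from imageI[OF this, of "\<lambda>S. insert 0 (Suc ` S)"] show ?thesis unfolding e[symmetric] ..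
  next
    case False
    then have e: "S = Suc ` T" using ST by simp
    have "card S = card T" by (subst e) (simp add: card_image)
    then have "T \<in> {S. S \<subseteq> {..<n} \<and> card S = Suc k}" using T S by simp
    from imageI[OF this, of "\<lambda>S. Suc ` S"] show ?thesis unfolding e[symmetric] ..
  qed
next
  fix S assume "S \<in> ?A \<union> ?B"
  then show "S \<in> ?L"
  proof
    assume "S \<in> ?A"
    then obtain T where T: "S = insert 0 (Suc ` T)" "T \<subseteq> {..<n}" "card T = k" by auto
    then have "finite T" using finite_subset by blast
    then have "card S = Suc k" using T by (simp add: card_image)
    then show ?thesis using T by auto
  next
    assume "S \<in> ?B"
    then show ?thesis by (auto simp: card_image)
  qed
qed

text \<open>Contraction is an antiderivation. Used as a recursion on the list of arguments, this replaces
  all reasoning about shuffles: the properties of the wedge product follow by induction, and products of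
  fixed degree are expanded by rewriting.\<close>

lemma wedge_Suc_Cons:
  "wedge (Suc k) \<alpha> \<beta> (v # vs) =
     wedge k (contract v \<alpha>) \<beta> vs + (-1) ^ Suc k * wedge (Suc k) \<alpha> (contract v \<beta>) vs"
proof -
  let ?n = "length vs"
  let ?f = "\<lambda>S. (-1) ^ card {(i, j). i \<in> S \<and> j \<in> {..<Suc ?n} - S \<and> j < i} *
        \<alpha> (nths (v # vs) S) * \<beta> (nths (v # vs) (- S))"
  let ?A = "{S. S \<subseteq> {..<?n} \<and> card S = k}" and ?B = "{S. S \<subseteq> {..<?n} \<and> card S = Suc k}"
  have inj1: "inj_on (\<lambda>S. insert 0 (Suc ` S)) ?A"
  proof (rule inj_onI)
    fix S T assume "insert 0 (Suc ` S) = insert 0 (Suc ` T)"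
    then have "Suc ` S = Suc ` T" by (auto dest: equalityD1 equalityD2)
    then show "S = T" by (simp add: inj_image_eq_iff)
  qed
  have inj2: "inj_on (\<lambda>S. Suc ` S) ?B" by (auto simp: inj_on_def inj_image_eq_iff)
  have "wedge (Suc k) \<alpha> \<beta> (v # vs) = sum ?f {S. S \<subseteq> {..<Suc ?n} \<and> card S = Suc k}"
    by (simp add: wedge_def)
  also have "\<dots> = sum ?f ((\<lambda>S. insert 0 (Suc ` S)) ` ?A) + sum ?f ((\<lambda>S. Suc ` S) ` ?B)"
    unfolding shuffle_index_Suc
    by (rule sum.union_disjoint) (auto intro: finite_imageI finite_wedge_index)
  also have "sum ?f ((\<lambda>S. insert 0 (Suc ` S)) ` ?A) = wedge k (contract v \<alpha>) \<beta> vs"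
    unfolding sum.reindex[OF inj1] wedge_def comp_def inversions_insert nths_Cons_insert
      nths_Cons_compl_insert contract_def ..
  also have "sum ?f ((\<lambda>S. Suc ` S) ` ?B) =
      (\<Sum>S\<in>?B. (-1) ^ Suc k * ((-1) ^ card {(i, j). i \<in> S \<and> j \<in> {..<?n} - S \<and> j < i} *
        \<alpha> (nths vs S) * contract v \<beta> (nths vs (- S))))"
    unfolding sum.reindex[OF inj2] comp_def
  proof (rule sum.cong)
    fix S assume S: "S \<in> ?B"
    then have fin: "finite S" using finite_subset by blast
    show "(-1) ^ card {(i, j). i \<in> Suc ` S \<and> j \<in> {..<Suc ?n} - Suc ` S \<and> j < i} *
        \<alpha> (nths (v # vs) (Suc ` S)) * \<beta> (nths (v # vs) (- Suc ` S)) =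
        (-1) ^ Suc k * ((-1) ^ card {(i, j). i \<in> S \<and> j \<in> {..<?n} - S \<and> j < i} *
        \<alpha> (nths vs S) * contract v \<beta> (nths vs (- S)))"
      unfolding inversions_image[OF fin] nths_Cons_image nths_Cons_compl_image contract_def
      using S by (simp add: power_add)
  qed simp
  also have "\<dots> = (-1) ^ Suc k * wedge (Suc k) \<alpha> (contract v \<beta>) vs"
    unfolding wedge_def sum_distrib_left[symmetric] ..
  finally show ?thesis .
qed

lemma wedge_Cons:
  "wedge k \<alpha> \<beta> (v # vs) =
     (if k = 0 then 0 else wedge (k - 1) (contract v \<alpha>) \<beta> vs) +
     (-1) ^ k * wedge k \<alpha> (contract v \<beta>) vs"
proof (cases k)
  case 0
  then show ?thesis by (simp add: wedge_0 contract_def)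
next
  case (Suc k')
  then show ?thesis using wedge_Suc_Cons[of k' \<alpha> \<beta> v vs] by simp
qed

lemma wedge_Nil: "wedge k \<alpha> \<beta> [] = (if k = 0 then \<alpha> [] * \<beta> [] else 0)"
  by (cases k) (simp_all add: wedge_0 wedge_Suc_Nil)

lemma wedge_lin_left:
  "wedge k (\<lambda>vs. a * \<alpha> vs + b * \<alpha>' vs) \<beta> vs = a * wedge k \<alpha> \<beta> vs + b * wedge k \<alpha>' \<beta> vs"
  by (simp add: wedge_def sum_distrib_left sum.distrib algebra_simps)

lemma wedge_lin_right:
  "wedge k \<alpha> (\<lambda>vs. a * \<beta> vs + b * \<beta>' vs) vs = a * wedge k \<alpha> \<beta> vs + b * wedge k \<alpha> \<beta>' vs"
  by (simp add: wedge_def sum_distrib_left sum.distrib algebra_simps)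

lemma wedge_zero_left [simp]: "wedge k (\<lambda>_. 0) \<beta> vs = 0"
  by (simp add: wedge_def)
lemma wedge_zero_right [simp]: "wedge k \<alpha> (\<lambda>_. 0) vs = 0"
  by (simp add: wedge_def)
lemma wedge_minus_left: "wedge k (\<lambda>vs. - \<alpha> vs) \<beta> vs = - wedge k \<alpha> \<beta> vs"
  by (simp add: wedge_def sum_negf)
lemma wedge_minus_right: "wedge k \<alpha> (\<lambda>vs. - \<beta> vs) vs = - wedge k \<alpha> \<beta> vs"
  by (simp add: wedge_def sum_negf)

lemma forms_zero:
  "\<alpha> \<in> forms k V \<Longrightarrow> length vs \<noteq> k \<or> \<not> set vs \<subseteq> V \<Longrightarrow> \<alpha> vs = 0"
  by (auto simp: forms_def)

lemma forms_alt: "\<alpha> \<in> forms k V \<Longrightarrow> \<not> distinct vs \<Longrightarrow> \<alpha> vs = 0"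
  by (auto simp: forms_def)

lemma forms_lin:
  assumes "\<alpha> \<in> forms k V" "x \<in> V" "y \<in> V" and sub: "subspace V"
  shows "\<alpha> (us @ (a *\<^sub>R x + b *\<^sub>R y) # ws) = a * \<alpha> (us @ x # ws) + b * \<alpha> (us @ y # ws)"
proof (cases "length us + length ws + 1 = k \<and> set us \<subseteq> V \<and> set ws \<subseteq> V")
  case True
  then show ?thesis using assms by (simp add: forms_def)
next
  case False
  have "a *\<^sub>R x + b *\<^sub>R y \<in> V" using assms by (simp add: subspace_add subspace_scale)
  then show ?thesis using False assms forms_zero[OF assms(1)] by auto
qed

text \<open>Polarisation of the vanishing on lists with a repeated entry.\<close>

lemma forms_swap:
  assumes \<alpha>: "\<alpha> \<in> forms k V" and sub: "subspace V"
  shows "\<alpha> (us @ x # y # ws) = - \<alpha> (us @ y # x # ws)"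
proof (cases "x \<in> V \<and> y \<in> V")
  case True
  then have xy: "x \<in> V" "y \<in> V" and s: "x + y \<in> V" using sub by (auto simp: subspace_add)
  have 1: "\<alpha> (us @ (x + y) # z # ws) = \<alpha> (us @ x # z # ws) + \<alpha> (us @ y # z # ws)" for z
    using forms_lin[OF \<alpha> xy sub, of us 1 1 "z # ws"] by simp
  have 2: "\<alpha> (us @ z # (x + y) # ws) = \<alpha> (us @ z # x # ws) + \<alpha> (us @ z # y # ws)" for z
    using forms_lin[OF \<alpha> xy sub, of "us @ [z]" 1 1 "ws"] by simp
  have 0: "\<alpha> (us @ z # z # ws) = 0" for z
    by (rule forms_alt[OF \<alpha>]) simp
  show ?thesis using 1[of "x + y"] 2[of x] 2[of y] 0[of "x+y"] 0[of x] 0[of y] by simp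
next
  case False
  then show ?thesis using forms_zero[OF \<alpha>] by auto
qed

lemma forms_contract:
  assumes "\<alpha> \<in> forms (Suc k) V" shows "contract v \<alpha> \<in> forms k V"
proof (cases "v \<in> V")
  case True
  show ?thesis
    unfolding forms_def contract_def mem_Collect_eq
  proof (intro conjI allI impI ballI)
    fix us ws x y and a b :: real assume "x \<in> V" "y \<in> V" and
      *: "length us + length ws + 1 = k \<and> set us \<subseteq> V \<and> set ws \<subseteq> V"
    have "\<forall>us ws. \<forall>x\<in>V. \<forall>y\<in>V. \<forall>a b. length us + length ws + 1 = Suc k \<and> set us \<subseteq> V \<and> set ws \<subseteq> V \<longrightarrow>
        \<alpha> (us @ (a *\<^sub>R x + b *\<^sub>R y) # ws) = a * \<alpha> (us @ x # ws) + b * \<alpha> (us @ y # ws)"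
      using assms by (simp add: forms_def)
    from this[rule_format, of x y "v # us" ws a b]
    show "\<alpha> (v # us @ (a *\<^sub>R x + b *\<^sub>R y) # ws) = a * \<alpha> (v # us @ x # ws) + b * \<alpha> (v # us @ y # ws)"
      using * \<open>x \<in> V\<close> \<open>y \<in> V\<close> True by simp
  qed (use forms_zero[OF assms] forms_alt[OF assms] True in auto)
next
  case False
  then have "contract v \<alpha> = (\<lambda>_. 0)" using forms_zero[OF assms] by (auto simp: contract_def)
  then show ?thesis by (simp add: forms_def)
qed

lemma forms_contract_notin:
  assumes "\<alpha> \<in> forms k V" "v \<notin> V" shows "contract v \<alpha> = (\<lambda>_. 0)"
  using forms_zero[OF assms(1)] assms(2) by (auto simp: contract_def)

lemma forms_contract_lin:
  assumes "\<alpha> \<in> forms k V" "x \<in> V" "y \<in> V" "subspace V"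
  shows "contract (a *\<^sub>R x + b *\<^sub>R y) \<alpha> = (\<lambda>vs. a * contract x \<alpha> vs + b * contract y \<alpha> vs)"
  using forms_lin[OF assms(1-4), of "[]" a b] by (auto simp: contract_def)

lemma forms_0_contract: "\<alpha> \<in> forms 0 V \<Longrightarrow> contract v \<alpha> = (\<lambda>_. 0)"
  by (auto simp: forms_def contract_def)

lemma forms_contract2_swap:
  assumes "\<alpha> \<in> forms k V" "subspace V"
  shows "contract y (contract x \<alpha>) = (\<lambda>vs. - contract x (contract y \<alpha>) vs)"
proof
  fix vs show "contract y (contract x \<alpha>) vs = - contract x (contract y \<alpha>) vs"
    using forms_swap[OF assms, of "[]" x y vs] by (simp only: contract_def append_Nil)
qed

lemma wedge_wrong:
  assumes "\<alpha> \<in> forms k V" "\<beta> \<in> forms l V" "length vs \<noteq> k + l \<or> \<not> set vs \<subseteq> V"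
  shows "wedge k \<alpha> \<beta> vs = 0"
  using assms
proof (induction vs arbitrary: k l \<alpha> \<beta>)
  case Nil
  then show ?case using forms_zero[OF Nil(2)] by (auto simp: wedge_Nil)
next
  case (Cons v vs)
  have z0: "wedge 0 \<alpha> \<beta> (v # vs) = 0" if "k = 0"
    using that Cons.prems forms_zero[OF Cons.prems(2)] by (auto simp: wedge_0)
  show ?case
  proof (cases k)
    case 0 then show ?thesis using z0 by simp
  next
    case (Suc k')
    have 1: "wedge k' (contract v \<alpha>) \<beta> vs = 0"
    proof (cases "v \<in> V")
      case True
      show ?thesis
        by (rule Cons.IH[OF forms_contract Cons.prems(2)]) (use Cons.prems Suc True in auto)
    next
      case False
      then show ?thesis using forms_contract_notin[OF Cons.prems(1)] by simp
    qed
    have 2: "wedge k \<alpha> (contract v \<beta>) vs = 0"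
    proof (cases "v \<in> V \<and> l \<noteq> 0")
      case True
      then obtain l' where l: "l = Suc l'" by (cases l) auto
      show ?thesis
        by (rule Cons.IH[OF Cons.prems(1) forms_contract]) (use Cons.prems l True in auto)
    next
      case False
      then have "contract v \<beta> = (\<lambda>_. 0)"
        using forms_contract_notin[OF Cons.prems(2)] forms_0_contract[of \<beta> V v] Cons.prems(2)
        by (cases "v \<in> V") auto
      then show ?thesis by simp
    qed
    show ?thesis using 1 2 Suc by (simp add: wedge_Suc_Cons)
  qed
qed

lemma contract_in_forms_cases:
  assumes "\<beta> \<in> forms l V"
  obtains l' where "contract v \<beta> \<in> forms l' V" "l = Suc l'" | "l = 0" "contract v \<beta> = (\<lambda>_. 0)"
  using assms forms_contract forms_0_contract by (metis not0_implies_Suc)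

text \<open>The contractions by two vectors anticommute, and by the recursion this passes to the product.\<close>

lemma wedge_swap_front:
  assumes "\<alpha> \<in> forms k V" "\<beta> \<in> forms l V" "subspace V"
  shows "wedge k \<alpha> \<beta> (x # y # ws) = - wedge k \<alpha> \<beta> (y # x # ws)"
proof -
  have e: "wedge j (contract y (contract x \<alpha>)) \<beta> ws = - wedge j (contract x (contract y \<alpha>)) \<beta> ws" for j
    by (subst forms_contract2_swap[OF assms(1,3)]) (rule wedge_minus_left)
  have f: "wedge j \<alpha> (contract y (contract x \<beta>)) ws = - wedge j \<alpha> (contract x (contract y \<beta>)) ws" for j
    by (subst forms_contract2_swap[OF assms(2,3)]) (rule wedge_minus_right)
  show ?thesis
  proof (cases k)
    case 0
    then show ?thesis using f[of 0] by (simp add: wedge_0 contract_def)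
  next
    case (Suc k')
    show ?thesis
    proof (cases k')
      case 0
      then show ?thesis using f[of k] unfolding Suc by (simp add: wedge_Suc_Cons wedge_0) (simp add: contract_def)
    next
      case (Suc k'')
      then show ?thesis using f[of k] e[of k''] unfolding \<open>k = Suc k'\<close>
        by (simp add: wedge_Suc_Cons algebra_simps)
    qed
  qed
qed

text \<open>The second copy of the repeated vector is brought to the front by transpositions.\<close>

lemma wedge_repeat_front:
  assumes "\<alpha> \<in> forms k V" "\<beta> \<in> forms l V" "subspace V" "x \<in> set ws"
  shows "wedge k \<alpha> \<beta> (x # ws) = 0"
  using assms(1,2,4)
proof (induction ws arbitrary: k l \<alpha> \<beta>)
  case (Cons y ws)
  show ?case
  proof (cases "x = y")
    case True
    then show ?thesis using wedge_swap_front[OF Cons.prems(1,2) assms(3), of x x ws] by simp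
  next
    case False
    then have x: "x \<in> set ws" using Cons.prems by simp
    have 2: "wedge k \<alpha> (contract y \<beta>) (x # ws) = 0"
      using contract_in_forms_cases[OF Cons.prems(2), of y]
      by cases (auto intro: Cons.IH[OF Cons.prems(1) _ x])
    have 1: "wedge k' (contract y \<alpha>) \<beta> (x # ws) = 0" if "k = Suc k'" for k'
      using Cons.IH[OF forms_contract Cons.prems(2) x] Cons.prems(1) that by blast
    have "wedge k \<alpha> \<beta> (y # x # ws) = 0"
      by (cases k) (use 1 2 in \<open>simp_all add: wedge_Suc_Cons[of _ _ _ y] wedge_0 contract_def\<close>)
    then show ?thesis using wedge_swap_front[OF Cons.prems(1,2) assms(3), of x y ws] by simp
  qed
qed simp

lemma wedge_alt:
  assumes "\<alpha> \<in> forms k V" "\<beta> \<in> forms l V" "subspace V" "\<not> distinct vs"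
  shows "wedge k \<alpha> \<beta> vs = 0"
  using assms(1,2,4)
proof (induction vs arbitrary: k l \<alpha> \<beta>)
  case (Cons y ws)
  show ?case
  proof (cases "y \<in> set ws")
    case True
    then show ?thesis using wedge_repeat_front[OF Cons.prems(1,2) assms(3)] by simp
  next
    case False
    then have x: "\<not> distinct ws" using Cons.prems by simp
    have 2: "wedge k \<alpha> (contract y \<beta>) ws = 0"
      using contract_in_forms_cases[OF Cons.prems(2), of y]
      by cases (auto intro: Cons.IH[OF Cons.prems(1) _ x])
    have 1: "wedge k' (contract y \<alpha>) \<beta> ws = 0" if "k = Suc k'" for k'
      using Cons.IH[OF forms_contract Cons.prems(2) x] Cons.prems(1) that by blast
    show ?thesis
      by (cases k) (use 1 2 in \<open>simp_all add: wedge_Suc_Cons wedge_0 contract_def\<close>)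
  qed
qed simp

lemma wedge_lin:
  assumes "\<alpha> \<in> forms k V" "\<beta> \<in> forms l V" "subspace V" "x \<in> V" "y \<in> V"
  shows "wedge k \<alpha> \<beta> (us @ (a *\<^sub>R x + b *\<^sub>R y) # ws) =
     a * wedge k \<alpha> \<beta> (us @ x # ws) + b * wedge k \<alpha> \<beta> (us @ y # ws)"
  using assms(1,2)
proof (induction us arbitrary: k l \<alpha> \<beta>)
  case Nil
  show ?case
    unfolding append_Nil wedge_Cons[of k \<alpha> \<beta>] forms_contract_lin[OF Nil(1) assms(4,5,3)]
      forms_contract_lin[OF Nil(2) assms(4,5,3)] wedge_lin_left wedge_lin_right
    by (simp add: algebra_simps)
next
  case (Cons v us)
  have 2: "wedge k \<alpha> (contract v \<beta>) (us @ (a *\<^sub>R x + b *\<^sub>R y) # ws) =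
     a * wedge k \<alpha> (contract v \<beta>) (us @ x # ws) + b * wedge k \<alpha> (contract v \<beta>) (us @ y # ws)"
    using contract_in_forms_cases[OF Cons.prems(2), of v]
    by cases (auto intro: Cons.IH[OF Cons.prems(1)])
  have 1: "wedge k' (contract v \<alpha>) \<beta> (us @ (a *\<^sub>R x + b *\<^sub>R y) # ws) =
     a * wedge k' (contract v \<alpha>) \<beta> (us @ x # ws) + b * wedge k' (contract v \<alpha>) \<beta> (us @ y # ws)"
    if "k = Suc k'" for k'
    using Cons.IH[OF forms_contract Cons.prems(2)] Cons.prems(1) that by blast
  show ?case
  proof (cases k)
    case 0
    then show ?thesis using 2 by (simp add: wedge_Cons)
  next
    case (Suc k')
    show ?thesis using 2 1[OF Suc] unfolding append_Cons wedge_Cons[of k \<alpha> \<beta>] using Suc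
      by (simp add: algebra_simps)
  qed
qed

lemma wedge_forms:
  assumes "\<alpha> \<in> forms k V" "\<beta> \<in> forms l V" "subspace V"
  shows "wedge k \<alpha> \<beta> \<in> forms (k + l) V"
  unfolding forms_def mem_Collect_eq
  using wedge_lin[OF assms] wedge_alt[OF assms] wedge_wrong[OF assms(1,2)] by auto

lemma forms_move_front:
  assumes "\<alpha> \<in> forms k V" "subspace V"
  shows "\<alpha> (us @ as @ x # bs) = 0 \<longleftrightarrow> \<alpha> (us @ x # as @ bs) = 0"
proof (induction as arbitrary: us)
  case (Cons a as)
  show ?case using Cons[of "us @ [a]"] forms_swap[OF assms, of us a x "as @ bs"] by simp
qed simp

text \<open>Only the vanishing of a value matters for the next lemmas, so the sign of the permutation need
  not be tracked.\<close>

lemma forms_mset: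
  assumes "\<alpha> \<in> forms k V" "subspace V" "mset xs = mset ys" "\<alpha> (us @ ys) = 0"
  shows "\<alpha> (us @ xs) = 0"
  using assms(3,4)
proof (induction xs arbitrary: ys us)
  case (Cons x xs)
  then have "x \<in> set ys" by (metis list.set_intros(1) set_mset_mset)
  then obtain as bs where ys: "ys = as @ x # bs" by (meson split_list)
  have "mset xs = mset (as @ bs)" using Cons.prems(1) ys by simp
  moreover have "\<alpha> ((us @ [x]) @ as @ bs) = 0"
    using forms_move_front[OF assms(1,2), of us as x bs] Cons.prems(2) ys by simp
  ultimately show ?case using Cons.IH[of "as @ bs" "us @ [x]"] by simp
qed simp

lemma distinct_sublist_mset:
  assumes "distinct bs" "distinct xs" "set xs \<subseteq> set bs"
  shows "\<exists>ys\<in>set (subseqs bs). mset ys = mset xs"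
proof -
  obtain ys where ys: "ys \<in> set (subseqs bs)" "set ys = set xs"
    using subset_subseqs[OF assms(3)] by (metis imageE)
  have "distinct ys" using subseqs_distinctD[OF ys(1) assms(1)] .
  then have "mset ys = mset xs" using assms(2) ys(2) set_eq_iff_mset_eq_distinct by blast
  then show ?thesis using ys(1) by blast
qed

lemma forms_eq_zeroI:
  assumes \<alpha>: "\<alpha> \<in> forms k V" and V: "V = span (set bs)" and d: "distinct bs"
    and z: "\<And>vs. vs \<in> set (subseqs bs) \<Longrightarrow> length vs = k \<Longrightarrow> \<alpha> vs = 0"
  shows "\<alpha> = (\<lambda>_. 0)"
proof
  have sub: "subspace V" using V by simp
  have B: "\<alpha> vs = 0" if vs: "set vs \<subseteq> set bs" for vs
  proof (cases "distinct vs \<and> length vs = k")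
    case True
    then obtain ys where ys: "ys \<in> set (subseqs bs)" "mset ys = mset vs"
      using distinct_sublist_mset[OF d _ vs] by auto
    have "length ys = k" using True mset_eq_length[OF ys(2)] by simp
    with z[OF ys(1)] have "\<alpha> ([] @ ys) = 0" by simp
    then show ?thesis using forms_mset[OF \<alpha> sub ys(2)[symmetric], of "[]"] by simp
  next
    case False
    then show ?thesis using forms_alt[OF \<alpha>, of vs] forms_zero[OF \<alpha>, of vs] by auto
  qed
  have G: "\<alpha> (us @ ws) = 0" if "set us \<subseteq> set bs" "set ws \<subseteq> V" for us ws
    using that
  proof (induction ws arbitrary: us)
    case Nil then show ?case using B by simp
  next
    case (Cons w ws)
    have "w \<in> span (set bs)" using Cons.prems V by simp
    then have "w \<in> V \<and> \<alpha> (us @ w # ws) = 0"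
    proof (induction w rule: span_induct_alt)
      case base
      have "0 \<in> V" using sub by (simp add: subspace_0)
      then show ?case using forms_lin[OF \<alpha> _ _ sub, of 0 0 us 0 0 ws] by simp
    next
      case (step c x y)
      have xy: "x \<in> V" "y \<in> V" using step V by (auto intro: span_base)
      then have "\<alpha> (us @ (c *\<^sub>R x + 1 *\<^sub>R y) # ws) = c * \<alpha> (us @ x # ws) + 1 * \<alpha> (us @ y # ws)"
        by (rule forms_lin[OF \<alpha> _ _ sub])
      moreover have "\<alpha> (us @ x # ws) = 0"
        using Cons.IH[of "us @ [x]"] Cons.prems step by simp
      moreover have "c *\<^sub>R x + y \<in> V" using xy sub by (simp add: subspace_add subspace_scale)
      ultimately show ?case using step by simp
    qed
    then show ?case ..
  qed
  fix vs show "\<alpha> vs = 0"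
  proof (cases "set vs \<subseteq> V")
    case True then show ?thesis using G[of "[]" vs] by simp
  next
    case False then show ?thesis using forms_zero[OF \<alpha>, of vs] by simp
  qed
qed

lemma forms_diff:
  assumes "\<alpha> \<in> forms k V" "\<beta> \<in> forms k V"
  shows "(\<lambda>vs. \<alpha> vs - \<beta> vs) \<in> forms k V"
  using assms unfolding forms_def mem_Collect_eq by (simp add: algebra_simps)

text \<open>This is how identities between forms are checked: on the increasing tuples of a frame.\<close>

lemma forms_eqI:
  assumes "\<alpha> \<in> forms k V" "\<beta> \<in> forms k V" "V = span (set bs)" "distinct bs"
    and "\<And>vs. vs \<in> set (subseqs bs) \<Longrightarrow> length vs = k \<Longrightarrow> \<alpha> vs = \<beta> vs"
  shows "\<alpha> = \<beta>"
  using forms_eq_zeroI[OF forms_diff[OF assms(1,2)] assms(3,4)] assms(5)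
  by (simp add: fun_eq_iff)

text \<open>The products of forms that occur below, written out as sums over shuffles.\<close>

lemma wedge_2_2:
  "wedge 2 \<alpha> \<beta> [a, b, c, d] =
    \<alpha> [a, b] * \<beta> [c, d] - \<alpha> [a, c] * \<beta> [b, d] + \<alpha> [a, d] * \<beta> [b, c]
     + \<alpha> [b, c] * \<beta> [a, d] - \<alpha> [b, d] * \<beta> [a, c] + \<alpha> [c, d] * \<beta> [a, b]"
  by (simp add: eval_nat_numeral wedge_Suc_Cons wedge_0 wedge_Suc_Nil contract_def)

lemma wedge_2_3:
  "wedge 2 \<alpha> \<beta> [a, b, c, d, e] =
    \<alpha> [a, b] * \<beta> [c, d, e] - \<alpha> [a, c] * \<beta> [b, d, e] + \<alpha> [a, d] * \<beta> [b, c, e]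
     - \<alpha> [a, e] * \<beta> [b, c, d] + \<alpha> [b, c] * \<beta> [a, d, e] - \<alpha> [b, d] * \<beta> [a, c, e]
     + \<alpha> [b, e] * \<beta> [a, c, d] + \<alpha> [c, d] * \<beta> [a, b, e] - \<alpha> [c, e] * \<beta> [a, b, d]
     + \<alpha> [d, e] * \<beta> [a, b, c]"
  by (simp add: eval_nat_numeral wedge_Suc_Cons wedge_0 wedge_Suc_Nil contract_def)

lemma wedge_4_2:
  "wedge 4 \<alpha> \<beta> [a, b, c, d, e, f] =
    \<alpha> [a, b, c, d] * \<beta> [e, f] - \<alpha> [a, b, c, e] * \<beta> [d, f] + \<alpha> [a, b, c, f] * \<beta> [d, e]
     + \<alpha> [a, b, d, e] * \<beta> [c, f] - \<alpha> [a, b, d, f] * \<beta> [c, e] + \<alpha> [a, b, e, f] * \<beta> [c, d]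
     - \<alpha> [a, c, d, e] * \<beta> [b, f] + \<alpha> [a, c, d, f] * \<beta> [b, e] - \<alpha> [a, c, e, f] * \<beta> [b, d]
     + \<alpha> [a, d, e, f] * \<beta> [b, c] + \<alpha> [b, c, d, e] * \<beta> [a, f] - \<alpha> [b, c, d, f] * \<beta> [a, e]
     + \<alpha> [b, c, e, f] * \<beta> [a, d] - \<alpha> [b, d, e, f] * \<beta> [a, c] + \<alpha> [c, d, e, f] * \<beta> [a, b]"
  by (simp add: eval_nat_numeral wedge_Suc_Cons wedge_0 wedge_Suc_Nil contract_def)

lemma wedge_3_3:
  "wedge 3 \<alpha> \<beta> [a, b, c, d, e, f] =
    \<alpha> [a, b, c] * \<beta> [d, e, f] - \<alpha> [a, b, d] * \<beta> [c, e, f] + \<alpha> [a, b, e] * \<beta> [c, d, f]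
     - \<alpha> [a, b, f] * \<beta> [c, d, e] + \<alpha> [a, c, d] * \<beta> [b, e, f] - \<alpha> [a, c, e] * \<beta> [b, d, f]
     + \<alpha> [a, c, f] * \<beta> [b, d, e] + \<alpha> [a, d, e] * \<beta> [b, c, f] - \<alpha> [a, d, f] * \<beta> [b, c, e]
     + \<alpha> [a, e, f] * \<beta> [b, c, d] - \<alpha> [b, c, d] * \<beta> [a, e, f] + \<alpha> [b, c, e] * \<beta> [a, d, f]
     - \<alpha> [b, c, f] * \<beta> [a, d, e] - \<alpha> [b, d, e] * \<beta> [a, c, f] + \<alpha> [b, d, f] * \<beta> [a, c, e]
     - \<alpha> [b, e, f] * \<beta> [a, c, d] + \<alpha> [c, d, e] * \<beta> [a, b, f] - \<alpha> [c, d, f] * \<beta> [a, b, e]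
     + \<alpha> [c, e, f] * \<beta> [a, b, d] - \<alpha> [d, e, f] * \<beta> [a, b, c]"
  by (simp add: eval_nat_numeral wedge_Suc_Cons wedge_0 wedge_Suc_Nil contract_def)

section \<open>The trace on a subspace\<close>
text \<open>The trace in a subspace refers to an arbitrary basis of it. Expanding that basis in the
  image of the standard basis under a parametrisation shows that the choice does not matter.\<close>

lemma trace_on_conjugate:
  fixes \<theta> :: "'e::euclidean_space \<Rightarrow> 'a::euclidean_space"
  assumes lin: "linear \<theta>" and inj: "inj \<theta>" and V: "range \<theta> = V"
    and g: "linear g" and f: "\<And>x. f (\<theta> x) = \<theta> (g x)"
  shows "trace_on V f = (\<Sum>d\<in>Basis. g d \<bullet> d)"
proof -
  define B where "B = (SOME B. independent B \<and> span B = V)"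
  have sub: "subspace V" using linear_subspace_image[OF lin subspace_UNIV] V by simp
  obtain B' where "B' \<subseteq> V" "independent B'" "V \<subseteq> span B'" by (rule basis_exists)
  then have "\<exists>B. independent B \<and> span B = V" using span_subspace[OF _ _ sub, of B'] by auto
  from someI_ex[OF this] have B: "independent B" "span B = V" unfolding B_def by auto
  have fin: "finite B" using independent_bound[OF B(1)] by simp
  obtain \<eta> where \<eta>: "linear \<eta>" "\<eta> \<circ> \<theta> = id"
    using linear_injective_left_inverse[OF lin inj] by blast
  have \<eta>\<theta>: "\<eta> (\<theta> x) = x" for x using \<eta>(2) by (metis comp_apply id_apply)
  have \<theta>\<eta>: "\<theta> (\<eta> v) = v" if "v \<in> V" for v using that V \<eta>\<theta> by auto
  have inV: "\<theta> x \<in> span B" for x using B V by auto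
  have rep: "representation B (f b) b = (\<Sum>d\<in>Basis. (\<eta> b \<bullet> d) * representation B (\<theta> (g d)) b)"
    if b: "b \<in> B" for b
  proof -
    have "b \<in> V" using span_base[OF b] B by simp
    have "f b = \<theta> (g (\<eta> b))" using f[of "\<eta> b"] \<theta>\<eta>[OF \<open>b \<in> V\<close>] by simp
    also have "\<eta> b = (\<Sum>d\<in>Basis. (\<eta> b \<bullet> d) *\<^sub>R d)" by (simp add: euclidean_representation)
    also have "\<theta> (g \<dots>) = (\<Sum>d\<in>Basis. (\<eta> b \<bullet> d) *\<^sub>R \<theta> (g d))"
      by (simp add: linear_sum[OF lin] linear_sum[OF g] linear_scale[OF lin] linear_scale[OF g])
    finally have fb: "f b = (\<Sum>d\<in>Basis. (\<eta> b \<bullet> d) *\<^sub>R \<theta> (g d))" .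
    show ?thesis unfolding fb
      by (simp add: representation_sum[OF B(1)] representation_scale[OF B(1)] inV span_scale)
  qed
  have "trace_on V f = (\<Sum>b\<in>B. representation B (f b) b)"
    by (simp add: trace_on_def B_def Let_def)
  also have "\<dots> = (\<Sum>b\<in>B. \<Sum>d\<in>Basis. (\<eta> b \<bullet> d) * representation B (\<theta> (g d)) b)"
    by (rule sum.cong) (auto simp: rep)
  also have "\<dots> = (\<Sum>d\<in>Basis. \<Sum>b\<in>B. (\<eta> b \<bullet> d) * representation B (\<theta> (g d)) b)"
    by (rule sum.swap)
  also have "\<dots> = (\<Sum>d\<in>Basis. g d \<bullet> d)"
  proof (rule sum.cong)
    fix d :: 'e assume "d \<in> Basis"
    have "(\<Sum>b\<in>B. representation B (\<theta> (g d)) b *\<^sub>R b) = \<theta> (g d)"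
      by (rule sum_representation_eq[OF B(1) inV fin order_refl])
    then have "g d = \<eta> (\<Sum>b\<in>B. representation B (\<theta> (g d)) b *\<^sub>R b)" using \<eta>\<theta> by simp
    also have "\<dots> = (\<Sum>b\<in>B. representation B (\<theta> (g d)) b *\<^sub>R \<eta> b)"
      by (simp add: linear_sum[OF \<eta>(1)] linear_scale[OF \<eta>(1)])
    finally have "g d = (\<Sum>b\<in>B. representation B (\<theta> (g d)) b *\<^sub>R \<eta> b)" .
    then have "g d \<bullet> d = (\<Sum>b\<in>B. representation B (\<theta> (g d)) b *\<^sub>R \<eta> b) \<bullet> d" by simp
    also have "\<dots> = (\<Sum>b\<in>B. (\<eta> b \<bullet> d) * representation B (\<theta> (g d)) b)"
      by (simp add: inner_sum_left mult.commute)
    finally show "(\<Sum>b\<in>B. (\<eta> b \<bullet> d) * representation B (\<theta> (g d)) b) = g d \<bullet> d" by simp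
  qed simp
  finally show ?thesis .
qed

section \<open>The group and its tangent spaces\<close>

unbundle cross3_syntax

lemma mat2_eq_iff: "(A::mat2) = B \<longleftrightarrow> A$1$1 = B$1$1 \<and> A$1$2 = B$1$2 \<and> A$2$1 = B$2$1 \<and> A$2$2 = B$2$2"
  by (auto simp: vec_eq_iff forall_2)

lemma mat2_mult_nth: "((A::mat2) ** B) $ i $ j = A$i$1 * B$1$j + A$i$2 * B$2$j"
  by (simp add: matrix_matrix_mult_def sum_2)

lemma mat2_one_nth: "(mat 1 :: mat2) $ 1 $ 1 = 1" "(mat 1 :: mat2) $ 1 $ 2 = 0"
   "(mat 1 :: mat2) $ 2 $ 1 = 0" "(mat 1 :: mat2) $ 2 $ 2 = 1"
  by (simp_all add: mat_def)

definition mstar :: "mat2 \<Rightarrow> mat2" where "mstar A = (\<chi> i j. cnj (A $ j $ i))"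

lemma mstar_nth [simp]: "mstar A $ i $ j = cnj (A $ j $ i)"
  by (simp add: mstar_def)

text \<open>The inverse of a unitary matrix of determinant 1 is both its adjoint and its adjugate, so
  \<open>SU(2)\<close> is the unit sphere in the real linear space of quaternions.\<close>

lemma SU2_iff:
  "A \<in> SU2 \<longleftrightarrow> A$2$2 = cnj (A$1$1) \<and> A$2$1 = - cnj (A$1$2) \<and> A$1$1 * cnj (A$1$1) + A$1$2 * cnj (A$1$2) = 1"
    (is "_ \<longleftrightarrow> ?R")
proof
  assume "A \<in> SU2"
  then have "A ** mstar A = mat 1" "det A = 1" by (auto simp: SU2_def mstar_def)
  then have 1: "A$1$1 * cnj (A$1$1) + A$1$2 * cnj (A$1$2) = 1"
    and 2: "A$1$1 * cnj (A$2$1) + A$1$2 * cnj (A$2$2) = 0"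
    and 4: "A$1$1 * A$2$2 - A$1$2 * A$2$1 = 1"
    by (auto simp: mat2_eq_iff mat2_mult_nth mat2_one_nth det_2)
  have 3: "cnj (A$1$1) * A$2$1 + cnj (A$1$2) * A$2$2 = 0"
    using arg_cong[OF 2, of cnj] by simp
  have "cnj (A$1$1) = cnj (A$1$1) * (A$1$1 * A$2$2 - A$1$2 * A$2$1)" using 4 by simp
  also have "\<dots> = (A$1$1 * cnj (A$1$1) + A$1$2 * cnj (A$1$2)) * A$2$2 -
      A$1$2 * (cnj (A$1$1) * A$2$1 + cnj (A$1$2) * A$2$2)" by (simp add: algebra_simps)
  also have "\<dots> = A$2$2" using 1 3 by simp
  finally have a: "A$2$2 = cnj (A$1$1)" by simp
  have "cnj (A$1$2) = cnj (A$1$2) * (A$1$1 * A$2$2 - A$1$2 * A$2$1)" using 4 by simp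
  also have "\<dots> = A$1$1 * (cnj (A$1$1) * A$2$1 + cnj (A$1$2) * A$2$2) -
      (A$1$1 * cnj (A$1$1) + A$1$2 * cnj (A$1$2)) * A$2$1" by (simp add: algebra_simps)
  also have "\<dots> = - A$2$1" using 1 3 by simp
  finally have b: "A$2$1 = - cnj (A$1$2)" by simp
  show ?R using a b 1 by simp
next
  assume ?R
  then have "A ** mstar A = mat 1" "det A = 1"
    by (auto simp: mat2_eq_iff mat2_mult_nth mat2_one_nth det_2 algebra_simps)
  then show "A \<in> SU2" by (simp add: SU2_def mstar_def)
qed

lemma SU2_mult: "A \<in> SU2 \<Longrightarrow> B \<in> SU2 \<Longrightarrow> A ** B \<in> SU2"
proof -
  assume a: "A \<in> SU2" and b: "B \<in> SU2"
  have 1: "(A ** B) ** mstar (A ** B) = A ** (B ** mstar B) ** mstar A"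
    by (simp add: mat2_eq_iff mat2_mult_nth algebra_simps)
  show ?thesis using a b 1 by (auto simp: SU2_def mstar_def[symmetric] det_mul)
qed

lemma SU2_one: "mat 1 \<in> SU2" by (simp add: SU2_iff mat2_one_nth)

lemma SU2_mstar: "A \<in> SU2 \<Longrightarrow> mstar A \<in> SU2"
  by (simp add: SU2_iff algebra_simps)

lemma SU2_inv: "A \<in> SU2 \<Longrightarrow> mstar A ** A = mat 1" "A \<in> SU2 \<Longrightarrow> A ** mstar A = mat 1"
  by (auto simp: SU2_iff mat2_eq_iff mat2_mult_nth mat2_one_nth algebra_simps)

lemma bounded_bilinear_gmult: "bounded_bilinear gmult"
proof -
  have "bilinear gmult"
    unfolding bilinear_def gmult_def
    by (auto intro!: linearI simp: mat2_eq_iff mat2_mult_nth algebra_simps)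
  then show ?thesis by (simp add: bilinear_conv_bounded_bilinear)
qed

lemma linear_gmult: "linear (gmult g)" "linear (\<lambda>g. gmult g x)"
proof -
  have "bilinear gmult" using bounded_bilinear_gmult by (simp only: bilinear_conv_bounded_bilinear)
  then show "linear (gmult g)" "linear (\<lambda>g. gmult g x)" unfolding bilinear_def by blast+
qed

lemma gmult_assoc: "gmult (gmult a b) c = gmult a (gmult b c)"
  by (simp add: gmult_def matrix_mul_assoc)

lemma gone_gmult [simp]: "gmult gone x = x" by (simp add: gone_def gmult_def)

text \<open>On the group this is the inverse; unlike the inverse it is real linear on the ambient space, hence
  smooth for trivial reasons.\<close>

definition gstar :: "mat2 \<times> mat2 \<Rightarrow> mat2 \<times> mat2" where "gstar p = (mstar (fst p), mstar (snd p))"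

lemma linear_gstar: "linear gstar"
  by (auto intro!: linearI simp: gstar_def mat2_eq_iff)

lemma gstar_mem: "p \<in> SU2xSU2 \<Longrightarrow> gstar p \<in> SU2xSU2"
  by (auto simp: gstar_def SU2xSU2_def SU2_mstar)

lemma gmult_mem: "p \<in> SU2xSU2 \<Longrightarrow> q \<in> SU2xSU2 \<Longrightarrow> gmult p q \<in> SU2xSU2"
  by (auto simp: gmult_def SU2xSU2_def SU2_mult)

lemma gone_mem: "gone \<in> SU2xSU2" by (simp add: gone_def SU2xSU2_def SU2_one)

lemma gstar_gmult: "p \<in> SU2xSU2 \<Longrightarrow> gmult (gstar p) (gmult p x) = x"
   "p \<in> SU2xSU2 \<Longrightarrow> gmult p (gmult (gstar p) x) = x"
   "p \<in> SU2xSU2 \<Longrightarrow> gmult (gstar p) p = gone"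
  by (auto simp: gstar_def SU2xSU2_def gmult_def matrix_mul_assoc SU2_inv gone_def)

text \<open>The value at \<open>x\<close> is \<open>- (i/2) (x\<^sub>1 \<sigma>\<^sub>1 + x\<^sub>2 \<sigma>\<^sub>2 + x\<^sub>3 \<sigma>\<^sub>3)\<close> with the Pauli matrices \<open>\<sigma>\<^sub>i\<close>; the factor is
  chosen so that the commutator becomes the cross product.\<close>

definition tau :: "real^3 \<Rightarrow> mat2" where
  "tau x = vector [vector [Complex 0 (- x$3 / 2), Complex (- x$2 / 2) (- x$1 / 2)],
                   vector [Complex (x$2 / 2) (- x$1 / 2), Complex 0 (x$3 / 2)]]"

lemma tau_nth [simp]:
  "tau x $ 1 $ 1 = Complex 0 (- x$3 / 2)" "tau x $ 1 $ 2 = Complex (- x$2 / 2) (- x$1 / 2)"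
  "tau x $ 2 $ 1 = Complex (x$2 / 2) (- x$1 / 2)" "tau x $ 2 $ 2 = Complex 0 (x$3 / 2)"
  by (simp_all add: tau_def vector_2)

lemma linear_tau: "linear tau"
  by (rule linearI) (auto simp: mat2_eq_iff complex_eq_iff field_simps)

lemma inj_tau: "inj tau"
  by (rule injI) (auto simp: mat2_eq_iff vec_eq_iff forall_3)

lemma tau_cross: "tau x ** tau y - tau y ** tau x = tau (x \<times> y)"
  by (auto simp: mat2_eq_iff mat2_mult_nth complex_eq_iff cross3_simps field_simps)

text \<open>Since \<open>tau x\<close> squares to \<open>- (x \<bullet> x) / 4\<close>, normalising \<open>1 + t tau x\<close> gives a curve in the
  group. It has the velocity of the one-parameter group at \<open>t = 0\<close> and is algebraic up to one root.\<close>

lemma SU2_curve: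
  "(1 / sqrt (1 + t\<^sup>2 * (x \<bullet> x) / 4)) *\<^sub>R (mat 1 + t *\<^sub>R tau x) \<in> SU2"
proof -
  define n where "n = 1 + t\<^sup>2 * (x \<bullet> x) / 4"
  have n: "n > 0" unfolding n_def by (rule add_pos_nonneg) auto
  define s where "s = 1 / sqrt n"
  have s: "s * s * n = 1" using n by (simp add: s_def field_simps)
  have "n = 1 + t\<^sup>2 * (x$1 * x$1 + x$2 * x$2 + x$3 * x$3) / 4"
    by (simp add: n_def inner_vec_def sum_3)
  with s have e: "s * s * (4 + t * t * (x$1 * x$1 + x$2 * x$2 + x$3 * x$3)) = 4"
    by (simp add: power2_eq_square field_simps)
  have "s *\<^sub>R (mat 1 + t *\<^sub>R tau x) \<in> SU2"
    unfolding SU2_iff using e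
    by (simp add: mat2_one_nth complex_eq_iff field_simps)
  then show ?thesis by (simp add: s_def n_def)
qed

lemma SU2_curve_deriv:
  "((\<lambda>t. (1 / sqrt (1 + t\<^sup>2 * (x \<bullet> x) / 4)) *\<^sub>R (mat 1 + t *\<^sub>R tau x)) has_vector_derivative tau x) (at 0)"
proof -
  have 1: "((\<lambda>t. 1 / sqrt (1 + t\<^sup>2 * (x \<bullet> x) / 4)) has_real_derivative 0) (at 0)"
    by (auto intro!: derivative_eq_intros)
  have 2: "((\<lambda>t. mat 1 + t *\<^sub>R tau x) has_vector_derivative tau x) (at 0)"
    by (auto intro!: derivative_eq_intros)
  show ?thesis using has_vector_derivative_scaleR[OF 1 2] by simp
qed

text \<open>The matrix entries satisfy linear relations on \<open>SU(2)\<close>, which pass to the velocity; the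
  norm condition makes its diagonal imaginary.\<close>

lemma SU2_velocity:
  assumes q: "\<And>t. q t \<in> SU2" and q0: "q 0 = mat 1" and d: "(q has_vector_derivative Q) (at 0)"
  shows "Q \<in> range tau"
proof -
  have nth: "bounded_linear (\<lambda>A::mat2. A $ i $ j)" for i j
    using bounded_linear_compose[OF bounded_linear_vec_nth bounded_linear_vec_nth] by blast
  have dc: "((\<lambda>t. q t $ i $ j) has_vector_derivative Q $ i $ j) (at 0)" for i j
    by (rule bounded_linear.has_vector_derivative[OF nth d])
  have dcn: "((\<lambda>t. cnj (q t $ i $ j)) has_vector_derivative cnj (Q $ i $ j)) (at 0)" for i j
    by (rule bounded_linear.has_vector_derivative[OF bounded_linear_cnj dc])
  have s: "q t $ 2 $ 2 = cnj (q t $ 1 $ 1)" "q t $ 2 $ 1 = - cnj (q t $ 1 $ 2)"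
     "q t $ 1 $ 1 * cnj (q t $ 1 $ 1) + q t $ 1 $ 2 * cnj (q t $ 1 $ 2) = 1" for t
    using q[of t] by (auto simp: SU2_iff)
  have 1: "Q $ 2 $ 2 = cnj (Q $ 1 $ 1)"
    using dc[of 2 2] dcn[of 1 1] unfolding s by (rule vector_derivative_unique_at)
  have 2: "Q $ 2 $ 1 = - cnj (Q $ 1 $ 2)"
    using dc[of 2 1] has_vector_derivative_minus[OF dcn[of 1 2]] unfolding s
    by (rule vector_derivative_unique_at)
  have "((\<lambda>t. q t $ 1 $ 1 * cnj (q t $ 1 $ 1) + q t $ 1 $ 2 * cnj (q t $ 1 $ 2)) has_vector_derivative
     ((q 0 $ 1 $ 1 * cnj (Q $ 1 $ 1) + Q $ 1 $ 1 * cnj (q 0 $ 1 $ 1)) +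
      (q 0 $ 1 $ 2 * cnj (Q $ 1 $ 2) + Q $ 1 $ 2 * cnj (q 0 $ 1 $ 2)))) (at 0)"
    by (intro has_vector_derivative_add has_vector_derivative_mult dc dcn)
  then have "((\<lambda>t. 1::complex) has_vector_derivative (cnj (Q $ 1 $ 1) + Q $ 1 $ 1)) (at 0)"
    unfolding s q0 by (simp add: mat2_one_nth)
  then have "cnj (Q $ 1 $ 1) + Q $ 1 $ 1 = 0"
    by (rule vector_derivative_unique_at[OF _ has_vector_derivative_const])
  then have 3: "Re (Q $ 1 $ 1) = 0" by (simp add: complex_eq_iff)
  have "Q = tau (vector [-2 * Im (Q$1$2), -2 * Re (Q$1$2), -2 * Im (Q$1$1)])"
    using 1 2 3 by (simp add: mat2_eq_iff complex_eq_iff vector_3)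
  then show ?thesis by blast
qed

type_synonym r33 = "(real^3) \<times> (real^3)"

definition gtau :: "r33 \<Rightarrow> mat2 \<times> mat2" where
  "gtau u = (tau (fst u), tau (snd u))"

lemma linear_gtau: "linear gtau"
  by (rule linearI) (auto simp: gtau_def linear_add[OF linear_tau] linear_scale[OF linear_tau])

lemma inj_gtau: "inj gtau"
  by (rule injI) (auto simp: gtau_def inj_eq[OF inj_tau] prod_eq_iff)

lemma gtau_bracket:
  "gmult (gtau u) (gtau v) - gmult (gtau v) (gtau u) = gtau (fst u \<times> fst v, snd u \<times> snd v)"
  by (simp add: gmult_def gtau_def tau_cross)

lemma tangent_space_SU2xSU2:
  assumes p: "p \<in> SU2xSU2"
  shows "tangent_space SU2xSU2 p = range (\<lambda>u. gmult p (gtau u))"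
proof (rule set_eqI, rule iffI)
  fix v assume "v \<in> tangent_space SU2xSU2 p"
  then obtain \<gamma> where \<gamma>: "\<And>t::real. \<gamma> t \<in> SU2xSU2" "\<gamma> 0 = p" "(\<gamma> has_vector_derivative v) (at 0)"
    by (auto simp: tangent_space_def)
  define Q where "Q = gmult (gstar p) v"
  have bl: "bounded_linear (gmult (gstar p))"
    using linear_gmult(1) linear_conv_bounded_linear by blast
  have d: "((\<lambda>t. gmult (gstar p) (\<gamma> t)) has_vector_derivative Q) (at 0)"
    unfolding Q_def by (rule bounded_linear.has_vector_derivative[OF bl \<gamma>(3)])
  have m: "gmult (gstar p) (\<gamma> t) \<in> SU2xSU2" for t
    by (intro gmult_mem gstar_mem p \<gamma>)
  have z: "gmult (gstar p) (\<gamma> 0) = gone" using gstar_gmult(3)[OF p] \<gamma>(2) by simp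
  have "fst Q \<in> range tau"
    by (rule SU2_velocity[OF _ _ bounded_linear.has_vector_derivative[OF bounded_linear_fst d]])
       (use m z in \<open>auto simp: SU2xSU2_def gone_def mem_Times_iff\<close>)
  moreover have "snd Q \<in> range tau"
    by (rule SU2_velocity[OF _ _ bounded_linear.has_vector_derivative[OF bounded_linear_snd d]])
       (use m z in \<open>auto simp: SU2xSU2_def gone_def mem_Times_iff\<close>)
  ultimately obtain x y where "fst Q = tau x" "snd Q = tau y" by blast
  then have "Q = gtau (x, y)" by (simp add: gtau_def prod_eq_iff)
  moreover have "v = gmult p Q" using gstar_gmult(2)[OF p] by (simp add: Q_def)
  ultimately show "v \<in> range (\<lambda>u. gmult p (gtau u))" by blast
next
  fix v assume "v \<in> range (\<lambda>u. gmult p (gtau u))"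
  then obtain u where v: "v = gmult p (gtau u)" by blast
  define c where "c x = (\<lambda>t. (1 / sqrt (1 + t\<^sup>2 * (x \<bullet> x) / 4)) *\<^sub>R (mat 1 + t *\<^sub>R tau x))" for x
  define \<gamma> where "\<gamma> t = gmult p (c (fst u) t, c (snd u) t)" for t
  have "\<gamma> t \<in> SU2xSU2" for t
    unfolding \<gamma>_def by (intro gmult_mem p) (simp add: SU2xSU2_def c_def SU2_curve)
  moreover have "\<gamma> 0 = p" by (simp add: \<gamma>_def c_def gmult_def)
  moreover have "(\<gamma> has_vector_derivative v) (at 0)"
  proof -
    have bl: "bounded_linear (gmult p)"
      using linear_gmult(1) by (simp add: linear_conv_bounded_linear)
    have "((\<lambda>t. (c (fst u) t, c (snd u) t)) has_vector_derivative gtau u) (at 0)"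
      unfolding gtau_def c_def by (intro has_vector_derivative_Pair SU2_curve_deriv)
    from bounded_linear.has_vector_derivative[OF bl this] show ?thesis by (simp add: \<gamma>_def[abs_def] v)
  qed
  ultimately show "v \<in> tangent_space SU2xSU2 p" unfolding tangent_space_def by blast
qed

lemma Ck_on_const: "Ck_on k U (\<lambda>_. c)"
  by (induction k arbitrary: c) auto

lemma Ck_on_linear: "linear f \<Longrightarrow> Ck_on k U f"
proof (induction k)
  case 0 then show ?case by (simp add: linear_continuous_on linear_conv_bounded_linear)
next
  case (Suc k)
  then have bl: "bounded_linear f" by (simp add: linear_conv_bounded_linear)
  have "frechet_derivative f (at x) = f" for x
    using frechet_derivative_at[OF bounded_linear_imp_has_derivative[OF bl]] by simp
  then show ?case using bounded_linear_imp_differentiable[OF bl] by (simp add: Ck_on_const)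
qed

lemma smooth_map_linear: "linear f \<Longrightarrow> smooth_map M f"
  unfolding smooth_map_def by (auto intro!: exI[of _ UNIV] exI[of _ f] Ck_on_linear)

lemma smooth_map_cong:
  assumes f: "smooth_map M f" and g: "\<And>x. x \<in> M \<Longrightarrow> g x = f x"
  shows "smooth_map M g"
  unfolding smooth_map_def
proof
  fix p assume "p \<in> M"
  with f obtain U F where "open U" "p \<in> U" "\<forall>k. Ck_on k U F" "\<forall>x\<in>U \<inter> M. F x = f x"
    unfolding smooth_map_def by meson
  then show "\<exists>U F. open U \<and> p \<in> U \<and> (\<forall>k. Ck_on k U F) \<and> (\<forall>x\<in>U \<inter> M. F x = g x)"
    using g by (intro exI[of _ U] exI[of _ F]) simp
qed

lemma smooth_map_differentiable:
  assumes "smooth_map M f" "p \<in> M"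
  shows "\<exists>f'. (f has_derivative f') (at p within M)"
proof -
  obtain U F where U: "open U" "p \<in> U" "\<forall>k. Ck_on k U F" "\<forall>x\<in>U \<inter> M. F x = f x"
    using assms unfolding smooth_map_def by meson
  have "F differentiable (at p)" using U(3)[rule_format, of "Suc 0"] U(2) by simp
  then obtain F' where "(F has_derivative F') (at p)"
    unfolding differentiable_def by blast
  then have F': "(F has_derivative F') (at p within M)" by (rule has_derivative_at_withinI)
  obtain e where e: "e > 0" "ball p e \<subseteq> U" using U(1,2) by (rule openE)
  have "(f has_derivative F') (at p within M)"
    by (rule has_derivative_transform_within[OF F' e(1) assms(2)])
       (use U(4) e(2) in \<open>auto simp: dist_commute subset_iff\<close>)
  then show ?thesis by blast
qed

text \<open>The derivative within \<open>M\<close> is not unique as a map on the ambient space, but along a curve in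
  \<open>M\<close> the chain rule determines its value on the velocity.\<close>

lemma deriv_along_eq:
  assumes f: "(f has_derivative f') (at p within M)" and p: "p \<in> M" and v: "v \<in> tangent_space M p"
  shows "deriv_along M f p v = f' v"
proof -
  obtain \<gamma> where \<gamma>: "\<And>t::real. \<gamma> t \<in> M" "\<gamma> 0 = p" "(\<gamma> has_vector_derivative v) (at 0)"
    using v by (auto simp: tangent_space_def)
  have key: "(f \<circ> \<gamma> has_vector_derivative g v) (at 0)" if g: "(f has_derivative g) (at p within M)" for g
  proof -
    have g': "(f has_derivative g) (at (\<gamma> 0) within range \<gamma>)"
      using has_derivative_subset[OF g, of "range \<gamma>"] \<gamma> by auto
    have "(f \<circ> \<gamma> has_derivative g \<circ> (\<lambda>t. t *\<^sub>R v)) (at 0)"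
      using diff_chain_within[OF _ g', of "\<lambda>t. t *\<^sub>R v"] \<gamma>(3)
      by (simp add: has_vector_derivative_def)
    moreover have "g \<circ> (\<lambda>t. t *\<^sub>R v) = (\<lambda>t. t *\<^sub>R g v)"
      using linear_scale[OF has_derivative_linear[OF g]] by auto
    ultimately show ?thesis by (simp add: has_vector_derivative_def)
  qed
  have "(f has_derivative frechet_derivative f (at p within M)) (at p within M)"
    using f frechet_derivative_works differentiable_def by blast
  \<comment> \<open>Both candidates are the velocity of the same curve \<open>f \<circ> \<gamma>\<close>.\<close>
  from key[OF this] key[OF f] show ?thesis
    unfolding deriv_along_def by (rule vector_derivative_unique_at)
qed

lemma deriv_along_const:
  assumes "\<And>q. q \<in> M \<Longrightarrow> f q = c" "p \<in> M" "v \<in> tangent_space M p"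
  shows "deriv_along M f p v = 0"
proof -
  have "(f has_derivative (\<lambda>_. 0)) (at p within M)"
    by (rule has_derivative_transform[OF assms(2) _ has_derivative_const[of c]]) (use assms in auto)
  from deriv_along_eq[OF this assms(2,3)] show ?thesis .
qed

section \<open>Normal form of the 2-form\<close>

lemma bilinear_max_exists:
  fixes B :: "'a::euclidean_space \<Rightarrow> 'a \<Rightarrow> real"
  assumes B: "bounded_bilinear B" and S: "subspace S" and T: "subspace T"
    and ne: "u \<in> S" "norm u = 1" "v \<in> T" "norm v = 1"
  shows "\<exists>x\<in>S. \<exists>y\<in>T. norm x = 1 \<and> norm y = 1 \<and>
     (\<forall>x'\<in>S. \<forall>y'\<in>T. norm x' = 1 \<and> norm y' = 1 \<longrightarrow> B x' y' \<le> B x y)"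
proof -
  let ?C = "Sigma (sphere 0 1 \<inter> S) (\<lambda>_. sphere 0 1 \<inter> T)"
  have "compact ?C"
    by (intro compact_Times compact_Int_closed compact_sphere closed_subspace S T)
  moreover have "?C \<noteq> {}" using ne by auto
  moreover have "continuous_on ?C (\<lambda>z. B (fst z) (snd z))"
    by (intro bounded_bilinear.continuous_on[OF B] continuous_intros)
  ultimately obtain z where z: "z \<in> ?C" "\<forall>w\<in>?C. B (fst w) (snd w) \<le> B (fst z) (snd z)"
    using continuous_attains_sup by meson
  show ?thesis
    by (intro bexI[of _ "fst z"] bexI[of _ "snd z"] conjI ballI impI)
       (use z in \<open>auto simp: dist_norm\<close>)
qed

text \<open>At a maximum over the unit sphere of a subspace the derivative in orthogonal directions
  vanishes.\<close>

lemma bilinear_max_orthogonal: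
  fixes B :: "'a::euclidean_space \<Rightarrow> 'b::euclidean_space \<Rightarrow> real"
  assumes B: "bounded_bilinear B" and S: "subspace S"
    and x: "x \<in> S" "norm x = 1" and max: "\<And>x'. x' \<in> S \<Longrightarrow> norm x' = 1 \<Longrightarrow> B x' y \<le> B x y"
    and w: "w \<in> S" "w \<bullet> x = 0"
  shows "B w y = 0"
proof (cases "w = 0")
  case True
  then show ?thesis using bounded_bilinear.zero_left[OF B] by simp
next
  case False
  define z where "z = (1 / norm w) *\<^sub>R w"
  have z: "z \<in> S" "norm z = 1" "z \<bullet> x = 0"
    using False w S by (auto simp: z_def subspace_scale)
  have f: "B (cos t *\<^sub>R x + sin t *\<^sub>R z) y = cos t * B x y + sin t * B z y" for t
    by (simp add: bounded_bilinear.add_left[OF B] bounded_bilinear.scaleR_left[OF B])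
  have le: "cos t * B x y + sin t * B z y \<le> B x y" for t
  proof -
    have "x \<bullet> x = 1" "z \<bullet> z = 1" "x \<bullet> z = 0"
      using x z by (simp_all add: norm_eq_1 inner_commute)
    then have "(cos t *\<^sub>R x + sin t *\<^sub>R z) \<bullet> (cos t *\<^sub>R x + sin t *\<^sub>R z) = (cos t)\<^sup>2 + (sin t)\<^sup>2"
      using z(3) by (simp add: inner_add_left inner_add_right power2_eq_square)
    then have "norm (cos t *\<^sub>R x + sin t *\<^sub>R z) = 1" by (simp add: norm_eq_1)
    moreover have "cos t *\<^sub>R x + sin t *\<^sub>R z \<in> S" using x z S by (simp add: subspace_add subspace_scale)
    ultimately have "B (cos t *\<^sub>R x + sin t *\<^sub>R z) y \<le> B x y" using max by simp
    then show ?thesis by (simp only: f)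
  qed
  have "((\<lambda>t. cos t * B x y + sin t * B z y) has_real_derivative B z y) (at 0)"
    by (auto intro!: derivative_eq_intros)
  then have "B z y = 0" by (rule DERIV_local_max[of _ _ 0 1]) (use le in auto)
  then show ?thesis using False by (simp add: z_def bounded_bilinear.scaleR_left[OF B])
qed

definition frame_comb :: "real^3 \<Rightarrow> real^3 \<Rightarrow> real^3 \<Rightarrow> real^3 \<Rightarrow> real^3" where
  "frame_comb x y z u = u$1 *\<^sub>R x + u$2 *\<^sub>R y + u$3 *\<^sub>R z"

text \<open>A positively oriented orthonormal frame defines a rotation, and rotations preserve the cross
  product.\<close>

lemma frame_comb_rotation:
  fixes x y :: "real^3"
  assumes "norm x = 1" "norm y = 1" "x \<bullet> y = 0"
  shows "linear (frame_comb x y (x \<times> y))" "inj (frame_comb x y (x \<times> y))"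
    "frame_comb x y (x \<times> y) (u \<times> v) = frame_comb x y (x \<times> y) u \<times> frame_comb x y (x \<times> y) v"
proof -
  let ?z = "x \<times> y"
  have xx: "x \<bullet> x = 1" "y \<bullet> y = 1" using assms by (simp_all add: norm_eq_1)
  have yx: "y \<bullet> x = 0" using assms by (simp add: inner_commute)
  have 1: "y \<times> ?z = x" using Lagrange[of y x y] xx yx assms by simp
  have 2: "x \<times> ?z = - y" using Lagrange[of x x y] xx yx assms by simp
  have 3: "?z \<times> x = y" "?z \<times> y = - x" "y \<times> x = - ?z"
    using 1 2 cross_skew[of ?z x] cross_skew[of ?z y] cross_skew[of y x] by auto
  show lin: "linear (frame_comb x y ?z)"
    by (rule linearI) (auto simp: frame_comb_def algebra_simps)
  show "frame_comb x y ?z (u \<times> v) = frame_comb x y ?z u \<times> frame_comb x y ?z v"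
    unfolding frame_comb_def cross_add_left cross_add_right cross_mult_left cross_mult_right 1 2 3 cross_refl
    by (simp add: cross_components algebra_simps)
  have zz: "?z \<bullet> ?z = 1"
    using norm_cross_dot[of x y] assms by (simp add: power2_norm_eq_inner)
  show "inj (frame_comb x y ?z)"
  proof (rule injI)
    fix u v assume e: "frame_comb x y ?z u = frame_comb x y ?z v"
    have c: "frame_comb x y ?z w \<bullet> x = w$1" "frame_comb x y ?z w \<bullet> y = w$2" "frame_comb x y ?z w \<bullet> ?z = w$3" for w
      by (simp_all add: frame_comb_def inner_add_left dot_cross_self xx yx assms(3) zz)
    show "u = v" using c[of u] c[of v] e by (simp add: vec_eq_iff forall_3)
  qed
qed

lemma orthogonal_unit_exists:
  fixes x :: "real^3"
  shows "\<exists>u. x \<bullet> u = 0 \<and> norm u = 1"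
proof -
  obtain w where "w \<noteq> 0" "orthogonal x w"
    using orthogonal_to_vector_exists[of x] by (auto simp: DIM_cart)
  then show ?thesis
    by (intro exI[of _ "(1 / norm w) *\<^sub>R w"]) (auto simp: orthogonal_def)
qed

text \<open>A singular value decomposition by rotations: the first pair of axes maximises \<open>B\<close> over pairs of
  unit vectors, the second one maximises it over their orthogonal complements, and the third one is
  forced by the orientation. The entries may therefore be negative.\<close>

lemma rotation_diagonal:
  fixes B :: "real^3 \<Rightarrow> real^3 \<Rightarrow> real"
  assumes B: "bounded_bilinear B"
  shows "\<exists>X Y b. linear X \<and> inj X \<and> (\<forall>u v. X (u \<times> v) = X u \<times> X v) \<and>
     linear Y \<and> inj Y \<and> (\<forall>u v. Y (u \<times> v) = Y u \<times> Y v) \<and>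
     (\<forall>u v. B (X u) (Y v) = (\<Sum>i\<in>UNIV. b$i * u$i * v$i) )"
proof -
  note add = bounded_bilinear.add_left[OF B] bounded_bilinear.add_right[OF B]
    bounded_bilinear.scaleR_left[OF B] bounded_bilinear.scaleR_right[OF B]
  have B': "bounded_bilinear (\<lambda>y x. B x y)" using bounded_bilinear.flip[OF B] .
  have ax: "norm (axis 1 1 :: real^3) = 1" by simp
  obtain x1 y1 where 1: "norm x1 = 1" "norm y1 = 1"
    "\<And>x y. norm x = 1 \<Longrightarrow> norm y = 1 \<Longrightarrow> B x y \<le> B x1 y1"
    using bilinear_max_exists[OF B subspace_UNIV subspace_UNIV UNIV_I ax UNIV_I ax] by auto
  have o1: "B w y1 = 0" if "w \<bullet> x1 = 0" for w
    by (rule bilinear_max_orthogonal[OF B subspace_UNIV UNIV_I 1(1) _ UNIV_I that]) (use 1 in auto)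
  have o2: "B x1 w = 0" if "w \<bullet> y1 = 0" for w
    by (rule bilinear_max_orthogonal[OF B' subspace_UNIV UNIV_I 1(2) _ UNIV_I that]) (use 1 in auto)
  let ?S = "{w. x1 \<bullet> w = 0}" and ?T = "{w. y1 \<bullet> w = 0}"
  have S: "subspace ?S" "subspace ?T" by (rule subspace_hyperplane)+
  obtain u where u: "u \<in> ?S" "norm u = 1" using orthogonal_unit_exists[of x1] by auto
  obtain v where v: "v \<in> ?T" "norm v = 1" using orthogonal_unit_exists[of y1] by auto
  obtain x2 y2 where 2: "x1 \<bullet> x2 = 0" "y1 \<bullet> y2 = 0" "norm x2 = 1" "norm y2 = 1"
    "\<And>x y. x1 \<bullet> x = 0 \<Longrightarrow> y1 \<bullet> y = 0 \<Longrightarrow> norm x = 1 \<Longrightarrow> norm y = 1 \<Longrightarrow> B x y \<le> B x2 y2"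
    using bilinear_max_exists[OF B S u v] by auto
  have o3: "B w y2 = 0" if "x1 \<bullet> w = 0" "w \<bullet> x2 = 0" for w
    by (rule bilinear_max_orthogonal[OF B S(1) _ 2(3) _ _ that(2)]) (use 2 that in auto)
  have o4: "B x2 w = 0" if "y1 \<bullet> w = 0" "w \<bullet> y2 = 0" for w
    by (rule bilinear_max_orthogonal[OF B' S(2) _ 2(4) _ _ that(2)]) (use 2 that in auto)
  let ?x3 = "x1 \<times> x2" and ?y3 = "y1 \<times> y2"
  have z: "B x1 y2 = 0" "B x1 ?y3 = 0" "B x2 y1 = 0" "B x2 ?y3 = 0" "B ?x3 y1 = 0" "B ?x3 y2 = 0"
  proof -
    have c: "x2 \<bullet> x1 = 0" "y2 \<bullet> y1 = 0" using 2(1,2) by (simp_all add: inner_commute)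
    show "B x1 y2 = 0" "B x1 ?y3 = 0" "B x2 y1 = 0" "B x2 ?y3 = 0" "B ?x3 y1 = 0" "B ?x3 y2 = 0"
      by (intro o1 o2 o3 o4; simp add: c dot_cross_self)+
  qed
  let ?b = "vector [B x1 y1, B x2 y2, B ?x3 ?y3] :: real^3"
  have "B (frame_comb x1 x2 ?x3 u) (frame_comb y1 y2 ?y3 v) = (\<Sum>i\<in>UNIV. ?b$i * u$i * v$i)" for u v
    unfolding frame_comb_def by (simp add: add z sum_3 vector_3)
  then show ?thesis
    using frame_comb_rotation[OF 1(1) 2(3) 2(1)] frame_comb_rotation[OF 1(2) 2(4) 2(2)]
    by (intro exI[of _ "frame_comb x1 x2 ?x3"] exI[of _ "frame_comb y1 y2 ?y3"] exI[of _ ?b]) auto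
qed

text \<open>The bracket of \<open>su(2) \<oplus> su(2)\<close> in coordinates \<open>(x, y)\<close> along the two factors.\<close>

definition product_bracket :: "r33 \<Rightarrow> r33 \<Rightarrow> r33" where
  "product_bracket u v = (fst u \<times> fst v, snd u \<times> snd v)"

text \<open>The same bracket in coordinates \<open>(s, t)\<close> with \<open>x = s + t\<close> and \<open>y = s - t\<close>.\<close>

definition bracket :: "r33 \<Rightarrow> r33 \<Rightarrow> r33" where
  "bracket u v = (fst u \<times> fst v + snd u \<times> snd v, fst u \<times> snd v + snd u \<times> fst v)"

text \<open>The Chevalley-Eilenberg differential of a 2-form on a Lie algebra.\<close>

definition ce_d :: "(r33 \<Rightarrow> r33 \<Rightarrow> r33) \<Rightarrow> (r33 \<Rightarrow> r33 \<Rightarrow> real) \<Rightarrow> r33 \<Rightarrow> r33 \<Rightarrow> r33 \<Rightarrow> real" where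
  "ce_d br A u v w = - A (br u v) w + A (br u w) v - A (br v w) u"

definition omega_nf :: "real^3 \<Rightarrow> r33 \<Rightarrow> r33 \<Rightarrow> real" where
  "omega_nf a u v = (\<Sum>i\<in>UNIV. a$i * (fst u $ i * snd v $ i - snd u $ i * fst v $ i))"

definition as_2form :: "(r33 \<Rightarrow> r33 \<Rightarrow> real) \<Rightarrow> r33 list \<Rightarrow> real" where
  "as_2form A vs = A (vs!0) (vs!1)"
definition as_3form :: "(r33 \<Rightarrow> r33 \<Rightarrow> r33 \<Rightarrow> real) \<Rightarrow> r33 list \<Rightarrow> real" where
  "as_3form A vs = A (vs!0) (vs!1) (vs!2)"

lemma alternating_bilinear_cross:
  fixes f :: "real^3 \<Rightarrow> real^3 \<Rightarrow> real"
  assumes f: "bounded_bilinear f" and alt: "\<And>x. f x x = 0"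
  shows "\<exists>\<alpha>. \<forall>x y. f x y = \<alpha> \<bullet> (x \<times> y)"
proof -
  note add = bounded_bilinear.add_left[OF f] bounded_bilinear.add_right[OF f]
    bounded_bilinear.scaleR_left[OF f] bounded_bilinear.scaleR_right[OF f]
  have skew: "f y x = - f x y" for x y
  proof -
    have "f x y + f y x = 0" using alt[of "x + y"] alt[of x] alt[of y] unfolding add by simp
    then show ?thesis by linarith
  qed
  define e1 e2 e3 where "e1 = (vector [1,0,0] :: real^3)" "e2 = (vector [0,1,0] :: real^3)"
    "e3 = (vector [0,0,1] :: real^3)"
  have ex: "x = x$1 *\<^sub>R e1 + x$2 *\<^sub>R e2 + x$3 *\<^sub>R e3" for x :: "real^3"
    by (simp add: e1_e2_e3_def vec_eq_iff forall_3 vector_3)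
  have "f x y = vector [f e2 e3, f e3 e1, f e1 e2] \<bullet> (x \<times> y)" for x y
    apply (subst ex[of x], subst ex[of y])
    using skew[of e2 e1] skew[of e3 e1] skew[of e3 e2]
    by (simp add: add alt inner_vec_def sum_3 vector_3 cross3_def algebra_simps)
  then show ?thesis by blast
qed

text \<open>Evaluation of \<open>\<omega> \<and> d\<omega>\<close> on a basis of one factor and two basis vectors of the other: only
  one product of coefficients survives in each case.\<close>

lemma coupled_form_diagonal:
  assumes A: "\<And>x y x' y'. A (x, y) (x', y') =
      \<alpha> \<bullet> (x \<times> x') + \<beta> \<bullet> (y \<times> y') + (\<Sum>i\<in>UNIV. b$i * (x$i * y'$i - x'$i * y$i))"
    and W: "\<And>a b c d e. wedge 2 (as_2form A) (as_3form (ce_d product_bracket A)) [a, b, c, d, e] = 0"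
  shows "\<alpha>$i * b$i = 0 \<and> \<beta>$i * b$i = 0"
proof -
  define e1 e2 e3 where e: "e1 = (vector [1,0,0] :: real^3)" "e2 = (vector [0,1,0] :: real^3)"
    "e3 = (vector [0,0,1] :: real^3)"
  have z: "(0::real^3) \<times> x = 0" "x \<times> (0::real^3) = 0" for x by simp_all
  have c: "e1 \<times> e2 = e3" "e2 \<times> e3 = e1" "e3 \<times> e1 = e2" "e2 \<times> e1 = - e3" "e3 \<times> e2 = - e1" "e1 \<times> e3 = - e2"
     "e1 \<times> e1 = 0" "e2 \<times> e2 = 0" "e3 \<times> e3 = 0"
    by (simp_all add: e cross3_def vec_eq_iff forall_3 vector_3)
  have n: "e1$1 = 1" "e1$2 = 0" "e1$3 = 0" "e2$1 = 0" "e2$2 = 1" "e2$3 = 0" "e3$1 = 0" "e3$2 = 0" "e3$3 = 1"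
    "x \<bullet> e1 = x$1" "x \<bullet> e2 = x$2" "x \<bullet> e3 = x$3" for x
    by (simp_all add: e vector_3 inner_vec_def sum_3)
  \<comment> \<open>All terms of the expansion are products of values on basis vectors, given by these rules.\<close>
  note s = wedge_2_3 as_2form_def as_3form_def ce_d_def product_bracket_def A sum_3 z c n
  have "\<alpha>$1 * b$1 = 0" using W[of "(e1,0)" "(e2,0)" "(e3,0)" "(0,e2)" "(0,e3)"] by (simp add: s)
  moreover have "\<alpha>$2 * b$2 = 0" using W[of "(e1,0)" "(e2,0)" "(e3,0)" "(0,e3)" "(0,e1)"] by (simp add: s)
  moreover have "\<alpha>$3 * b$3 = 0" using W[of "(e1,0)" "(e2,0)" "(e3,0)" "(0,e1)" "(0,e2)"] by (simp add: s)
  moreover have "\<beta>$1 * b$1 = 0" using W[of "(0,e1)" "(0,e2)" "(0,e3)" "(e2,0)" "(e3,0)"] by (simp add: s)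
  moreover have "\<beta>$2 * b$2 = 0" using W[of "(0,e1)" "(0,e2)" "(0,e3)" "(e3,0)" "(e1,0)"] by (simp add: s)
  moreover have "\<beta>$3 * b$3 = 0" using W[of "(0,e1)" "(0,e2)" "(0,e3)" "(e1,0)" "(e2,0)"] by (simp add: s)
  ultimately show ?thesis using exhaust_3[of i] by auto
qed

text \<open>Two signs of the \<open>b\<^sub>i\<close> can be changed by a rotation of the first factor. An odd number of negative
  signs needs the exchange of the factors, which changes the sign of \<open>t\<close> and of \<open>\<omega>\<close>; the sign \<open>\<delta>\<close> of
  \<open>b\<^sub>1 b\<^sub>2 b\<^sub>3\<close> decides which of the two is used.\<close>

lemma sign_change:
  fixes b :: "real^3"
  assumes b: "\<And>i. b$i \<noteq> 0"
  shows "\<exists>\<Phi>. linear \<Phi> \<and> inj \<Phi> \<and> (\<forall>u v. \<Phi> (bracket u v) = product_bracket (\<Phi> u) (\<Phi> v)) \<and>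
    (\<forall>u v. (\<Sum>i\<in>UNIV. b$i * (fst (\<Phi> u) $ i * snd (\<Phi> v) $ i - fst (\<Phi> v) $ i * snd (\<Phi> u) $ i)) =
       omega_nf (\<chi> i. 2 * \<bar>b$i\<bar>) u v)"
proof -
  define \<delta> where "\<delta> = sgn (b$1 * b$2 * b$3)"
  define \<epsilon> where "\<epsilon> i = \<delta> * sgn (b$i)" for i
  have dd: "\<delta> * \<delta> = 1" using b by (simp add: \<delta>_def sgn_mult_self_eq)
  have ee: "\<epsilon> i * \<epsilon> i = 1" for i
    using b[of i] dd by (simp add: \<epsilon>_def algebra_simps sgn_mult_self_eq)
  have bb: "b$i * \<epsilon> i = \<delta> * \<bar>b$i\<bar>" for i
    by (simp add: \<epsilon>_def abs_sgn[of "b$i"])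
  have "\<epsilon> 1 * \<epsilon> 2 * \<epsilon> 3 = \<delta> * \<delta> * (\<delta> * (sgn (b$1) * sgn (b$2) * sgn (b$3)))"
    by (simp add: \<epsilon>_def algebra_simps)
  also have "sgn (b$1) * sgn (b$2) * sgn (b$3) = \<delta>" by (simp add: \<delta>_def sgn_mult)
  finally have e123: "\<epsilon> 1 * \<epsilon> 2 * \<epsilon> 3 = 1" using dd by simp
  have e1: "\<epsilon> 2 * \<epsilon> 3 = \<epsilon> 1" 
    using e123 ee[of 1] by (metis mult.assoc mult.left_neutral mult.right_neutral)
  have e2: "\<epsilon> 3 * \<epsilon> 1 = \<epsilon> 2"
    using e123 ee[of 2] by (metis mult.assoc mult.commute mult.left_neutral)
  have e3: "\<epsilon> 1 * \<epsilon> 2 = \<epsilon> 3"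
    using e123 ee[of 3] by (metis mult.assoc mult.left_neutral mult.right_neutral)
  define \<Phi> :: "r33 \<Rightarrow> r33" where
    "\<Phi> u = ((\<chi> i. \<epsilon> i * (fst u $ i - \<delta> * snd u $ i)), (\<chi> i. fst u $ i + \<delta> * snd u $ i))" for u
  have lin: "linear \<Phi>"
    by (rule linearI) (auto simp: \<Phi>_def vec_eq_iff algebra_simps)
  have inj: "inj \<Phi>"
  proof (rule injI)
    fix u v assume "\<Phi> u = \<Phi> v"
    then have 1: "\<epsilon> i * (fst u $ i - \<delta> * snd u $ i) = \<epsilon> i * (fst v $ i - \<delta> * snd v $ i)"
      and 2: "fst u $ i + \<delta> * snd u $ i = fst v $ i + \<delta> * snd v $ i" for i
      by (auto simp: \<Phi>_def vec_eq_iff)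
    have "\<epsilon> i \<noteq> 0" for i using ee[of i] by auto
    with 1 have 3: "fst u $ i - \<delta> * snd u $ i = fst v $ i - \<delta> * snd v $ i" for i by simp
    have "\<delta> \<noteq> 0" using dd by auto
    have f: "fst u $ i = fst v $ i" for i using 2[of i] 3[of i] by linarith
    have "\<delta> * snd u $ i = \<delta> * snd v $ i" for i using 2[of i] 3[of i] by linarith
    then have "snd u $ i = snd v $ i" for i using \<open>\<delta> \<noteq> 0\<close> by simp
    with f show "u = v" by (simp add: prod_eq_iff vec_eq_iff)
  qed
  have br: "\<Phi> (bracket u v) = product_bracket (\<Phi> u) (\<Phi> v)" for u v
  proof -
    have s: "(s - \<delta> * t) * (s' - \<delta> * t') = s * s' + t * t' - \<delta> * (s * t' + t * s')"
      "(s + \<delta> * t) * (s' + \<delta> * t') = s * s' + t * t' + \<delta> * (s * t' + t * s')" for s t s' t'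
      using dd by algebra+
    have e: "\<epsilon> 2 * x * (\<epsilon> 3 * y) = \<epsilon> 1 * (x * y)" "\<epsilon> 3 * x * (\<epsilon> 2 * y) = \<epsilon> 1 * (x * y)"
      "\<epsilon> 3 * x * (\<epsilon> 1 * y) = \<epsilon> 2 * (x * y)" "\<epsilon> 1 * x * (\<epsilon> 3 * y) = \<epsilon> 2 * (x * y)"
      "\<epsilon> 1 * x * (\<epsilon> 2 * y) = \<epsilon> 3 * (x * y)" "\<epsilon> 2 * x * (\<epsilon> 1 * y) = \<epsilon> 3 * (x * y)" for x y
      unfolding arg_cong[OF e1[symmetric], of "\<lambda>z. z * (x * y)"]
        arg_cong[OF e2[symmetric], of "\<lambda>z. z * (x * y)"] arg_cong[OF e3[symmetric], of "\<lambda>z. z * (x * y)"]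
      by simp_all
    show ?thesis
      unfolding prod_eq_iff vec_eq_iff forall_3
      by (simp add: \<Phi>_def bracket_def product_bracket_def cross3_def vector_3 e s) (simp add: algebra_simps)
  qed
  have omega_nf: "(\<Sum>i\<in>UNIV. b$i * (fst (\<Phi> u) $ i * snd (\<Phi> v) $ i - fst (\<Phi> v) $ i * snd (\<Phi> u) $ i)) =
       omega_nf (\<chi> i. 2 * \<bar>b$i\<bar>) u v" for u v
    unfolding omega_nf_def
  proof (rule sum.cong)
    fix i
    have "b$i * (fst (\<Phi> u) $ i * snd (\<Phi> v) $ i - fst (\<Phi> v) $ i * snd (\<Phi> u) $ i) =
       (b$i * \<epsilon> i) * (2 * \<delta> * (fst u $ i * snd v $ i - snd u $ i * fst v $ i))"
      by (simp add: \<Phi>_def algebra_simps)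
    also have "\<dots> = (\<delta> * \<delta>) * (2 * \<bar>b$i\<bar> * (fst u $ i * snd v $ i - snd u $ i * fst v $ i))"
      by (simp only: bb) (simp add: algebra_simps)
    finally show "b$i * (fst (\<Phi> u) $ i * snd (\<Phi> v) $ i - fst (\<Phi> v) $ i * snd (\<Phi> u) $ i) =
       (\<chi> i. 2 * \<bar>b$i\<bar>)$i * (fst u $ i * snd v $ i - snd u $ i * fst v $ i)" using dd by simp
  qed simp
  show ?thesis using lin inj br omega_nf by blast
qed

text \<open>In rotated coordinates, \<open>\<omega>\<close> is \<open>\<alpha> \<bullet> (x \<times> x') + \<beta> \<bullet> (y \<times> y')\<close> plus a diagonal mixed part, and
  \<open>\<alpha>\<^sub>i b\<^sub>i = \<beta>\<^sub>i b\<^sub>i = 0\<close>. Then \<open>(\<alpha>, 0)\<close> and \<open>(0, \<beta>)\<close> lie in the kernel of \<open>\<omega>\<close>, hence are zero, and the \<open>b\<^sub>i\<close>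
  are nonzero by non-degeneracy again.\<close>

lemma coupled_normal_form:
  fixes A :: "r33 \<Rightarrow> r33 \<Rightarrow> real"
  assumes bb: "bounded_bilinear A" and alt: "\<And>u. A u u = 0"
    and nd: "\<And>u. u \<noteq> 0 \<Longrightarrow> \<exists>v. A u v \<noteq> 0"
    and W: "\<And>a b c d e. wedge 2 (as_2form A) (as_3form (ce_d product_bracket A)) [a, b, c, d, e] = 0"
  shows "\<exists>\<Phi> a. linear \<Phi> \<and> inj \<Phi> \<and> (\<forall>u v. \<Phi> (bracket u v) = product_bracket (\<Phi> u) (\<Phi> v)) \<and>
    (\<forall>i. a$i > 0) \<and> (\<forall>u v. A (\<Phi> u) (\<Phi> v) = omega_nf a u v)"
proof -
  have l: "bounded_linear (\<lambda>x::real^3. (x, 0::real^3))" "bounded_linear (\<lambda>x::real^3. (0::real^3, x))"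
    by (intro bounded_linear_Pair bounded_linear_ident bounded_linear_zero)+
  obtain X Y b where X: "linear X" "inj X" "\<forall>u v. X (u \<times> v) = X u \<times> X v"
    and Y: "linear Y" "inj Y" "\<forall>u v. Y (u \<times> v) = Y u \<times> Y v"
    and b: "\<forall>u v. A (X u, 0) (0, Y v) = (\<Sum>i\<in>UNIV. b$i * u$i * v$i)"
    using rotation_diagonal[OF bounded_bilinear.comp[OF bb l]] by blast
  define \<Psi> :: "r33 \<Rightarrow> r33" where "\<Psi> u = (X (fst u), Y (snd u))" for u
  have \<Psi>: "linear \<Psi>" "inj \<Psi>"
    by (auto intro!: linearI injI simp: \<Psi>_def linear_add[OF X(1)] linear_add[OF Y(1)]
        linear_scale[OF X(1)] linear_scale[OF Y(1)] inj_eq[OF X(2)] inj_eq[OF Y(2)] prod_eq_iff)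
  have \<Psi>br: "\<Psi> (product_bracket u v) = product_bracket (\<Psi> u) (\<Psi> v)" for u v by (simp add: \<Psi>_def product_bracket_def X Y)
  have \<Psi>surj: "surj \<Psi>" using linear_inj_imp_surj[OF \<Psi>] .
  define A' where "A' u v = A (\<Psi> u) (\<Psi> v)" for u v
  have blPsi: "bounded_linear \<Psi>" using \<Psi>(1) by (simp add: linear_conv_bounded_linear)
  have bb': "bounded_bilinear A'" unfolding A'_def by (rule bounded_bilinear.comp[OF bb blPsi blPsi])
  note add = bounded_bilinear.add_left[OF bb'] bounded_bilinear.add_right[OF bb']
  have alt': "A' u u = 0" for u by (simp add: A'_def alt)
  have skew: "A' v u = - A' u v" for u v
  proof -
    have "A' u v + A' v u = 0" using alt'[of "u + v"] alt'[of u] alt'[of v] unfolding add by simp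
    then show ?thesis by linarith
  qed
  have nd': "\<exists>v. A' u v \<noteq> 0" if "u \<noteq> 0" for u
  proof -
    have "\<Psi> u \<noteq> 0" using that linear_0[OF \<Psi>(1)] inj_eq[OF \<Psi>(2), of u 0] by simp
    then obtain v where v: "A (\<Psi> u) v \<noteq> 0" using nd by blast
    obtain w where "v = \<Psi> w" using surjD[OF \<Psi>surj] by blast
    with v show ?thesis unfolding A'_def by blast
  qed
  have W': "wedge 2 (as_2form A') (as_3form (ce_d product_bracket A')) [a, b, c, d, e] = 0" for a b c d e
    using W[of "\<Psi> a" "\<Psi> b" "\<Psi> c" "\<Psi> d" "\<Psi> e"]
    by (simp add: wedge_2_3 as_2form_def as_3form_def ce_d_def A'_def \<Psi>br)
  obtain \<alpha> where \<alpha>: "\<forall>x y. A' (x, 0) (y, 0) = \<alpha> \<bullet> (x \<times> y)"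
    using alternating_bilinear_cross[OF bounded_bilinear.comp[OF bb' l(1) l(1)] alt'] by blast
  obtain \<beta> where \<beta>: "\<forall>x y. A' (0, x) (0, y) = \<beta> \<bullet> (x \<times> y)"
    using alternating_bilinear_cross[OF bounded_bilinear.comp[OF bb' l(2) l(2)] alt'] by blast
  have mix: "A' (x, 0) (0, y) = (\<Sum>i\<in>UNIV. b$i * x$i * y$i)" for x y
    using b[rule_format, of x y] linear_0[OF X(1)] linear_0[OF Y(1)] by (simp add: A'_def \<Psi>_def)
  have form: "A' (x, y) (x', y') =
      \<alpha> \<bullet> (x \<times> x') + \<beta> \<bullet> (y \<times> y') + (\<Sum>i\<in>UNIV. b$i * (x$i * y'$i - x'$i * y$i))" for x y x' y'
  proof -
    have "A' (x, y) (x', y') = A' ((x, 0) + (0, y)) ((x', 0) + (0, y'))" by simp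
    also have "\<dots> = A' (x, 0) (x', 0) + A' (0, y) (0, y') + (A' (x, 0) (0, y') - A' (x', 0) (0, y))"
      unfolding add using skew[of "(0, y)" "(x', 0)"] by simp
    also have "A' (x, 0) (0, y') - A' (x', 0) (0, y) = (\<Sum>i\<in>UNIV. b$i * (x$i * y'$i - x'$i * y$i))"
      by (simp add: mix sum_subtractf[symmetric] algebra_simps)
    finally show ?thesis by (simp add: \<alpha> \<beta>)
  qed
  have ab: "\<alpha>$i * b$i = 0" "\<beta>$i * b$i = 0" for i
    using coupled_form_diagonal[OF form W', of i] by auto
  have "\<alpha> = 0"
  proof (rule ccontr)
    assume "\<alpha> \<noteq> 0"
    then have "(\<alpha>, 0) \<noteq> (0 :: r33)" by (simp add: zero_prod_def)
    then obtain v where v: "A' (\<alpha>, 0) v \<noteq> 0" using nd' by blast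
    have "A' (\<alpha>, 0) (fst v, snd v) = 0"
    proof -
      have z: "b$i * (\<alpha>$i * c) = 0" for i c using ab(1)[of i] by auto
      show ?thesis unfolding form by (simp add: dot_cross_self z)
    qed
    then show False using v by simp
  qed
  moreover have "\<beta> = 0"
  proof (rule ccontr)
    assume "\<beta> \<noteq> 0"
    then have "(0, \<beta>) \<noteq> (0 :: r33)" by (simp add: zero_prod_def)
    then obtain v where v: "A' (0, \<beta>) v \<noteq> 0" using nd' by blast
    have "A' (0, \<beta>) (fst v, snd v) = 0"
    proof -
      have z: "b$i * (c * \<beta>$i) = 0" for i c using ab(2)[of i] by auto
      show ?thesis unfolding form by (simp add: dot_cross_self z)
    qed
    then show False using v by simp
  qed
  ultimately have form': "A' u v = (\<Sum>i\<in>UNIV. b$i * (fst u$i * snd v$i - fst v$i * snd u$i))" for u v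
    using form[of "fst u" "snd u" "fst v" "snd v"] by simp
  have b0: "b$i \<noteq> 0" for i
  proof
    assume b: "b$i = 0"
    have "axis i 1 \<noteq> (0::real^3)" by (simp add: axis_eq_0_iff)
    then have "(axis i 1, 0) \<noteq> (0 :: r33)" by (simp add: zero_prod_def)
    then obtain v where v: "A' (axis i 1, 0) v \<noteq> 0" using nd' by blast
    have z: "b$j * ((axis i 1 :: real^3)$j * c) = 0" for j c using b by (simp add: axis_def)
    have "A' (axis i 1, 0) v = 0" unfolding form' by (simp add: z)
    then show False using v by simp
  qed
  obtain \<Phi> where \<Phi>: "linear \<Phi>" "inj \<Phi>" "\<forall>u v. \<Phi> (bracket u v) = product_bracket (\<Phi> u) (\<Phi> v)"
    "\<forall>u v. (\<Sum>i\<in>UNIV. b$i * (fst (\<Phi> u) $ i * snd (\<Phi> v) $ i - fst (\<Phi> v) $ i * snd (\<Phi> u) $ i)) =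
       omega_nf (\<chi> i. 2 * \<bar>b$i\<bar>) u v"
    using sign_change[OF b0] by blast
  have "linear (\<Psi> \<circ> \<Phi>)" "inj (\<Psi> \<circ> \<Phi>)" using \<Psi> \<Phi> by (auto intro: linear_compose inj_compose)
  moreover have "A ((\<Psi> \<circ> \<Phi>) u) ((\<Psi> \<circ> \<Phi>) v) = omega_nf (\<chi> i. 2 * \<bar>b$i\<bar>) u v" for u v
    using \<Phi>(4)[rule_format, of u v] form'[of "\<Phi> u" "\<Phi> v"] by (simp add: A'_def)
  ultimately show ?thesis
    using b0 \<Psi>br \<Phi>(3) by (intro exI[of _ "\<Psi> \<circ> \<Phi>"] exI[of _ "\<chi> i. 2 * \<bar>b$i\<bar>"]) simp
qed

section \<open>Ricci curvature of a diagonal metric\<close>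

abbreviation "e1 \<equiv> (vector [1,0,0] :: real^3)"
abbreviation "e2 \<equiv> (vector [0,1,0] :: real^3)"
abbreviation "e3 \<equiv> (vector [0,0,1] :: real^3)"

lemma axis_vector: "axis 1 1 = e1" "axis 2 1 = e2" "axis 3 1 = e3"
  by (simp_all add: vec_eq_iff forall_3 axis_def vector_3)

lemma sum_Basis_r33:
  fixes f :: "r33 \<Rightarrow> real"
  shows "sum f Basis = f (e1, 0) + f (e2, 0) + f (e3, 0) + f (0, e1) + f (0, e2) + f (0, e3)"
proof -
  have B: "(Basis :: (real^3) set) = (\<lambda>i. axis i 1) ` UNIV" by (auto simp: Basis_vec_def)
  have I: "inj (\<lambda>i. axis i 1 :: real^3)" by (simp add: inj_def axis_eq_axis)
  have "sum g (Basis :: (real^3) set) = (\<Sum>i\<in>UNIV. g (axis i 1))" for g :: "real^3 \<Rightarrow> real"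
    unfolding B using sum.reindex[OF I, of g] by (simp add: comp_def)
  then have 3: "sum g (Basis :: (real^3) set) = g e1 + g e2 + g e3" for g :: "real^3 \<Rightarrow> real"
    by (simp only: sum_3 axis_vector)
  have BP: "(Basis :: r33 set) = (\<lambda>u. (u, 0)) ` Basis \<union> (\<lambda>u. (0, u)) ` Basis"
    by (simp add: Basis_prod_def)
  have "sum f Basis = sum f ((\<lambda>u. (u, 0)) ` (Basis :: (real^3) set)) + sum f ((\<lambda>u. (0, u)) ` (Basis :: (real^3) set))"
    unfolding BP by (rule sum.union_disjoint) (auto dest: nonzero_Basis)
  also have "sum f ((\<lambda>u. (u, 0)) ` (Basis :: (real^3) set)) = (\<Sum>u\<in>Basis. f (u, 0))"
    by (subst sum.reindex) (auto simp: inj_on_def)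
  also have "sum f ((\<lambda>u. (0, u)) ` (Basis :: (real^3) set)) = (\<Sum>u\<in>Basis. f (0, u))"
    by (subst sum.reindex) (auto simp: inj_on_def)
  finally have "sum f Basis = (\<Sum>u\<in>Basis. f (u, 0)) + (\<Sum>u\<in>Basis. f (0, u))" .
  then show ?thesis by (simp add: 3)
qed

definition diag_metric :: "real^3 \<Rightarrow> real^3 \<Rightarrow> r33 \<Rightarrow> r33 \<Rightarrow> real" where
  "diag_metric P M u v = (\<Sum>i\<in>UNIV. P$i * (fst u $ i * fst v $ i) + M$i * (snd u $ i * snd v $ i))"

definition lc_coeff :: "real \<Rightarrow> real \<Rightarrow> real \<Rightarrow> real" where
  "lc_coeff g ga gb = (g + gb - ga) / (2 * g)"

text \<open>The Levi-Civita connection on left invariant fields. For orthogonal \<open>X\<^sub>a, X\<^sub>b, X\<^sub>c\<close> with cyclic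
  brackets and square norms \<open>g\<^sub>a, g\<^sub>b, g\<^sub>c\<close>, the Koszul formula gives
  \<open>(g\<^sub>c + g\<^sub>b - g\<^sub>a) / (2 g\<^sub>c) X\<^sub>c\<close> for the derivative of \<open>X\<^sub>b\<close> along \<open>X\<^sub>a\<close>. The coordinate basis is of this
  kind: its cyclic triples are \<open>s\<^sub>1 s\<^sub>2 s\<^sub>3\<close>, and \<open>s\<^sub>i t\<^sub>j t\<^sub>k\<close> for every cyclic \<open>(i, j, k)\<close>.\<close>

definition lc_product :: "real^3 \<Rightarrow> real^3 \<Rightarrow> r33 \<Rightarrow> r33 \<Rightarrow> r33" where
  "lc_product P M u v = (let s = fst u; t = snd u; s' = fst v; t' = snd v;
      h = (\<lambda>i j k. lc_coeff (P$i) (P$j) (P$k) * (s$j * s'$k) - lc_coeff (P$i) (P$k) (P$j) * (s$k * s'$j)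
                 + lc_coeff (P$i) (M$j) (M$k) * (t$j * t'$k) - lc_coeff (P$i) (M$k) (M$j) * (t$k * t'$j));
      g = (\<lambda>i j k. lc_coeff (M$i) (P$j) (M$k) * (s$j * t'$k) - lc_coeff (M$i) (P$k) (M$j) * (s$k * t'$j)
                 + lc_coeff (M$i) (M$j) (P$k) * (t$j * s'$k) - lc_coeff (M$i) (M$k) (P$j) * (t$k * s'$j))
    in (vector [h 1 2 3, h 2 3 1, h 3 1 2], vector [g 1 2 3, g 2 3 1, g 3 1 2]))"

lemma linear_lc_product: "linear (\<lambda>u. lc_product P M u v)" "linear (lc_product P M u)"
  by (rule linearI; simp add: lc_product_def Let_def prod_eq_iff vec_eq_iff forall_3 vector_3 algebra_simps)+

lemma linear_bracket: "linear (\<lambda>u. bracket u v)" "linear (bracket u)"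
  by (rule linearI; simp add: bracket_def prod_eq_iff vec_eq_iff forall_3 cross_components algebra_simps)+

lemma lc_product_koszul:
  assumes "\<And>i. P$i > 0" "\<And>i. M$i > 0"
  shows "2 * diag_metric P M (lc_product P M u v) w = diag_metric P M (bracket u v) w - diag_metric P M (bracket v w) u + diag_metric P M (bracket w u) v"
proof -
  have nz: "P$i \<noteq> 0" "M$i \<noteq> 0" for i using assms(1)[of i] assms(2)[of i] by auto
  have k: "2 * (P$i * (lc_coeff (P$i) ga gb * x)) = (P$i + gb - ga) * x"
    "2 * (M$i * (lc_coeff (M$i) ga gb * x)) = (M$i + gb - ga) * x" for i ga gb x
    using nz by (auto simp: lc_coeff_def)
  \<comment> \<open>Distributivity is confined to this shape, so that each coefficient meets the metric weight which cancels its denominator.\<close>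
  have d: "2 * (p * (((a - b + c - d) :: real) * y)) = 2 * (p * (a * y)) - 2 * (p * (b * y)) + 2 * (p * (c * y)) - 2 * (p * (d * y))"
    for p a b c d y by (simp add: algebra_simps)
  have m: "(q * (xx :: real)) * y = q * (xx * y)" for q xx y by simp
  show ?thesis
    unfolding diag_metric_def sum_3 lc_product_def Let_def fst_conv snd_conv vector_3 distrib_left[of 2] d m k
    by (simp add: bracket_def cross_components algebra_simps)
qed

definition curvature_nf :: "real^3 \<Rightarrow> real^3 \<Rightarrow> r33 \<Rightarrow> r33 \<Rightarrow> r33 \<Rightarrow> r33" where
  "curvature_nf P M u v w = lc_product P M u (lc_product P M v w) - lc_product P M v (lc_product P M u w) - lc_product P M (bracket u v) w"

definition ricci_nf :: "real^3 \<Rightarrow> real^3 \<Rightarrow> r33 \<Rightarrow> r33 \<Rightarrow> real" where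
  "ricci_nf P M v w = (\<Sum>d\<in>Basis. curvature_nf P M d v w \<bullet> d)"

lemma linear_curvature_nf: "linear (\<lambda>u. curvature_nf P M u v w)"
  unfolding curvature_nf_def
  by (intro linear_compose_sub linear_lc_product
      linear_compose[OF linear_lc_product(1), unfolded comp_def, OF linear_lc_product(2)]
      linear_compose[OF linear_bracket(1), unfolded comp_def, OF linear_lc_product(1)])

lemmas ricci_nf_simps = ricci_nf_def sum_Basis_r33 curvature_nf_def lc_product_def lc_coeff_def Let_def bracket_def cross3_def vector_3
  inner_prod_def inner_vec_def sum_3

text \<open>The two summands come from the two cyclic triples through the given vector. It commutes with the
  remaining basis vector, and the plane of these two is flat.\<close>

lemma ricci_nf_diagonal:
  assumes p: "\<And>i. P$i > 0" "\<And>i. M$i > 0"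
  shows
    "ricci_nf P M (e1, 0) (e1, 0) =
      (((P$1)\<^sup>2 - (P$2 - P$3)\<^sup>2) / (P$2 * P$3) + ((P$1)\<^sup>2 - (M$2 - M$3)\<^sup>2) / (M$2 * M$3)) / 2"
    "ricci_nf P M (0, e1) (0, e1) =
      (((M$1)\<^sup>2 - (P$2 - M$3)\<^sup>2) / (P$2 * M$3) + ((M$1)\<^sup>2 - (M$2 - P$3)\<^sup>2) / (M$2 * P$3)) / 2"
    "ricci_nf P M (e2, 0) (e2, 0) =
      (((P$2)\<^sup>2 - (P$3 - P$1)\<^sup>2) / (P$3 * P$1) + ((P$2)\<^sup>2 - (M$3 - M$1)\<^sup>2) / (M$3 * M$1)) / 2"
    "ricci_nf P M (0, e2) (0, e2) =
      (((M$2)\<^sup>2 - (P$3 - M$1)\<^sup>2) / (P$3 * M$1) + ((M$2)\<^sup>2 - (M$3 - P$1)\<^sup>2) / (M$3 * P$1)) / 2"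
    "ricci_nf P M (e3, 0) (e3, 0) =
      (((P$3)\<^sup>2 - (P$1 - P$2)\<^sup>2) / (P$1 * P$2) + ((P$3)\<^sup>2 - (M$1 - M$2)\<^sup>2) / (M$1 * M$2)) / 2"
    "ricci_nf P M (0, e3) (0, e3) =
      (((M$3)\<^sup>2 - (P$1 - M$2)\<^sup>2) / (P$1 * M$2) + ((M$3)\<^sup>2 - (M$1 - P$2)\<^sup>2) / (M$1 * P$2)) / 2"
proof -
  have nz: "P$i \<noteq> 0" "M$i \<noteq> 0" for i using assms(1)[of i] assms(2)[of i] by auto
  show "ricci_nf P M (e1, 0) (e1, 0) =
      (((P$1)\<^sup>2 - (P$2 - P$3)\<^sup>2) / (P$2 * P$3) + ((P$1)\<^sup>2 - (M$2 - M$3)\<^sup>2) / (M$2 * M$3)) / 2"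
    "ricci_nf P M (0, e1) (0, e1) =
      (((M$1)\<^sup>2 - (P$2 - M$3)\<^sup>2) / (P$2 * M$3) + ((M$1)\<^sup>2 - (M$2 - P$3)\<^sup>2) / (M$2 * P$3)) / 2"
    "ricci_nf P M (e2, 0) (e2, 0) =
      (((P$2)\<^sup>2 - (P$3 - P$1)\<^sup>2) / (P$3 * P$1) + ((P$2)\<^sup>2 - (M$3 - M$1)\<^sup>2) / (M$3 * M$1)) / 2"
    "ricci_nf P M (0, e2) (0, e2) =
      (((M$2)\<^sup>2 - (P$3 - M$1)\<^sup>2) / (P$3 * M$1) + ((M$2)\<^sup>2 - (M$3 - P$1)\<^sup>2) / (M$3 * P$1)) / 2"
    "ricci_nf P M (e3, 0) (e3, 0) =
      (((P$3)\<^sup>2 - (P$1 - P$2)\<^sup>2) / (P$1 * P$2) + ((P$3)\<^sup>2 - (M$1 - M$2)\<^sup>2) / (M$1 * M$2)) / 2"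
    "ricci_nf P M (0, e3) (0, e3) =
      (((M$3)\<^sup>2 - (P$1 - M$2)\<^sup>2) / (P$1 * M$2) + ((M$3)\<^sup>2 - (M$1 - P$2)\<^sup>2) / (M$1 * P$2)) / 2"
    by (simp add: ricci_nf_simps, simp add: nz divide_simps, simp add: power2_eq_square algebra_simps)+
qed

section \<open>Almost complex structure and metric of the normal form\<close>

text \<open>With \<open>\<sigma>\<close> the perimeter and \<open>l\<^sub>i = \<sigma> - 2 a\<^sub>i\<close> the excesses in the triangle inequality,
  \<open>d\<omega> = - \<sigma> t\<^sup>1\<^sup>2\<^sup>3 + l\<^sub>1 s\<^sup>2\<^sup>3 t\<^sup>1 + l\<^sub>2 s\<^sup>3\<^sup>1 t\<^sup>2 + l\<^sub>3 s\<^sup>1\<^sup>2 t\<^sup>3\<close>. The endomorphism \<open>K\<close> exchanges the lines of \<open>s\<^sub>i\<close>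
  and \<open>t\<^sub>i\<close>. Up to signs and a common factor its weights are \<open>l\<^sub>j l\<^sub>k\<close> and \<open>\<sigma> l\<^sub>i\<close>. Their product \<open>\<sigma> l\<^sub>1 l\<^sub>2 l\<^sub>3\<close> is, by Heron's formula, sixteen times the squared area
  of the triangle.\<close>

definition perimeter :: "real^3 \<Rightarrow> real" where "perimeter a = a$1 + a$2 + a$3"
definition excess :: "real^3 \<Rightarrow> real^3" where "excess a = (\<chi> i. perimeter a - 2 * a$i)"
definition J_weight_t :: "real^3 \<Rightarrow> real^3" where "J_weight_t a = (\<chi> i. perimeter a * excess a $ i)"
definition J_weight_s :: "real^3 \<Rightarrow> real^3" where
  "J_weight_s a = vector [excess a $ 2 * excess a $ 3, excess a $ 3 * excess a $ 1, excess a $ 1 * excess a $ 2]"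
definition quartic :: "real^3 \<Rightarrow> real" where "quartic a = perimeter a * excess a $ 1 * excess a $ 2 * excess a $ 3"
definition prod3 :: "real^3 \<Rightarrow> real" where "prod3 a = a$1 * a$2 * a$3"

definition J_unscaled :: "real^3 \<Rightarrow> r33 \<Rightarrow> r33" where
  "J_unscaled a u = ((\<chi> i. - J_weight_t a $ i * snd u $ i), (\<chi> i. J_weight_s a $ i * fst u $ i))"

lemma linear_J_unscaled: "linear (J_unscaled a)"
  by (rule linearI) (auto simp: J_unscaled_def prod_eq_iff vec_eq_iff algebra_simps)

lemma J_unscaled_square: "J_unscaled a (J_unscaled a u) = (- quartic a) *\<^sub>R u"
  by (simp add: J_unscaled_def quartic_def J_weight_t_def J_weight_s_def prod_eq_iff vec_eq_iff forall_3 vector_3)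

definition domega_nf :: "real^3 \<Rightarrow> r33 \<Rightarrow> r33 \<Rightarrow> r33 \<Rightarrow> real" where "domega_nf a = ce_d bracket (omega_nf a)"

definition J_nf :: "real^3 \<Rightarrow> r33 \<Rightarrow> r33" where "J_nf a u = (1 / sqrt (quartic a)) *\<^sub>R J_unscaled a u"
definition metric_s :: "real^3 \<Rightarrow> real^3" where "metric_s a = (\<chi> i. a$i * J_weight_s a $ i)"
definition metric_t :: "real^3 \<Rightarrow> real^3" where "metric_t a = (\<chi> i. a$i * J_weight_t a $ i)"

lemma subseqs_6_5:
  "vs \<in> set (subseqs [a,b,c,d,e,f]) \<Longrightarrow> length vs = 5 \<Longrightarrow>
   vs = [b,c,d,e,f] \<or> vs = [a,c,d,e,f] \<or> vs = [a,b,d,e,f] \<or> vs = [a,b,c,e,f] \<or> vs = [a,b,c,d,f] \<or> vs = [a,b,c,d,e]"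
  by (simp add: Let_def) (elim disjE; simp)

text \<open>The data at one point. All points of the group have the same coefficients in a left invariant
  frame, so the linear algebra of the almost complex structure is done once, for any space with such a
  frame.\<close>

locale frame6 =
  fixes \<theta> :: "r33 \<Rightarrow> 'a::euclidean_space" and V :: "'a set" and \<omega> \<psi> :: "'a list \<Rightarrow> real"
    and a :: "real^3" and c :: real
  assumes lin: "linear \<theta>" and inj: "inj \<theta>" and V: "V = range \<theta>"
    and \<omega>_form: "\<omega> \<in> forms 2 V" and \<psi>_form: "\<psi> \<in> forms 3 V"
    and \<omega>: "\<And>u v. \<omega> [\<theta> u, \<theta> v] = omega_nf a u v"
    and \<psi>: "\<And>u v w. \<psi> [\<theta> u, \<theta> v, \<theta> w] = domega_nf a u v w / c"
    and a: "\<And>i. a$i > 0" and c: "c \<noteq> 0"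
begin

definition "frame_list = [\<theta> (e1, 0), \<theta> (e2, 0), \<theta> (e3, 0), \<theta> (0, e1), \<theta> (0, e2), \<theta> (0, e3)]"

lemma sub: "subspace V"
  using linear_subspace_image[OF lin subspace_UNIV] V by simp

lemma span_frame_list: "V = span (set frame_list)"
proof
  have "u = fst u $ 1 *\<^sub>R (e1, 0) + fst u $ 2 *\<^sub>R (e2, 0) + fst u $ 3 *\<^sub>R (e3, 0) +
     snd u $ 1 *\<^sub>R (0, e1) + snd u $ 2 *\<^sub>R (0, e2) + snd u $ 3 *\<^sub>R (0, e3)" for u :: r33
    by (simp add: prod_eq_iff vec_eq_iff forall_3 vector_3)
  then have 1: "\<theta> u = fst u $ 1 *\<^sub>R \<theta> (e1, 0) + fst u $ 2 *\<^sub>R \<theta> (e2, 0) + fst u $ 3 *\<^sub>R \<theta> (e3, 0) +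
     snd u $ 1 *\<^sub>R \<theta> (0, e1) + snd u $ 2 *\<^sub>R \<theta> (0, e2) + snd u $ 3 *\<^sub>R \<theta> (0, e3)" for u :: r33
    using arg_cong[of _ _ \<theta>] by (simp only: linear_add[OF lin, symmetric] linear_scale[OF lin, symmetric])
  have 2: "fst u $ 1 *\<^sub>R \<theta> (e1, 0) + fst u $ 2 *\<^sub>R \<theta> (e2, 0) + fst u $ 3 *\<^sub>R \<theta> (e3, 0) +
     snd u $ 1 *\<^sub>R \<theta> (0, e1) + snd u $ 2 *\<^sub>R \<theta> (0, e2) + snd u $ 3 *\<^sub>R \<theta> (0, e3) \<in> span (set frame_list)" for u :: r33
    unfolding frame_list_def by (intro span_add span_scale span_base) simp_all
  have "\<theta> u \<in> span (set frame_list)" for u by (subst 1) (rule 2)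
  then show "V \<subseteq> span (set frame_list)" unfolding V by auto
  have "set frame_list \<subseteq> V" by (auto simp: frame_list_def V)
  then show "span (set frame_list) \<subseteq> V" using span_minimal sub by blast
qed

lemma distinct_frame_list: "distinct frame_list"
  by (simp add: frame_list_def inj_eq[OF inj] vec_eq_iff forall_3 vector_3)

lemma cube_form: "cube \<omega> \<in> forms 6 V"
  using wedge_forms[OF wedge_forms[OF \<omega>_form \<omega>_form sub] \<omega>_form sub] by (simp add: cube_def)

lemma K_form: "wedge 2 (contract v \<psi>) \<psi> \<in> forms 5 V"
proof -
  have "contract v \<psi> \<in> forms 2 V" by (rule forms_contract) (use \<psi>_form in \<open>simp add: eval_nat_numeral\<close>)
  from wedge_forms[OF this \<psi>_form sub] show ?thesis by simp
qed

lemma cube_contract_form: "contract v (cube \<omega>) \<in> forms 5 V"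
  by (rule forms_contract) (use cube_form in \<open>simp add: eval_nat_numeral\<close>)

lemmas cube_simps = cube_def wedge_4_2 wedge_2_2 \<omega> omega_nf_def sum_3 vector_3

text \<open>Here \<open>\<omega>\<^sup>3 = - 6 a\<^sub>1 a\<^sub>2 a\<^sub>3 s\<^sup>1\<^sup>2\<^sup>3 t\<^sup>1\<^sup>2\<^sup>3\<close>. The first vector is left general:
  the six values recover all its coordinates, so they also prove that contraction with \<open>\<omega>\<^sup>3\<close> is injective.\<close>

lemma cube_eval:
  "cube \<omega> [\<theta> u, \<theta> (e2, 0), \<theta> (e3, 0), \<theta> (0, e1), \<theta> (0, e2), \<theta> (0, e3)] = - 6 * prod3 a * fst u $ 1"
  "cube \<omega> [\<theta> u, \<theta> (e1, 0), \<theta> (e3, 0), \<theta> (0, e1), \<theta> (0, e2), \<theta> (0, e3)] = 6 * prod3 a * fst u $ 2"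
  "cube \<omega> [\<theta> u, \<theta> (e1, 0), \<theta> (e2, 0), \<theta> (0, e1), \<theta> (0, e2), \<theta> (0, e3)] = - 6 * prod3 a * fst u $ 3"
  "cube \<omega> [\<theta> u, \<theta> (e1, 0), \<theta> (e2, 0), \<theta> (e3, 0), \<theta> (0, e2), \<theta> (0, e3)] = 6 * prod3 a * snd u $ 1"
  "cube \<omega> [\<theta> u, \<theta> (e1, 0), \<theta> (e2, 0), \<theta> (e3, 0), \<theta> (0, e1), \<theta> (0, e3)] = - 6 * prod3 a * snd u $ 2"
  "cube \<omega> [\<theta> u, \<theta> (e1, 0), \<theta> (e2, 0), \<theta> (e3, 0), \<theta> (0, e1), \<theta> (0, e2)] = 6 * prod3 a * snd u $ 3"
  by (simp_all add: cube_simps prod3_def)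

lemmas K_simps = wedge_2_3 contract_def \<psi> domega_nf_def ce_d_def bracket_def omega_nf_def sum_3 vector_3 cross3_def

lemma K_eval:
  "wedge 2 (contract (\<theta> u) \<psi>) \<psi> [\<theta> (e2, 0), \<theta> (e3, 0), \<theta> (0, e1), \<theta> (0, e2), \<theta> (0, e3)] = 2 * fst (J_unscaled a u) $ 1 / c\<^sup>2"
  "wedge 2 (contract (\<theta> u) \<psi>) \<psi> [\<theta> (e1, 0), \<theta> (e3, 0), \<theta> (0, e1), \<theta> (0, e2), \<theta> (0, e3)] = - 2 * fst (J_unscaled a u) $ 2 / c\<^sup>2"
  "wedge 2 (contract (\<theta> u) \<psi>) \<psi> [\<theta> (e1, 0), \<theta> (e2, 0), \<theta> (0, e1), \<theta> (0, e2), \<theta> (0, e3)] = 2 * fst (J_unscaled a u) $ 3 / c\<^sup>2"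
  "wedge 2 (contract (\<theta> u) \<psi>) \<psi> [\<theta> (e1, 0), \<theta> (e2, 0), \<theta> (e3, 0), \<theta> (0, e2), \<theta> (0, e3)] = - 2 * snd (J_unscaled a u) $ 1 / c\<^sup>2"
  "wedge 2 (contract (\<theta> u) \<psi>) \<psi> [\<theta> (e1, 0), \<theta> (e2, 0), \<theta> (e3, 0), \<theta> (0, e1), \<theta> (0, e3)] = 2 * snd (J_unscaled a u) $ 2 / c\<^sup>2"
  "wedge 2 (contract (\<theta> u) \<psi>) \<psi> [\<theta> (e1, 0), \<theta> (e2, 0), \<theta> (e3, 0), \<theta> (0, e1), \<theta> (0, e2)] = - 2 * snd (J_unscaled a u) $ 3 / c\<^sup>2"
  using c by (simp_all add: K_simps J_unscaled_def J_weight_t_def J_weight_s_def excess_def perimeter_def)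
     (simp_all add: power2_eq_square divide_simps, simp_all add: algebra_simps)

lemma prod3_pos: "prod3 a > 0" unfolding prod3_def by (intro mult_pos_pos a)

lemma hitchin_K_frame:
  "hitchin_K V (cube \<omega>) \<psi> (\<theta> u) = (- 1 / (3 * prod3 a * c\<^sup>2)) *\<^sub>R \<theta> (J_unscaled a u)"
proof -
  let ?k = "- 1 / (3 * prod3 a * c\<^sup>2)"
  have eq: "(?k *\<^sub>R \<theta> (J_unscaled a u)) = \<theta> (?k *\<^sub>R J_unscaled a u)" by (simp only: linear_scale[OF lin])
  have 1: "contract (\<theta> (?k *\<^sub>R J_unscaled a u)) (cube \<omega>) = wedge 2 (contract (\<theta> u) \<psi>) \<psi>"
  proof (rule forms_eqI[OF cube_contract_form K_form span_frame_list distinct_frame_list])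
    fix vs assume "vs \<in> set (subseqs frame_list)" "length vs = 5"
    from subseqs_6_5[OF this[unfolded frame_list_def]]
    show "contract (\<theta> (?k *\<^sub>R J_unscaled a u)) (cube \<omega>) vs = wedge 2 (contract (\<theta> u) \<psi>) \<psi> vs"
      by (elim disjE; simp only: contract_def[of _ "cube \<omega>"] cube_eval K_eval)
         (use prod3_pos c in \<open>simp_all add: divide_simps\<close>)
  qed
  have 2: "w = w'" if ww: "w \<in> V" "w' \<in> V" and cw: "contract w (cube \<omega>) = contract w' (cube \<omega>)" for w w'
  proof -
    obtain x x' where x: "w = \<theta> x" "w' = \<theta> x'" using ww V by auto
    have "cube \<omega> (\<theta> x # vs) = cube \<omega> (\<theta> x' # vs)" for vs
      using fun_cong[OF cw, of vs] by (simp add: contract_def x)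
    from this[of "[\<theta> (e2, 0), \<theta> (e3, 0), \<theta> (0, e1), \<theta> (0, e2), \<theta> (0, e3)]"]
      this[of "[\<theta> (e1, 0), \<theta> (e3, 0), \<theta> (0, e1), \<theta> (0, e2), \<theta> (0, e3)]"]
      this[of "[\<theta> (e1, 0), \<theta> (e2, 0), \<theta> (0, e1), \<theta> (0, e2), \<theta> (0, e3)]"]
      this[of "[\<theta> (e1, 0), \<theta> (e2, 0), \<theta> (e3, 0), \<theta> (0, e2), \<theta> (0, e3)]"]
      this[of "[\<theta> (e1, 0), \<theta> (e2, 0), \<theta> (e3, 0), \<theta> (0, e1), \<theta> (0, e3)]"]
      this[of "[\<theta> (e1, 0), \<theta> (e2, 0), \<theta> (e3, 0), \<theta> (0, e1), \<theta> (0, e2)]"]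
    have "x = x'" unfolding cube_eval using prod3_pos by (simp add: prod_eq_iff vec_eq_iff forall_3)
    then show ?thesis using x by simp
  qed
  have 3: "\<theta> x \<in> V" for x unfolding V by (rule rangeI)
  show ?thesis
    unfolding hitchin_K_def eq
  proof (rule the_equality)
    show "\<theta> (?k *\<^sub>R J_unscaled a u) \<in> V \<and>
        contract (\<theta> (?k *\<^sub>R J_unscaled a u)) (cube \<omega>) = wedge 2 (contract (\<theta> u) \<psi>) \<psi>"
      using 1 3 by (rule conjI[rotated])
    fix w assume w: "w \<in> V \<and> contract w (cube \<omega>) = wedge 2 (contract (\<theta> u) \<psi>) \<psi>"
    show "w = \<theta> (?k *\<^sub>R J_unscaled a u)"
      by (rule 2[OF conjunct1[OF w] 3 trans[OF conjunct2[OF w] 1[symmetric]]])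
  qed
qed

lemma hitchin_lambda_frame: "hitchin_lambda V (cube \<omega>) \<psi> = - quartic a / (3 * prod3 a * c\<^sup>2)\<^sup>2"
proof -
  let ?k = "- 1 / (3 * prod3 a * c\<^sup>2)"
  have "trace_on V (hitchin_K V (cube \<omega>) \<psi> \<circ> hitchin_K V (cube \<omega>) \<psi>) =
     (\<Sum>d\<in>Basis. ((?k\<^sup>2 * (- quartic a)) *\<^sub>R (d :: r33)) \<bullet> d)"
  proof (rule trace_on_conjugate[OF lin inj V[symmetric]])
    show "linear (\<lambda>d :: r33. (?k\<^sup>2 * (- quartic a)) *\<^sub>R d)" by (rule linear_scale_self)
    have K: "hitchin_K V (cube \<omega>) \<psi> (\<theta> u) = \<theta> (?k *\<^sub>R J_unscaled a u)" for u
      by (simp only: hitchin_K_frame linear_scale[OF lin])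
    show "(hitchin_K V (cube \<omega>) \<psi> \<circ> hitchin_K V (cube \<omega>) \<psi>) (\<theta> u) = \<theta> ((?k\<^sup>2 * (- quartic a)) *\<^sub>R u)" for u
      by (simp only: comp_def K linear_scale[OF linear_J_unscaled] J_unscaled_square scaleR_scaleR power2_eq_square mult.assoc)
  qed
  also have "\<dots> = 6 * (?k\<^sup>2 * (- quartic a))" by (simp add: inner_same_Basis)
  finally show ?thesis by (simp add: hitchin_lambda_def power_divide)
qed

lemma quartic_pos_if: "hitchin_lambda V (cube \<omega>) \<psi> < 0 \<Longrightarrow> quartic a > 0"
  unfolding hitchin_lambda_frame by (auto simp: divide_less_0_iff zero_less_divide_iff) 

lemma hitchin_J_frame:
  assumes Q: "quartic a > 0"
  shows "hitchin_J V (cube \<omega>) \<psi> (\<theta> u) = \<theta> (J_nf a u)"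
proof -
  have p: "3 * prod3 a * c\<^sup>2 > 0" using prod3_pos c by simp
  have "\<bar>hitchin_lambda V (cube \<omega>) \<psi>\<bar> = quartic a / (3 * prod3 a * c\<^sup>2)\<^sup>2"
    using Q by (simp add: hitchin_lambda_frame)
  then have "sqrt \<bar>hitchin_lambda V (cube \<omega>) \<psi>\<bar> = sqrt (quartic a) / (3 * prod3 a * c\<^sup>2)"
    using p by (simp add: real_sqrt_divide)
  then show ?thesis
    using prod3_pos c Q by (simp add: hitchin_J_def hitchin_K_frame J_nf_def linear_scale[OF lin])
qed

lemma metric_frame:
  assumes Q: "quartic a > 0"
  shows "\<omega> [\<theta> u, hitchin_J V (cube \<omega>) \<psi> (\<theta> v)] = (1 / sqrt (quartic a)) * diag_metric (metric_s a) (metric_t a) u v"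
  unfolding hitchin_J_frame[OF Q] \<omega>
  by (simp add: omega_nf_def diag_metric_def J_nf_def J_unscaled_def metric_s_def metric_t_def sum_3 divide_simps) (simp add: algebra_simps)

end

section \<open>Angles of a triangle\<close>

text \<open>The hypothesis \<open>E\<close> is the ratio of the Einstein equations for \<open>s\<^sub>1\<close> and \<open>t\<^sub>1\<close>. Modulo the
  relation between the cosines both numerators become linear in \<open>w = y z\<close>, and after clearing
  denominators \<open>2 x w\<^sup>2 + (1 + x\<^sup>2) w = x (1 - x\<^sup>2)\<close> remains. Multiplication by \<open>x\<close> turns it into an equation for
  \<open>x\<^sup>2\<close> and the product \<open>x y z\<close>.\<close>

lemma triangle_einstein_relation:
  fixes x y z :: real
  assumes y: "\<bar>y\<bar> < 1" and z: "\<bar>z\<bar> < 1" and con: "x\<^sup>2 + y\<^sup>2 + z\<^sup>2 + 2 * x * y * z = 1"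
    and E: "(((1 - x)\<^sup>2 - (y - z)\<^sup>2) / ((1 - y) * (1 - z)) + ((1 - x)\<^sup>2 - (y - z)\<^sup>2) / ((1 + y) * (1 + z))) * (1 + x) =
            (((1 + x)\<^sup>2 - (y + z)\<^sup>2) / ((1 - y) * (1 + z)) + ((1 + x)\<^sup>2 - (y + z)\<^sup>2) / ((1 + y) * (1 - z))) * (1 - x)"
  shows "(x\<^sup>2)\<^sup>2 + (x * y * z - 1) * x\<^sup>2 + 2 * (x * y * z)\<^sup>2 + x * y * z = 0"
proof -
  define w where "w = y * z"
  have f1: "(1 - x)\<^sup>2 - (y - z)\<^sup>2 = 2 * (w * (1 + x) - x * (1 - x))"
    using con unfolding w_def by algebra
  have f2: "(1 + x)\<^sup>2 - (y + z)\<^sup>2 = 2 * (x * (1 + x) - w * (1 - x))"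
    using con unfolding w_def by algebra
  have p: "1 - y > 0" "1 + y > 0" "1 - z > 0" "1 + z > 0" using y z by auto
  have g1: "c / ((1 - y) * (1 - z)) + c / ((1 + y) * (1 + z)) = 2 * c * (1 + w) / ((1 - y\<^sup>2) * (1 - z\<^sup>2))" for c
  proof -
    have "(1 - y\<^sup>2) * (1 - z\<^sup>2) = ((1 - y) * (1 - z)) * ((1 + y) * (1 + z))" by algebra
    then show ?thesis using p by (simp add: w_def divide_simps) (simp add: algebra_simps)
  qed
  have g2: "c / ((1 - y) * (1 + z)) + c / ((1 + y) * (1 - z)) = 2 * c * (1 - w) / ((1 - y\<^sup>2) * (1 - z\<^sup>2))" for c
  proof -
    have "(1 - y\<^sup>2) * (1 - z\<^sup>2) = ((1 - y) * (1 + z)) * ((1 + y) * (1 - z))" by algebra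
    then show ?thesis using p by (simp add: w_def divide_simps) (simp add: algebra_simps)
  qed
  have D: "(1 - y\<^sup>2) * (1 - z\<^sup>2) \<noteq> 0"
  proof -
    have "(1 - y\<^sup>2) * (1 - z\<^sup>2) = ((1 - y) * (1 - z)) * ((1 + y) * (1 + z))" by algebra
    then show ?thesis using p by simp
  qed
  have "2 * (2 * (w * (1 + x) - x * (1 - x))) * (1 + w) * (1 + x) =
        2 * (2 * (x * (1 + x) - w * (1 - x))) * (1 - w) * (1 - x)"
    using E D unfolding f1 f2 g1 g2 by (simp add: divide_simps)
  then have "2 * x * w\<^sup>2 + (1 + x\<^sup>2) * w - x * (1 - x\<^sup>2) = 0" by algebra
  then have "x * (2 * x * w\<^sup>2 + (1 + x\<^sup>2) * w - x * (1 - x\<^sup>2)) = 0" by simp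
  then show ?thesis unfolding w_def by algebra
qed

text \<open>If two of the squares differ, they are the two roots and have sum \<open>1 - T\<close>. The relation
  between the cosines then makes the third one \<open>- T\<close>, which leaves \<open>T = 0\<close> or \<open>T = - 1\<close>, and both contradict
  the bounds. If all squares equal \<open>r\<close>, then \<open>T = (1 - 3 r) / 2\<close> turns the quadratic equation into
  \<open>(4 r - 1) (r - 1) = 0\<close>.\<close>

lemma triangle_cosines_half:
  fixes x y z :: real
  assumes lt: "x\<^sup>2 < 1" "y\<^sup>2 < 1" "z\<^sup>2 < 1" and con: "x\<^sup>2 + y\<^sup>2 + z\<^sup>2 + 2 * x * y * z = 1"
    and T: "T = x * y * z"
    and q: "\<And>q. q \<in> {x\<^sup>2, y\<^sup>2, z\<^sup>2} \<Longrightarrow> q\<^sup>2 + (T - 1) * q + 2 * T\<^sup>2 + T = 0"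
  shows "x\<^sup>2 = 1/4 \<and> y\<^sup>2 = 1/4 \<and> z\<^sup>2 = 1/4"
proof -
  have key: "q1 = q2" if q1: "q1\<^sup>2 + (T - 1) * q1 + 2 * T\<^sup>2 + T = 0"
     and q2: "q2\<^sup>2 + (T - 1) * q2 + 2 * T\<^sup>2 + T = 0" and q3: "q3\<^sup>2 + (T - 1) * q3 + 2 * T\<^sup>2 + T = 0"
     and s: "q1 + q2 + q3 + 2 * T = 1" and lt: "q1 < 1" "q2 < 1" "q3 < 1" for q1 q2 q3 :: real
  proof (rule ccontr)
    assume ne: "q1 \<noteq> q2"
    have "(q1 - q2) * (q1 + q2 + T - 1) = 0" using q1 q2 by algebra
    then have s2: "q1 + q2 + T - 1 = 0" using ne by simp
    then have "q3 = - T" using s by simp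
    then have "2 * T * (T + 1) = 0" using q3 by algebra
    then have "T = 0 \<or> T = -1" by auto
    then show False
    proof
      assume "T = 0"
      then have "q1 * (q1 - 1) = 0" "q2 * (q2 - 1) = 0" using q1 q2 by algebra+
      then have "q1 = 0" "q2 = 0" using lt by auto
      then show False using ne by simp
    next
      assume "T = -1" then show False using \<open>q3 = - T\<close> lt by simp
    qed
  qed
  have s: "x\<^sup>2 + y\<^sup>2 + z\<^sup>2 + 2 * T = 1" using con T by (simp add: mult.assoc)
  have xy: "x\<^sup>2 = y\<^sup>2" by (rule key[OF q q q s]) (use lt in auto)
  have yz: "y\<^sup>2 = z\<^sup>2" by (rule key[OF q q q, of "y\<^sup>2" "z\<^sup>2" "x\<^sup>2"]) (use lt s in auto)
  define r where "r = x\<^sup>2"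
  have r: "y\<^sup>2 = r" "z\<^sup>2 = r" using xy yz by (auto simp: r_def)
  have T': "T = (1 - 3 * r) / 2" using s r by (simp add: r_def[symmetric])
  have "r\<^sup>2 + (T - 1) * r + 2 * T\<^sup>2 + T = 0" using q[of r] by (simp add: r_def)
  then have "(4 * r - 1) * (r - 1) = 0" unfolding T' by (simp add: field_simps power2_eq_square)
  then have "r = 1/4" using lt(1) by (auto simp: r_def)
  then show ?thesis using r by (simp add: r_def[symmetric])
qed

text \<open>Each side is the sum of the projections of the other two, hence at most half of their sum.\<close>

lemma equilateral:
  fixes a b c :: real
  assumes pos: "a > 0" "b > 0" "c > 0"
    and x: "x = (b\<^sup>2 + c\<^sup>2 - a\<^sup>2) / (2 * b * c)" and y: "y = (c\<^sup>2 + a\<^sup>2 - b\<^sup>2) / (2 * c * a)"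
    and z: "z = (a\<^sup>2 + b\<^sup>2 - c\<^sup>2) / (2 * a * b)"
    and h: "x\<^sup>2 = 1/4" "y\<^sup>2 = 1/4" "z\<^sup>2 = 1/4"
  shows "a = b \<and> b = c"
proof -
  have le: "t \<le> 1/2" if "t\<^sup>2 = 1/4" for t :: real
  proof -
    have "t\<^sup>2 \<le> (1/2)\<^sup>2" using that by (simp add: power_divide)
    then show ?thesis by (rule power2_le_imp_le) simp
  qed
  have "a = y * c + z * b" using pos by (simp add: y z field_simps power2_eq_square)
  moreover have "b = x * c + z * a" using pos by (simp add: x z field_simps power2_eq_square)
  moreover have "c = x * b + y * a" using pos by (simp add: x y field_simps power2_eq_square)
  moreover have "y * c \<le> 1/2 * c" "z * b \<le> 1/2 * b" "x * c \<le> 1/2 * c" "z * a \<le> 1/2 * a"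
    "x * b \<le> 1/2 * b" "y * a \<le> 1/2 * a"
    using le h pos by (auto intro!: mult_right_mono)
  ultimately show ?thesis by linarith
qed

section \<open>Left invariant frames\<close>

lemma levi_civitaD:
  assumes "levi_civita M h D" "vector_field M X" "vector_field M Y" "vector_field M Z" "p \<in> M"
  shows "D X Y p - D Y X p = lie_bracket M X Y p"
    "deriv_along M (\<lambda>q. h q (Y q) (Z q)) p (X p) = h p (D X Y p) (Z p) + h p (Y p) (D X Z p)"
  using assms unfolding levi_civita_def by blast+

lemma curvature_tensorD:
  assumes "curvature_tensor M D R" "vector_field M X" "vector_field M Y" "vector_field M Z" "p \<in> M"
  shows "R p (X p) (Y p) (Z p) = D X (D Y Z) p - D Y (D X Z) p - D (lie_bracket M X Y) Z p"
  using assms unfolding curvature_tensor_def by blast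

text \<open>Expanding the first argument in a basis reduces the product rule to the bilinear one.\<close>

lemma trilinear_has_derivative:
  fixes F :: "'e::euclidean_space \<Rightarrow> 'e \<Rightarrow> 'e \<Rightarrow> real"
  assumes l: "\<And>v w. linear (\<lambda>u. F u v w)" and b: "\<And>u. bounded_bilinear (F u)"
    and x: "(x has_derivative x') (at p within M)" and y: "(y has_derivative y') (at p within M)"
    and z: "(z has_derivative z') (at p within M)"
  shows "((\<lambda>q. F (x q) (y q) (z q)) has_derivative
     (\<lambda>v. F (x' v) (y p) (z p) + F (x p) (y' v) (z p) + F (x p) (y p) (z' v))) (at p within M)"
proof -
  have ex: "F u v w = (\<Sum>d\<in>Basis. (u \<bullet> d) * F d v w)" for u v w
  proof -
    have "F u v w = F (\<Sum>d\<in>Basis. (u \<bullet> d) *\<^sub>R d) v w" by (simp add: euclidean_representation)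
    also have "\<dots> = (\<Sum>d\<in>Basis. (u \<bullet> d) * F d v w)"
      using linear_sum[OF l, of "\<lambda>d. (u \<bullet> d) *\<^sub>R d"] by (simp add: linear_scale[OF l])
    finally show ?thesis .
  qed
  have "((\<lambda>q. \<Sum>d\<in>Basis. (x q \<bullet> d) * F d (y q) (z q)) has_derivative
     (\<lambda>v. \<Sum>d\<in>Basis. (x p \<bullet> d) * (F d (y p) (z' v) + F d (y' v) (z p)) + (x' v \<bullet> d) * F d (y p) (z p))) (at p within M)"
    by (intro has_derivative_sum has_derivative_mult bounded_bilinear.FDERIV[OF b] y z
        has_derivative_inner_left x)
  moreover have "(\<Sum>d\<in>Basis. (x p \<bullet> d) * (F d (y p) (z' v) + F d (y' v) (z p)) + (x' v \<bullet> d) * F d (y p) (z p)) =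
    F (x' v) (y p) (z p) + F (x p) (y' v) (z p) + F (x p) (y p) (z' v)" for v
    unfolding ex[of "x' v"] ex[of "x p"] by (simp add: sum.distrib distrib_left)
  ultimately show ?thesis unfolding ex[of "x _"] by simp
qed

lemma diag_metric_nondegenerate:
  assumes p: "\<And>i. P$i > 0" "\<And>i. M$i > 0"
    and h: "\<And>w. diag_metric P M n w = diag_metric P M n' w"
  shows "n = n'"
proof -
  have "fst n $ i = fst n' $ i" for i
  proof -
    have "diag_metric P M n (axis i 1, 0) = P$i * fst n $ i" for n using exhaust_3[of i] by (auto simp: diag_metric_def axis_def sum_3)
    then show ?thesis using h[of "(axis i 1, 0)"] p(1)[of i] by simp
  qed
  moreover have "snd n $ i = snd n' $ i" for i
  proof -
    have "diag_metric P M n (0, axis i 1) = M$i * snd n $ i" for n using exhaust_3[of i] by (auto simp: diag_metric_def axis_def sum_3)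
    then show ?thesis using h[of "(0, axis i 1)"] p(2)[of i] by simp
  qed
  ultimately show ?thesis by (simp add: prod_eq_iff vec_eq_iff)
qed

lemma diag_metric_add: "diag_metric P M (u + v) w = diag_metric P M u w + diag_metric P M v w" "diag_metric P M w (u + v) = diag_metric P M w u + diag_metric P M w v"
  by (simp_all add: diag_metric_def sum.distrib algebra_simps)

lemma diag_metric_sym: "diag_metric P M u v = diag_metric P M v u"
  by (simp add: diag_metric_def mult.commute)

text \<open>The map \<open>\<Phi>\<close> is an isomorphism of Lie algebras from the coordinates \<open>(s, t)\<close> to the coordinates along the
  factors. It gives a frame of left invariant fields, and \<open>\<theta> p\<close> is this frame at \<open>p\<close>.\<close>

locale left_frame =
  fixes \<Phi> :: "r33 \<Rightarrow> r33"
  assumes \<Phi>_lin: "linear \<Phi>" and \<Phi>_inj: "inj \<Phi>" and \<Phi>_br: "\<And>u v. \<Phi> (bracket u v) = product_bracket (\<Phi> u) (\<Phi> v)"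
begin

abbreviation "G \<equiv> SU2xSU2"

definition "\<xi> u = gtau (\<Phi> u)"

definition "\<theta> p u = gmult p (\<xi> u)"

lemma \<xi>_lin: "linear \<xi>"
  using linear_compose[OF \<Phi>_lin linear_gtau] by (simp add: \<xi>_def[abs_def] comp_def)

lemma \<xi>_inj: "inj \<xi>"
  using inj_compose[OF inj_gtau \<Phi>_inj] by (simp add: \<xi>_def[abs_def] comp_def)

lemma \<xi>_br: "gmult (\<xi> u) (\<xi> v) - gmult (\<xi> v) (\<xi> u) = \<xi> (bracket u v)"
  by (simp add: \<xi>_def gtau_bracket \<Phi>_br product_bracket_def)

lemma \<theta>_lin: "linear (\<theta> p)"
  using linear_compose[OF \<xi>_lin linear_gmult(1)] by (simp add: \<theta>_def[abs_def] comp_def)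

lemma \<theta>_inj: "p \<in> G \<Longrightarrow> inj (\<theta> p)"
  by (rule injI) (metis \<theta>_def gstar_gmult(1) \<xi>_inj injD)

lemma \<theta>_range: "p \<in> G \<Longrightarrow> tangent_space G p = range (\<theta> p)"
proof -
  assume p: "p \<in> G"
  have "surj \<Phi>" using linear_inj_imp_surj[OF \<Phi>_lin \<Phi>_inj] .
  have "range (\<theta> p) = (\<lambda>u. gmult p (gtau u)) ` range \<Phi>"
    by (simp add: \<theta>_def[abs_def] \<xi>_def image_image)
  then show ?thesis using \<open>surj \<Phi>\<close> tangent_space_SU2xSU2[OF p] by simp
qed

lemma \<theta>_tangent: "p \<in> G \<Longrightarrow> \<theta> p u \<in> tangent_space G p"
  by (simp add: \<theta>_range)

text \<open>A left inverse defined on all pairs of matrices, so that the coordinates of a vector field in the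
  frame are a composition of the field with maps which are smooth on the whole ambient space.\<close>

definition "\<eta> = (SOME f. linear f \<and> f \<circ> \<xi> = id)"

lemma \<eta>: "linear \<eta>" "\<eta> (\<xi> u) = u"
proof -
  have "\<exists>f. linear f \<and> f \<circ> \<xi> = id" using linear_injective_left_inverse[OF \<xi>_lin \<xi>_inj] .
  from someI_ex[OF this] have f: "linear \<eta> \<and> \<eta> \<circ> \<xi> = id" unfolding \<eta>_def .
  then show "linear \<eta>" ..
  show "\<eta> (\<xi> u) = u" using fun_cong[OF conjunct2[OF f], of u] by (simp only: comp_apply id_apply)
qed

definition "coords X q = \<eta> (gmult (gstar q) (X q))"

lemma coords_\<theta>:
  assumes "vector_field G X" "q \<in> G" shows "\<theta> q (coords X q) = X q"
proof -
  have "X q \<in> range (\<theta> q)" using assms \<theta>_range by (auto simp: vector_field_def)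
  then obtain u where u: "X q = \<theta> q u" by blast
  then have "gmult (gstar q) (X q) = \<xi> u" using assms(2) by (simp add: \<theta>_def gstar_gmult)
  then show ?thesis using u by (simp add: coords_def \<eta>)
qed

lemma coords_unique: "q \<in> G \<Longrightarrow> X q = \<theta> q u \<Longrightarrow> coords X q = u"
  by (simp add: coords_def \<theta>_def gstar_gmult \<eta>)

lemma coords_deriv:
  assumes X: "vector_field G X" and p: "p \<in> G"
  shows "\<exists>x'. (coords X has_derivative x') (at p within G)"
proof -
  have "smooth_map G X" using X by (simp add: vector_field_def)
  from smooth_map_differentiable[OF this p] obtain X' where X': "(X has_derivative X') (at p within G)" by blast
  have g: "(gstar has_derivative gstar) (at p within G)"
    using linear_gstar by (simp add: linear_conv_bounded_linear bounded_linear_imp_has_derivative)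
  have "bounded_linear \<eta>" using \<eta>(1) by (simp add: linear_conv_bounded_linear)
  from bounded_linear.has_derivative[OF this bounded_bilinear.FDERIV[OF bounded_bilinear_gmult g X']]
  show ?thesis unfolding coords_def[abs_def] by blast
qed

lemma field_deriv_along:
  assumes X: "vector_field G X" and p: "p \<in> G" and v: "v \<in> tangent_space G p"
    and x': "(coords X has_derivative x') (at p within G)"
  shows "deriv_along G X p v = gmult v (\<xi> (coords X p)) + \<theta> p (x' v)"
proof -
  have bl: "bounded_linear \<xi>" using \<xi>_lin by (simp add: linear_conv_bounded_linear)
  have d: "((\<lambda>q. gmult q (\<xi> (coords X q))) has_derivative (\<lambda>v. gmult p (\<xi> (x' v)) + gmult v (\<xi> (coords X p)))) (at p within G)"
    by (rule bounded_bilinear.FDERIV[OF bounded_bilinear_gmult has_derivative_ident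
        bounded_linear.has_derivative[OF bl x']])
  have "(X has_derivative (\<lambda>v. gmult p (\<xi> (x' v)) + gmult v (\<xi> (coords X p)))) (at p within G)"
    by (rule has_derivative_transform[OF p _ d]) (use coords_\<theta>[OF X] in \<open>simp add: \<theta>_def\<close>)
  from deriv_along_eq[OF this p v] show ?thesis by (simp add: \<theta>_def)
qed

text \<open>In the left trivialisation a field is a function with values in the Lie algebra, and its bracket
  with another one consists of the pointwise bracket and the derivatives of the coordinate functions.\<close>

lemma bracket_formula:
  assumes X: "vector_field G X" and Y: "vector_field G Y" and p: "p \<in> G"
    and x': "(coords X has_derivative x') (at p within G)" and y': "(coords Y has_derivative y') (at p within G)"
  shows "lie_bracket G X Y p = \<theta> p (bracket (coords X p) (coords Y p) + y' (X p) - x' (Y p))"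
proof -
  have T: "X p \<in> tangent_space G p" "Y p \<in> tangent_space G p" using X Y p by (auto simp: vector_field_def)
  have e: "X p = gmult p (\<xi> (coords X p))" "Y p = gmult p (\<xi> (coords Y p))"
    using coords_\<theta>[OF X p] coords_\<theta>[OF Y p] by (auto simp: \<theta>_def)
  have "lie_bracket G X Y p = gmult (X p) (\<xi> (coords Y p)) - gmult (Y p) (\<xi> (coords X p)) + \<theta> p (y' (X p)) - \<theta> p (x' (Y p))"
    using field_deriv_along[OF Y p T(1) y'] field_deriv_along[OF X p T(2) x'] by (simp add: lie_bracket_def)
  also have "gmult (X p) (\<xi> (coords Y p)) - gmult (Y p) (\<xi> (coords X p)) =
      gmult p (gmult (\<xi> (coords X p)) (\<xi> (coords Y p)) - gmult (\<xi> (coords Y p)) (\<xi> (coords X p)))"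
    using e by (metis gmult_assoc linear_diff[OF linear_gmult(1)])
  also have "\<dots> = \<theta> p (bracket (coords X p) (coords Y p))" by (simp only: \<xi>_br \<theta>_def)
  finally show ?thesis by (simp add: linear_add[OF \<theta>_lin] linear_diff[OF \<theta>_lin])
qed

text \<open>A connection acts on fields on the ambient space, of which only the values on the group are
  known. So left invariance is a predicate and not a fixed extension of the field.\<close>

definition "left_invariant_field X u \<longleftrightarrow> vector_field G X \<and> (\<forall>p\<in>G. X p = \<theta> p u)"

lemma left_invariant_fieldI:
  assumes "\<And>p. p \<in> G \<Longrightarrow> X p = \<theta> p u" shows "left_invariant_field X u"
proof -
  have "linear (\<lambda>p. \<theta> p u)" unfolding \<theta>_def by (rule linear_gmult(2))
  then have "smooth_map G X" using assms smooth_map_cong smooth_map_linear by metis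
  then show ?thesis using assms \<theta>_tangent by (simp add: left_invariant_field_def vector_field_def)
qed

lemma left_invariant_field_frame: "left_invariant_field (\<lambda>p. \<theta> p u) u" by (rule left_invariant_fieldI) simp

lemma coords_deriv_left_invariant: "left_invariant_field X u \<Longrightarrow> p \<in> G \<Longrightarrow> (coords X has_derivative (\<lambda>_. 0)) (at p within G)"
  by (rule has_derivative_transform[OF _ _ has_derivative_const[of u]]) (auto simp: left_invariant_field_def coords_unique)

lemma left_invariant_field_bracket:
  assumes "left_invariant_field X u" "left_invariant_field Y v" shows "left_invariant_field (lie_bracket G X Y) (bracket u v)"
proof (rule left_invariant_fieldI)
  fix p assume p: "p \<in> G"
  have X: "vector_field G X" "vector_field G Y" using assms by (auto simp: left_invariant_field_def)
  have "coords X p = u" "coords Y p = v" using assms p by (auto simp: left_invariant_field_def intro!: coords_unique)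
  then show "lie_bracket G X Y p = \<theta> p (bracket u v)"
    using bracket_formula[OF X p coords_deriv_left_invariant[OF assms(1) p] coords_deriv_left_invariant[OF assms(2) p]] by simp
qed

text \<open>The Koszul argument. For left invariant fields all functions \<open>h(Y, Z)\<close> are constant, so
  compatibility with the metric and vanishing torsion are linear equations between constants.\<close>

lemma levi_civita_left_invariant:
  assumes P: "\<And>i. P$i > 0" "\<And>i. M$i > 0" and \<kappa>: "\<kappa> > 0"
    and h: "\<And>p u v. p \<in> G \<Longrightarrow> h p (\<theta> p u) (\<theta> p v) = \<kappa> * diag_metric P M u v"
    and D: "levi_civita G h D" and X: "left_invariant_field X u" and Y: "left_invariant_field Y v"
  shows "left_invariant_field (D X Y) (lc_product P M u v)"
proof (rule left_invariant_fieldI)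
  fix p assume p: "p \<in> G"
  have conn: "connection G D" using D by (simp add: levi_civita_def)
  have vf: "vector_field G (D A B)" if "left_invariant_field A a" "left_invariant_field B b" for A B a b
    using conn that by (simp add: connection_def left_invariant_field_def)
  define n where "n A B = coords (D A B) p" for A B
  have n: "D A B p = \<theta> p (n A B)" if "left_invariant_field A a" "left_invariant_field B b" for A B a b
    using coords_\<theta>[OF vf[OF that] p] by (simp add: n_def)
  have tor: "n A B = n B A + bracket a b" if "left_invariant_field A a" "left_invariant_field B b" for A B a b
  proof -
    have "D A B p - D B A p = lie_bracket G A B p"
      using that p by (auto intro!: levi_civitaD(1)[OF D] simp: left_invariant_field_def)
    also have "\<dots> = \<theta> p (bracket a b)" using left_invariant_field_bracket[OF that] p by (simp add: left_invariant_field_def)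
    finally have "\<theta> p (n A B - n B A) = \<theta> p (bracket a b)"
      using n that by (simp add: linear_diff[OF \<theta>_lin])
    then have "n A B - n B A = bracket a b" using \<theta>_inj[OF p] by (simp add: inj_eq)
    then show ?thesis by (simp add: algebra_simps)
  qed
  have met: "diag_metric P M (n A B) c + diag_metric P M b (n A C) = 0" if "left_invariant_field A a" "left_invariant_field B b" "left_invariant_field C c" for A B C a b c
  proof -
    have "deriv_along G (\<lambda>q. h q (B q) (C q)) p (A p) = 0"
      by (rule deriv_along_const[of G _ "\<kappa> * diag_metric P M b c"])
         (use that p h in \<open>auto simp: left_invariant_field_def \<theta>_tangent\<close>)
    moreover have "deriv_along G (\<lambda>q. h q (B q) (C q)) p (A p) = h p (D A B p) (C p) + h p (B p) (D A C p)"
      using that p by (intro levi_civitaD(2)[OF D]) (simp_all add: left_invariant_field_def)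
    moreover have "C p = \<theta> p c" "B p = \<theta> p b" using that p by (auto simp: left_invariant_field_def)
    ultimately have "\<kappa> * diag_metric P M (n A B) c + \<kappa> * diag_metric P M b (n A C) = 0"
      using n[OF that(1,2)] n[OF that(1,3)] h[OF p] by simp
    then show ?thesis using \<kappa> by (simp add: distrib_left[symmetric])
  qed
  have "diag_metric P M (n X Y) w = diag_metric P M (lc_product P M u v) w" for w
  proof -
    define Z where "Z = (\<lambda>p. \<theta> p w)"
    have Z: "left_invariant_field Z w" unfolding Z_def by (rule left_invariant_field_frame)
    have "diag_metric P M (n X Y) w + diag_metric P M v (n X Z) = 0" "diag_metric P M (n Y Z) u + diag_metric P M w (n Y X) = 0"
      "diag_metric P M (n Z X) v + diag_metric P M u (n Z Y) = 0"
      using met[OF X Y Z] met[OF Y Z X] met[OF Z X Y] by auto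
    moreover have "n X Y = n Y X + bracket u v" "n Y Z = n Z Y + bracket v w" "n Z X = n X Z + bracket w u"
      using tor[OF X Y] tor[OF Y Z] tor[OF Z X] by auto
    ultimately have "2 * diag_metric P M (n X Y) w = diag_metric P M (bracket u v) w - diag_metric P M (bracket v w) u + diag_metric P M (bracket w u) v"
      by (simp add: diag_metric_add diag_metric_sym[of P M w] diag_metric_sym[of P M u "n Z Y"] diag_metric_sym[of P M v "n X Z"])
    then show ?thesis using lc_product_koszul[OF P, of u v w] by simp
  qed
  then have "n X Y = lc_product P M u v" by (rule diag_metric_nondegenerate[OF P])
  then show "D X Y p = \<theta> p (lc_product P M u v)" using n[OF X Y] by simp
qed

lemma einstein_ricci_nf:
  assumes P: "\<And>i. P$i > 0" "\<And>i. M$i > 0" and \<kappa>: "\<kappa> > 0"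
    and h: "\<And>p u v. p \<in> G \<Longrightarrow> h p (\<theta> p u) (\<theta> p v) = \<kappa> * diag_metric P M u v"
    and E: "einstein G h"
  shows "\<exists>\<mu>. \<forall>u v. ricci_nf P M u v = \<mu> * diag_metric P M u v"
proof -
  obtain D R \<mu> where D: "levi_civita G h D" and R: "curvature_tensor G D R"
    and \<mu>: "\<forall>p\<in>G. \<forall>y\<in>tangent_space G p. \<forall>z\<in>tangent_space G p. ricci G R p y z = \<mu> * h p y z"
    using E unfolding einstein_def by blast
  have LC: "left_invariant_field (D X Y) (lc_product P M u v)" if "left_invariant_field X u" "left_invariant_field Y v" for X Y u v
    by (rule levi_civita_left_invariant[OF P \<kappa> _ D that]) (rule h)
  have "ricci_nf P M v w = (\<mu> * \<kappa>) * diag_metric P M v w" for v w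
  proof -
    have "R gone (\<theta> gone u) (\<theta> gone v) (\<theta> gone w) = \<theta> gone (curvature_nf P M u v w)" for u
    proof -
      define X Y Z where "X = (\<lambda>p. \<theta> p u)" "Y = (\<lambda>p. \<theta> p v)" "Z = (\<lambda>p. \<theta> p w)"
      have L: "left_invariant_field X u" "left_invariant_field Y v" "left_invariant_field Z w" by (simp_all add: X_Y_Z_def left_invariant_field_frame)
      have "R gone (X gone) (Y gone) (Z gone) =
          D X (D Y Z) gone - D Y (D X Z) gone - D (lie_bracket G X Y) Z gone"
        using L gone_mem by (intro curvature_tensorD[OF R]) (simp_all add: left_invariant_field_def)
      also have "D X (D Y Z) gone = \<theta> gone (lc_product P M u (lc_product P M v w))"
        using LC[OF L(1) LC[OF L(2,3)]] gone_mem by (simp add: left_invariant_field_def)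
      also have "D Y (D X Z) gone = \<theta> gone (lc_product P M v (lc_product P M u w))"
        using LC[OF L(2) LC[OF L(1,3)]] gone_mem by (simp add: left_invariant_field_def)
      also have "D (lie_bracket G X Y) Z gone = \<theta> gone (lc_product P M (bracket u v) w)"
        using LC[OF left_invariant_field_bracket[OF L(1,2)] L(3)] gone_mem by (simp add: left_invariant_field_def)
      finally show ?thesis by (simp add: X_Y_Z_def curvature_nf_def linear_diff[OF \<theta>_lin])
    qed
    then have "trace_on (tangent_space G gone) (\<lambda>x. R gone x (\<theta> gone v) (\<theta> gone w)) = ricci_nf P M v w"
      unfolding ricci_nf_def
      by (rule trace_on_conjugate[OF \<theta>_lin \<theta>_inj[OF gone_mem] \<theta>_range[OF gone_mem, symmetric] linear_curvature_nf])
    then have "ricci_nf P M v w = ricci G R gone (\<theta> gone v) (\<theta> gone w)" by (simp add: ricci_def)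
    also have "\<dots> = \<mu> * h gone (\<theta> gone v) (\<theta> gone w)"
      using \<mu> gone_mem \<theta>_tangent[OF gone_mem] by blast
    finally show ?thesis using h[OF gone_mem] by simp
  qed
  then show ?thesis by blast
qed

end

section \<open>Einstein metrics are equilateral\<close>

text \<open>The metric coefficients have a common factor, which cancels in each quotient of the Ricci
  tensor.\<close>

lemma ratio_scale:
  fixes k :: real assumes "k \<noteq> 0"
  shows "((k * p)\<^sup>2 - (k * q - k * r)\<^sup>2) / ((k * q') * (k * r')) = (p\<^sup>2 - (q - r)\<^sup>2) / (q' * r')"
proof -
  have "(k * p)\<^sup>2 - (k * q - k * r)\<^sup>2 = (k * k) * (p\<^sup>2 - (q - r)\<^sup>2)" by (simp add: power2_eq_square algebra_simps)
  moreover have "(k * q') * (k * r') = (k * k) * (q' * r')" by simp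
  ultimately show ?thesis using assms by simp
qed

lemma einstein_ratio:
  fixes k x y z \<mu> :: real
  assumes k: "k \<noteq> 0" 
    and S: "(((k * (1 - x))\<^sup>2 - (k * (1 - y) - k * (1 - z))\<^sup>2) / ((k * (1 - y)) * (k * (1 - z))) +
        ((k * (1 - x))\<^sup>2 - (k * (1 + y) - k * (1 + z))\<^sup>2) / ((k * (1 + y)) * (k * (1 + z)))) / 2 = \<mu> * (k * (1 - x))"
    and T: "(((k * (1 + x))\<^sup>2 - (k * (1 - y) - k * (1 + z))\<^sup>2) / ((k * (1 - y)) * (k * (1 + z))) +
        ((k * (1 + x))\<^sup>2 - (k * (1 + y) - k * (1 - z))\<^sup>2) / ((k * (1 + y)) * (k * (1 - z)))) / 2 = \<mu> * (k * (1 + x))"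
    and y: "\<bar>y\<bar> < 1" and z: "\<bar>z\<bar> < 1" and con: "x\<^sup>2 + y\<^sup>2 + z\<^sup>2 + 2 * x * y * z = 1"
  shows "(x\<^sup>2)\<^sup>2 + (x * y * z - 1) * x\<^sup>2 + 2 * (x * y * z)\<^sup>2 + x * y * z = 0"
proof (rule triangle_einstein_relation[OF y z con])
  have e: "((1 - y) - (1 - z))\<^sup>2 = (y - z)\<^sup>2" "((1 + y) - (1 + z))\<^sup>2 = (y - z)\<^sup>2"
    "((1 - y) - (1 + z))\<^sup>2 = (y + z)\<^sup>2" "((1 + y) - (1 - z))\<^sup>2 = (y + z)\<^sup>2"
    by (simp_all add: power2_eq_square algebra_simps)
  note S' = S[unfolded ratio_scale[OF k] e] and T' = T[unfolded ratio_scale[OF k] e]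
  let ?S = "((1 - x)\<^sup>2 - (y - z)\<^sup>2) / ((1 - y) * (1 - z)) + ((1 - x)\<^sup>2 - (y - z)\<^sup>2) / ((1 + y) * (1 + z))"
  let ?T = "((1 + x)\<^sup>2 - (y + z)\<^sup>2) / ((1 - y) * (1 + z)) + ((1 + x)\<^sup>2 - (y + z)\<^sup>2) / ((1 + y) * (1 - z))"
  have "?S = 2 * \<mu> * k * (1 - x)" using S' by (simp add: field_simps)
  moreover have "?T = 2 * \<mu> * k * (1 + x)" using T' by (simp add: field_simps)
  ultimately show "?S * (1 + x) = ?T * (1 - x)" by simp
qed

text \<open>By the law of cosines the metric coefficients are \<open>k (1 - x\<^sub>i)\<close> and \<open>k (1 + x\<^sub>i)\<close> with \<open>k = 2 a\<^sub>1 a\<^sub>2 a\<^sub>3\<close>; positivity of the metric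
  gives \<open>\<bar>x\<^sub>i\<bar> < 1\<close>.\<close>

lemma einstein_equal_sides:
  assumes a: "\<And>i. a$i > 0" and P: "\<And>i. metric_s a $ i > 0" and M: "\<And>i. metric_t a $ i > 0"
    and E: "\<forall>u v. ricci_nf (metric_s a) (metric_t a) u v = \<mu> * diag_metric (metric_s a) (metric_t a) u v"
  shows "a$1 = a$2 \<and> a$2 = a$3"
proof -
  define A B C where "A = a$1" "B = a$2" "C = a$3"
  have p: "A > 0" "B > 0" "C > 0" using a by (simp_all add: A_B_C_def)
  define x y z where "x = (B\<^sup>2 + C\<^sup>2 - A\<^sup>2) / (2 * B * C)" "y = (C\<^sup>2 + A\<^sup>2 - B\<^sup>2) / (2 * C * A)"
    "z = (A\<^sup>2 + B\<^sup>2 - C\<^sup>2) / (2 * A * B)"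
  define k where "k = 2 * A * B * C"
  have k: "k > 0" using p by (simp add: k_def)
  have kx: "k * x = A * (B\<^sup>2 + C\<^sup>2 - A\<^sup>2)" "k * y = B * (C\<^sup>2 + A\<^sup>2 - B\<^sup>2)" "k * z = C * (A\<^sup>2 + B\<^sup>2 - C\<^sup>2)"
    using p by (simp_all add: k_def x_y_z_def)
  have PM: "metric_s a $ 1 = k * (1 - x)" "metric_s a $ 2 = k * (1 - y)" "metric_s a $ 3 = k * (1 - z)"
     "metric_t a $ 1 = k * (1 + x)" "metric_t a $ 2 = k * (1 + y)" "metric_t a $ 3 = k * (1 + z)"
    unfolding right_diff_distrib distrib_left kx
    by (simp_all add: metric_s_def metric_t_def J_weight_s_def J_weight_t_def excess_def perimeter_def vector_3 A_B_C_def[symmetric] k_def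
        power2_eq_square algebra_simps)
  have lt: "\<bar>x\<bar> < 1" "\<bar>y\<bar> < 1" "\<bar>z\<bar> < 1"
    using P[of 1] P[of 2] P[of 3] M[of 1] M[of 2] M[of 3] k unfolding PM
    by (auto simp: zero_less_mult_iff)
  have con: "x\<^sup>2 + y\<^sup>2 + z\<^sup>2 + 2 * x * y * z = 1"
    using p by (simp add: x_y_z_def divide_simps) (simp add: power2_eq_square algebra_simps)
  have diag_metric: "diag_metric (metric_s a) (metric_t a) (e1, 0) (e1, 0) = metric_s a $ 1" "diag_metric (metric_s a) (metric_t a) (e2, 0) (e2, 0) = metric_s a $ 2"
     "diag_metric (metric_s a) (metric_t a) (e3, 0) (e3, 0) = metric_s a $ 3" "diag_metric (metric_s a) (metric_t a) (0, e1) (0, e1) = metric_t a $ 1"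
     "diag_metric (metric_s a) (metric_t a) (0, e2) (0, e2) = metric_t a $ 2" "diag_metric (metric_s a) (metric_t a) (0, e3) (0, e3) = metric_t a $ 3"
    by (simp_all add: diag_metric_def sum_3 vector_3)
  note E' = E[rule_format]
  note r1 = einstein_ratio[of k x y z \<mu>, folded PM, folded ricci_nf_diagonal(1,2)[OF P M]]
  note r2 = einstein_ratio[of k y z x \<mu>, folded PM, folded ricci_nf_diagonal(3,4)[OF P M]]
  note r3 = einstein_ratio[of k z x y \<mu>, folded PM, folded ricci_nf_diagonal(5,6)[OF P M]]
  have q: "(x\<^sup>2)\<^sup>2 + (x * y * z - 1) * x\<^sup>2 + 2 * (x * y * z)\<^sup>2 + x * y * z = 0"
    by (rule r1) (use k E' diag_metric lt con in simp_all)
  have q2: "(y\<^sup>2)\<^sup>2 + (y * z * x - 1) * y\<^sup>2 + 2 * (y * z * x)\<^sup>2 + y * z * x = 0"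
    by (rule r2) (use k E' diag_metric lt con in \<open>simp_all add: ac_simps\<close>)
  have q3: "(z\<^sup>2)\<^sup>2 + (z * x * y - 1) * z\<^sup>2 + 2 * (z * x * y)\<^sup>2 + z * x * y = 0"
    by (rule r3) (use k E' diag_metric lt con in \<open>simp_all add: ac_simps\<close>)
  have c: "y * z * x = x * y * z" "z * x * y = x * y * z" by simp_all
  have sq: "t\<^sup>2 < 1" if "\<bar>t\<bar> < 1" for t :: real using that by (simp add: abs_square_less_1)
  have "x\<^sup>2 = 1/4 \<and> y\<^sup>2 = 1/4 \<and> z\<^sup>2 = 1/4"
    by (rule triangle_cosines_half[OF sq[OF lt(1)] sq[OF lt(2)] sq[OF lt(3)] con refl])
       (use q q2[unfolded c] q3[unfolded c] in auto)
  then have "A = B \<and> B = C" using equilateral[OF p x_y_z_def] by blast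
  then show ?thesis by (simp add: A_B_C_def)
qed

section \<open>Exterior derivatives of left invariant forms\<close>

lemma nths_drop:
  "nths [x0, x1, x2] (- {0}) = [x1, x2]" "nths [x0, x1, x2] (- {Suc 0}) = [x0, x2]"
  "nths [x0, x1, x2] (- {Suc (Suc 0)}) = [x0, x1]"
  "nths [x0, x1, x2] (- {0, Suc 0}) = [x2]" "nths [x0, x1, x2] (- {0, Suc (Suc 0)}) = [x1]"
  "nths [x0, x1, x2] (- {Suc 0, Suc (Suc 0)}) = [x0]"
  "nths [x0, x1, x2, x3] (- {0}) = [x1, x2, x3]" "nths [x0, x1, x2, x3] (- {Suc 0}) = [x0, x2, x3]"
  "nths [x0, x1, x2, x3] (- {Suc (Suc 0)}) = [x0, x1, x3]"
  "nths [x0, x1, x2, x3] (- {Suc (Suc (Suc 0))}) = [x0, x1, x2]"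
  "nths [x0, x1, x2, x3] (- {0, Suc 0}) = [x2, x3]"
  "nths [x0, x1, x2, x3] (- {0, Suc (Suc 0)}) = [x1, x3]"
  "nths [x0, x1, x2, x3] (- {0, Suc (Suc (Suc 0))}) = [x1, x2]"
  "nths [x0, x1, x2, x3] (- {Suc 0, Suc (Suc 0)}) = [x0, x3]"
  "nths [x0, x1, x2, x3] (- {Suc 0, Suc (Suc (Suc 0))}) = [x0, x2]"
  "nths [x0, x1, x2, x3] (- {Suc (Suc 0), Suc (Suc (Suc 0))}) = [x0, x1]"
  by (simp_all add: nths_Cons)

lemma index_sets:
  "{..Suc (Suc 0)} = {0, Suc 0, Suc (Suc 0)}"
  "{..Suc (Suc (Suc 0))} = {0, Suc 0, Suc (Suc 0), Suc (Suc (Suc 0))}"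
  "{0<..Suc (Suc 0)} = {Suc 0, Suc (Suc 0)}" "{Suc 0<..Suc (Suc 0)} = {Suc (Suc 0)}"
  "{0<..Suc (Suc (Suc 0))} = {Suc 0, Suc (Suc 0), Suc (Suc (Suc 0))}"
  "{Suc 0<..Suc (Suc (Suc 0))} = {Suc (Suc 0), Suc (Suc (Suc 0))}"
  "{Suc (Suc 0)<..Suc (Suc (Suc 0))} = {Suc (Suc (Suc 0))}"
  by auto

lemma has_ext_deriv_2D:
  assumes d: "has_ext_deriv M 2 \<alpha> \<beta>" and V: "vector_field M X" "vector_field M Y" "vector_field M Z" and p: "p \<in> M"
  shows "\<beta> p [X p, Y p, Z p] =
     deriv_along M (\<lambda>q. \<alpha> q [Y q, Z q]) p (X p) - deriv_along M (\<lambda>q. \<alpha> q [X q, Z q]) p (Y p) +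
     deriv_along M (\<lambda>q. \<alpha> q [X q, Y q]) p (Z p)
     - \<alpha> p [lie_bracket M X Y p, Z p] + \<alpha> p [lie_bracket M X Z p, Y p] - \<alpha> p [lie_bracket M Y Z p, X p]"
proof -
  have "length [X, Y, Z] = 2 + 1 \<and> (\<forall>X\<in>set [X, Y, Z]. vector_field M X)" using V by simp
  from d[unfolded has_ext_deriv_def, rule_format, OF this p] show ?thesis
    unfolding numeral_2_eq_2 by (simp add: index_sets nths_drop)
qed

lemma has_ext_deriv_3I:
  assumes "\<And>X Y Z W p. vector_field M X \<Longrightarrow> vector_field M Y \<Longrightarrow> vector_field M Z \<Longrightarrow> vector_field M W \<Longrightarrow> p \<in> M \<Longrightarrow>
    \<beta> p [X p, Y p, Z p, W p] =
     deriv_along M (\<lambda>q. \<alpha> q [Y q, Z q, W q]) p (X p) - deriv_along M (\<lambda>q. \<alpha> q [X q, Z q, W q]) p (Y p) +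
     deriv_along M (\<lambda>q. \<alpha> q [X q, Y q, W q]) p (Z p) - deriv_along M (\<lambda>q. \<alpha> q [X q, Y q, Z q]) p (W p)
     - \<alpha> p [lie_bracket M X Y p, Z p, W p] + \<alpha> p [lie_bracket M X Z p, Y p, W p] - \<alpha> p [lie_bracket M X W p, Y p, Z p]
     - \<alpha> p [lie_bracket M Y Z p, X p, W p] + \<alpha> p [lie_bracket M Y W p, X p, Z p] - \<alpha> p [lie_bracket M Z W p, X p, Y p]"
  shows "has_ext_deriv M 3 \<alpha> \<beta>"
  unfolding has_ext_deriv_def
proof (intro allI impI ballI)
  fix Xs p assume Xs: "length Xs = 3 + 1 \<and> (\<forall>X\<in>set Xs. vector_field M X)" and p: "p \<in> M"
  then obtain X Y Z W where e: "Xs = [X, Y, Z, W]"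
    by (auto simp: length_Suc_conv numeral_eq_Suc)
  then have V: "vector_field M X" "vector_field M Y" "vector_field M Z" "vector_field M W" using Xs by auto
  show "\<beta> p (map (\<lambda>X. X p) Xs) =
          (\<Sum>i\<le>3. (-1) ^ i * deriv_along M (\<lambda>q. \<alpha> q (map (\<lambda>X. X q) (nths Xs (- {i})))) p ((Xs ! i) p)) +
          (\<Sum>i\<le>3. \<Sum>j\<in>{i<..3}. (-1) ^ (i + j) *
             \<alpha> p (map (\<lambda>X. X p) (lie_bracket M (Xs ! i) (Xs ! j) # nths Xs (- {i, j}))))"
    unfolding e numeral_3_eq_3 using assms[OF V p] by (simp add: index_sets nths_drop)
qed

definition omega_unit :: "r33 \<Rightarrow> r33 \<Rightarrow> real" where "omega_unit u v = fst u \<bullet> snd v - snd u \<bullet> fst v"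

text \<open>The 3-form \<open>- s\<^sup>1\<^sup>2\<^sup>3 + 3 (s\<^sup>1 t\<^sup>2\<^sup>3 + s\<^sup>2 t\<^sup>3\<^sup>1 + s\<^sup>3 t\<^sup>1\<^sup>2)\<close>, to which \<open>\<psi>\<^sub>-\<close> is proportional if the three sides are
  equal.\<close>

definition psi_minus_unit :: "r33 \<Rightarrow> r33 \<Rightarrow> r33 \<Rightarrow> real" where
  "psi_minus_unit u v w = - (fst u \<bullet> (fst v \<times> fst w)) +
     3 * (fst u \<bullet> (snd v \<times> snd w) + fst v \<bullet> (snd w \<times> snd u) + fst w \<bullet> (snd u \<times> snd v))"

lemma psi_minus_unit_cyclic: "psi_minus_unit v w u = psi_minus_unit u v w"
  by (simp add: psi_minus_unit_def inner_vec_def sum_3 cross_components algebra_simps)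

lemma psi_minus_unit_skew: "psi_minus_unit v u w = - psi_minus_unit u v w"
  by (simp add: psi_minus_unit_def inner_vec_def sum_3 cross_components algebra_simps)

lemma psi_minus_unit_linear: "linear (\<lambda>u. psi_minus_unit u v w)"
  by (rule linearI) (simp_all add: psi_minus_unit_def cross_add_left cross_add_right cross_mult_left cross_mult_right
      inner_add_left inner_add_right algebra_simps)

lemma psi_minus_unit_bilinear: "bounded_bilinear (psi_minus_unit u)"
proof -
  have "bilinear (psi_minus_unit u)"
    unfolding bilinear_def
    by (auto intro!: linearI simp: psi_minus_unit_def cross_add_left cross_add_right cross_mult_left cross_mult_right
      inner_add_left inner_add_right algebra_simps)
  then show ?thesis by (simp add: bilinear_conv_bounded_bilinear)
qed

lemma psi_minus_unit_bracket:
  "psi_minus_unit (bracket u v) w x =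
    - ((fst u \<times> fst v) \<bullet> (fst w \<times> fst x) + (snd u \<times> snd v) \<bullet> (fst w \<times> fst x)) +
    3 * ((fst u \<times> fst v) \<bullet> (snd w \<times> snd x) + (snd u \<times> snd v) \<bullet> (snd w \<times> snd x) +
       (fst w \<times> snd x) \<bullet> (fst u \<times> snd v) + (fst w \<times> snd x) \<bullet> (snd u \<times> fst v) +
       (snd w \<times> fst x) \<bullet> (fst u \<times> snd v) + (snd w \<times> fst x) \<bullet> (snd u \<times> fst v))"
  by (simp add: psi_minus_unit_def bracket_def inner_vec_def sum_3 cross_components algebra_simps)

text \<open>After expressing everything by inner products of two cross products, the identity of Lagrange
  leaves a polynomial identity in the inner products of the eight vectors.\<close>

lemma d_psi_minus_unit:
  "- psi_minus_unit (bracket x0 x1) x2 x3 + psi_minus_unit (bracket x0 x2) x1 x3 - psi_minus_unit (bracket x0 x3) x1 x2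
   - psi_minus_unit (bracket x1 x2) x0 x3 + psi_minus_unit (bracket x1 x3) x0 x2 - psi_minus_unit (bracket x2 x3) x0 x1 =
   - 4 * (omega_unit x0 x1 * omega_unit x2 x3 - omega_unit x0 x2 * omega_unit x1 x3 + omega_unit x0 x3 * omega_unit x1 x2)"
  unfolding psi_minus_unit_bracket dot_cross omega_unit_def
  by (simp add: inner_commute algebra_simps)

lemma omega_nf_const: "a$1 = a$2 \<Longrightarrow> a$2 = a$3 \<Longrightarrow> omega_nf a u v = a$1 * omega_unit u v"
  by (simp add: omega_nf_def omega_unit_def inner_vec_def sum_3 algebra_simps)

lemma domega_nf_const:
  assumes "a$1 = a$2" "a$2 = a$3"
  shows "domega_nf a u v w = a$1 * (- 3 * (snd u \<bullet> (snd v \<times> snd w)) +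
     (snd u \<bullet> (fst v \<times> fst w) + snd v \<bullet> (fst w \<times> fst u) + snd w \<bullet> (fst u \<times> fst v)))"
  unfolding domega_nf_def ce_d_def omega_nf_const[OF assms]
  by (simp add: omega_unit_def bracket_def inner_vec_def sum_3 cross_components algebra_simps)

text \<open>For equal sides \<open>a\<close> the weights are \<open>\<sigma> l\<^sub>i = 3 a\<^sup>2\<close> and \<open>l\<^sub>j l\<^sub>k = a\<^sup>2\<close>, and the square root of their product is
  \<open>sqrt 3 a\<^sup>2\<close>.\<close>

lemma J_nf_const:
  assumes "a$1 = a$2" "a$2 = a$3" "a$1 > 0"
  shows "J_nf a u = (- sqrt 3 *\<^sub>R snd u, (1 / sqrt 3) *\<^sub>R fst u)"
proof -
  have Q: "sqrt (quartic a) = sqrt 3 * (a$1)\<^sup>2"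
  proof -
    have "quartic a = 3 * ((a$1)\<^sup>2)\<^sup>2" using assms by (simp add: quartic_def perimeter_def excess_def power2_eq_square)
    then have "sqrt (quartic a) = sqrt 3 * sqrt (((a$1)\<^sup>2)\<^sup>2)" by (simp only: real_sqrt_mult)
    then show ?thesis by (simp only: real_sqrt_abs abs_power2)
  qed
  have "J_weight_t a $ i = 3 * (a$1)\<^sup>2" "J_weight_s a $ i = (a$1)\<^sup>2" for i
    using assms exhaust_3[of i] by (auto simp: J_weight_t_def J_weight_s_def excess_def perimeter_def power2_eq_square vector_3)
  then show ?thesis
    using assms(3) unfolding J_nf_def Q
    by (simp add: J_unscaled_def prod_eq_iff vec_eq_iff power2_eq_square divide_simps)
qed

lemma domega_nf_J_nf:
  assumes "a$1 = a$2" "a$2 = a$3" "a$1 > 0"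
  shows "domega_nf a (J_nf a u) (J_nf a v) (J_nf a w) = (a$1 / sqrt 3) * psi_minus_unit u v w"
proof -
  have s: "sqrt 3 * sqrt 3 = (3::real)" by simp
  show ?thesis
    unfolding domega_nf_const[OF assms(1,2)] J_nf_const[OF assms] psi_minus_unit_def
    by (simp add: cross_mult_left cross_mult_right divide_simps)
qed

context left_frame
begin

lemma ext_deriv_left_invariant:
  assumes B: "\<And>q u v. q \<in> G \<Longrightarrow> \<omega> q [\<theta> q u, \<theta> q v] = B u v"
    and d: "has_ext_deriv G 2 \<omega> \<beta>" and p: "p \<in> G"
  shows "\<beta> p [\<theta> p u, \<theta> p v, \<theta> p w] = ce_d bracket B u v w"
proof -
  \<comment> \<open>The derivatives of the constant values of \<open>\<omega>\<close> vanish; only the three brackets remain.\<close>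
  define X Y Z where "X = (\<lambda>p. \<theta> p u)" "Y = (\<lambda>p. \<theta> p v)" "Z = (\<lambda>p. \<theta> p w)"
  have L: "left_invariant_field X u" "left_invariant_field Y v" "left_invariant_field Z w" by (simp_all add: X_Y_Z_def left_invariant_field_frame)
  then have V: "vector_field G X" "vector_field G Y" "vector_field G Z" by (auto simp: left_invariant_field_def)
  have z: "deriv_along G (\<lambda>q. \<omega> q [A q, C q]) p (E p) = 0" if "left_invariant_field A a" "left_invariant_field C c" "left_invariant_field E e" for A C E a c e
    by (rule deriv_along_const[of G _ "B a c"]) (use that p B \<theta>_tangent in \<open>auto simp: left_invariant_field_def\<close>)
  have b: "lie_bracket G X Y p = \<theta> p (bracket u v)" "lie_bracket G X Z p = \<theta> p (bracket u w)"
    "lie_bracket G Y Z p = \<theta> p (bracket v w)"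
    using left_invariant_field_bracket[OF L(1,2)] left_invariant_field_bracket[OF L(1,3)] left_invariant_field_bracket[OF L(2,3)] p by (auto simp: left_invariant_field_def)
  show ?thesis
    using has_ext_deriv_2D[OF d V p] unfolding z[OF L(2,3,1)] z[OF L(1,3,2)] z[OF L(1,2,3)] b
    by (simp add: X_Y_Z_def B[OF p] ce_d_def)
qed

text \<open>For a left invariant form the invariant formula for \<open>d\<close> extends from left invariant to all
  fields: in coordinates, the derivatives of the coordinate functions enter once through the derivatives
  of the values of \<open>\<alpha>\<close> and once through the brackets, and these contributions cancel.\<close>

lemma ext_deriv_trilinear:
  assumes F: "\<And>q u v w. q \<in> G \<Longrightarrow> \<alpha> q [\<theta> q u, \<theta> q v, \<theta> q w] = F u v w"
    and lin: "\<And>v w. linear (\<lambda>u. F u v w)" and bil: "\<And>u. bounded_bilinear (F u)"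
    and skew: "\<And>u v w. F v u w = - F u v w" and cyc: "\<And>u v w. F v w u = F u v w"
    and \<beta>: "\<And>p x0 x1 x2 x3. p \<in> G \<Longrightarrow> \<beta> p [\<theta> p x0, \<theta> p x1, \<theta> p x2, \<theta> p x3] =
        - F (bracket x0 x1) x2 x3 + F (bracket x0 x2) x1 x3 - F (bracket x0 x3) x1 x2
        - F (bracket x1 x2) x0 x3 + F (bracket x1 x3) x0 x2 - F (bracket x2 x3) x0 x1"
  shows "has_ext_deriv G 3 \<alpha> \<beta>"
proof (rule has_ext_deriv_3I)
  fix X Y Z W p
  assume V: "vector_field G X" "vector_field G Y" "vector_field G Z" "vector_field G W" and p: "p \<in> G"
  obtain x' where x': "(coords X has_derivative x') (at p within G)" using coords_deriv[OF V(1) p] by blast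
  obtain y' where y': "(coords Y has_derivative y') (at p within G)" using coords_deriv[OF V(2) p] by blast
  obtain z' where z': "(coords Z has_derivative z') (at p within G)" using coords_deriv[OF V(3) p] by blast
  obtain w' where w': "(coords W has_derivative w') (at p within G)" using coords_deriv[OF V(4) p] by blast
  have D: "deriv_along G (\<lambda>q. \<alpha> q [A q, B q, C q]) p v =
      F (a' v) (coords B p) (coords C p) + F (coords A p) (b' v) (coords C p) + F (coords A p) (coords B p) (c' v)"
    if VA: "vector_field G A" and VB: "vector_field G B" and VC: "vector_field G C"
      and a': "(coords A has_derivative a') (at p within G)" and b': "(coords B has_derivative b') (at p within G)"
      and c': "(coords C has_derivative c') (at p within G)" and v: "v \<in> tangent_space G p"
    for A B C a' b' c' v
  proof (rule deriv_along_eq[OF _ p v])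
    have "\<alpha> q [A q, B q, C q] = F (coords A q) (coords B q) (coords C q)" if q: "q \<in> G" for q
      using F[OF q, of "coords A q" "coords B q" "coords C q"]
      by (simp only: coords_\<theta>[OF VA q] coords_\<theta>[OF VB q] coords_\<theta>[OF VC q])
    then show "((\<lambda>q. \<alpha> q [A q, B q, C q]) has_derivative (\<lambda>v.
      F (a' v) (coords B p) (coords C p) + F (coords A p) (b' v) (coords C p) + F (coords A p) (coords B p) (c' v))) (at p within G)"
      by (intro has_derivative_transform[OF p _ trilinear_has_derivative[OF lin bil a' b' c']]) simp
  qed
  define x y z w where "x = coords X p" "y = coords Y p" "z = coords Z p" "w = coords W p"
  have e: "X p = \<theta> p x" "Y p = \<theta> p y" "Z p = \<theta> p z" "W p = \<theta> p w"
    using coords_\<theta>[OF V(1) p] coords_\<theta>[OF V(2) p] coords_\<theta>[OF V(3) p] coords_\<theta>[OF V(4) p]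
    by (simp_all add: x_y_z_w_def)
  have t: "X p \<in> tangent_space G p" "Y p \<in> tangent_space G p" "Z p \<in> tangent_space G p" "W p \<in> tangent_space G p"
    by (simp_all only: e \<theta>_tangent[OF p])
  have Fa: "F (u + u' - u'') v w = F u v w + F u' v w - F u'' v w" for u u' u'' v w
    using linear_add[OF lin] linear_diff[OF lin] by simp
  note br = bracket_formula[OF V(1,2) p x' y'] bracket_formula[OF V(1,3) p x' z'] bracket_formula[OF V(1,4) p x' w']
    bracket_formula[OF V(2,3) p y' z'] bracket_formula[OF V(2,4) p y' w'] bracket_formula[OF V(3,4) p z' w']
  have s2: "F a u b = - F u a b" and s3: "F a b u = F u a b" for a b u
    by (rule skew, rule cyc)
  show "\<beta> p [X p, Y p, Z p, W p] =
     deriv_along G (\<lambda>q. \<alpha> q [Y q, Z q, W q]) p (X p) - deriv_along G (\<lambda>q. \<alpha> q [X q, Z q, W q]) p (Y p) +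
     deriv_along G (\<lambda>q. \<alpha> q [X q, Y q, W q]) p (Z p) - deriv_along G (\<lambda>q. \<alpha> q [X q, Y q, Z q]) p (W p)
     - \<alpha> p [lie_bracket G X Y p, Z p, W p] + \<alpha> p [lie_bracket G X Z p, Y p, W p] - \<alpha> p [lie_bracket G X W p, Y p, Z p]
     - \<alpha> p [lie_bracket G Y Z p, X p, W p] + \<alpha> p [lie_bracket G Y W p, X p, Z p] - \<alpha> p [lie_bracket G Z W p, X p, Y p]"
    unfolding D[OF V(2,3,4) y' z' w' t(1)] D[OF V(1,3,4) x' z' w' t(2)] D[OF V(1,2,4) x' y' w' t(3)]
      D[OF V(1,2,3) x' y' z' t(4)] br x_y_z_w_def[symmetric]
    unfolding e F[OF p] \<beta>[OF p] Fa
    using s2[of y "z' (\<theta> p x)" w] s3[of y z "w' (\<theta> p x)"] s2[of x "z' (\<theta> p y)" w] s3[of x z "w' (\<theta> p y)"]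
      s2[of x "y' (\<theta> p z)" w] s3[of x y "w' (\<theta> p z)"] s2[of x "y' (\<theta> p w)" z] s3[of x y "z' (\<theta> p w)"]
    by linarith
qed

end

section \<open>Coupled structures with an Einstein metric\<close>

lemma has_ext_deriv_cong:
  assumes "has_ext_deriv M k \<alpha> \<beta>" "\<And>p vs. p \<in> M \<Longrightarrow> \<beta>' p vs = \<beta> p vs"
  shows "has_ext_deriv M k \<alpha> \<beta>'"
  using assms unfolding has_ext_deriv_def by simp

lemma left_frame_sum_difference: "left_frame (\<lambda>u. (fst u + snd u, fst u - snd u))" (is "left_frame ?\<Phi>")
proof (rule left_frame.intro)
  show "linear ?\<Phi>" by (rule linearI) (auto simp: algebra_simps)
  show "inj ?\<Phi>"
  proof (rule injI)
    fix u v :: r33 assume e: "?\<Phi> u = ?\<Phi> v"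
    then have 1: "fst u + snd u = fst v + snd v" and 2: "fst u - snd u = fst v - snd v" by auto
    have "2 *\<^sub>R fst u = (fst u + snd u) + (fst u - snd u)" by (simp add: scaleR_2)
    also have "\<dots> = 2 *\<^sub>R fst v" unfolding 1 2 by (simp add: scaleR_2)
    finally have "fst u = fst v" by simp
    with 1 show "u = v" by (simp add: prod_eq_iff)
  qed
  show "?\<Phi> (bracket u v) = product_bracket (?\<Phi> u) (?\<Phi> v)" for u v
    by (simp add: bracket_def product_bracket_def vec_eq_iff forall_3 cross_components algebra_simps)
qed

text \<open>Through \<open>d\<omega> = c \<psi>\<close> the 3-form, and with it all other data, can be computed from \<open>\<omega>\<close> and \<open>c\<close>.\<close>

locale left_invariant_coupled =
  fixes \<omega> \<psi> :: "mat2 \<times> mat2 \<Rightarrow> (mat2 \<times> mat2) list \<Rightarrow> real" and c :: "mat2 \<times> mat2 \<Rightarrow> real"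
  assumes su3: "su3_structure SU2xSU2 \<omega> \<psi>"
    and li: "left_invariant \<omega>" "left_invariant \<psi>"
    and c0: "\<And>p. p \<in> SU2xSU2 \<Longrightarrow> c p \<noteq> 0"
    and d: "has_ext_deriv SU2xSU2 2 \<omega> (\<lambda>p vs. c p * \<psi> p vs)"
begin

lemma forms_at: "p \<in> SU2xSU2 \<Longrightarrow> \<omega> p \<in> forms 2 (tangent_space SU2xSU2 p)"
  "p \<in> SU2xSU2 \<Longrightarrow> \<psi> p \<in> forms 3 (tangent_space SU2xSU2 p)"
  using su3 by (auto simp: su3_structure_def differential_form_def)

lemma tangent_gone: "tangent_space SU2xSU2 gone = range gtau"
  using tangent_space_SU2xSU2[OF gone_mem] by simp

lemma left_inv:
  assumes "left_invariant \<alpha>" "p \<in> SU2xSU2"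
  shows "\<alpha> p (map (\<lambda>u. gmult p (gtau u)) us) = \<alpha> gone (map gtau us)"
proof -
  have "set (map gtau us) \<subseteq> tangent_space SU2xSU2 gone" by (auto simp: tangent_gone)
  then have "\<alpha> (gmult p gone) (map (gmult p) (map gtau us)) = \<alpha> gone (map gtau us)"
    using assms gone_mem unfolding left_invariant_def by blast
  moreover have "gmult p gone = p" by (simp add: gmult_def gone_def)
  ultimately show ?thesis by (simp add: comp_def)
qed

definition "A u v = \<omega> gone [gtau u, gtau v]"

lemma A: "p \<in> SU2xSU2 \<Longrightarrow> \<omega> p [gmult p (gtau u), gmult p (gtau v)] = A u v"
  using left_inv[OF li(1), of p "[u, v]"] by (simp add: A_def)

lemma A_bilinear: "bounded_bilinear A"
proof -
  have sub: "subspace (tangent_space SU2xSU2 gone)"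
    using linear_subspace_image[OF linear_gtau subspace_UNIV] by (simp add: tangent_gone)
  note f = forms_at(1)[OF gone_mem]
  have T: "gtau u \<in> tangent_space SU2xSU2 gone" for u by (simp add: tangent_gone)
  have "linear (A u)" for u
  proof (rule linearI)
    show "A u (x + y) = A u x + A u y" for x y
      using forms_lin[OF f T T sub, of "[gtau u]" 1 x 1 y "[]"]
      by (simp add: A_def linear_add[OF linear_gtau])
    show "A u (r *\<^sub>R x) = r *\<^sub>R A u x" for r x
      using forms_lin[OF f T T sub, of "[gtau u]" r x 0 x "[]"]
      by (simp add: A_def linear_scale[OF linear_gtau])
  qed
  moreover have "linear (\<lambda>v. A v u)" for u
  proof (rule linearI)
    show "A (x + y) u = A x u + A y u" for x y
      using forms_lin[OF f T T sub, of "[]" 1 x 1 y "[gtau u]"]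
      by (simp add: A_def linear_add[OF linear_gtau])
    show "A (r *\<^sub>R x) u = r *\<^sub>R A x u" for r x
      using forms_lin[OF f T T sub, of "[]" r x 0 x "[gtau u]"]
      by (simp add: A_def linear_scale[OF linear_gtau])
  qed
  ultimately show ?thesis by (simp add: bilinear_conv_bounded_bilinear[symmetric] bilinear_def del: split_paired_All)
qed

lemma A_alt: "A u u = 0"
  using forms_alt[OF forms_at(1)[OF gone_mem], of "[gtau u, gtau u]"] by (simp add: A_def)

lemma metric_pos:
  assumes "p \<in> SU2xSU2" "x \<in> tangent_space SU2xSU2 p" "x \<noteq> 0"
  shows "su3_metric SU2xSU2 \<omega> \<psi> p x x > 0"
  using su3 assms by (simp add: su3_structure_def riemannian_metric_def Let_def)

text \<open>Positivity of the metric pairs \<open>x\<close> nontrivially with \<open>J x\<close>. The form vanishes on lists that leave the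
  tangent space, so \<open>J x\<close> is tangent.\<close>

lemma A_nondegenerate:
  assumes "u \<noteq> 0" shows "\<exists>v. A u v \<noteq> 0"
proof -
  let ?J = "su3_J SU2xSU2 \<omega> \<psi> gone"
  have "gtau u \<noteq> 0" using assms linear_0[OF linear_gtau] inj_eq[OF inj_gtau, of u 0] by simp
  then have "\<omega> gone [gtau u, ?J (gtau u)] > 0"
    using metric_pos[OF gone_mem, of "gtau u"] by (simp add: tangent_gone su3_metric_def)
  moreover from this have "?J (gtau u) \<in> range gtau"
    using forms_zero[OF forms_at(1)[OF gone_mem], of "[gtau u, ?J (gtau u)]"] by (auto simp: tangent_gone)
  ultimately show ?thesis unfolding A_def by (metis rangeE less_irrefl)
qed

lemma psi_gone: "c gone * \<psi> gone [gtau u, gtau v, gtau w] = ce_d product_bracket A u v w"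
proof -
  let ?\<Phi> = "\<lambda>u :: r33. (fst u + snd u, fst u - snd u)"
  interpret L0: left_frame ?\<Phi> by (rule left_frame_sum_difference)
  have "surj ?\<Phi>" using linear_inj_imp_surj[OF L0.\<Phi>_lin L0.\<Phi>_inj] .
  then obtain u' v' w' where e: "u = ?\<Phi> u'" "v = ?\<Phi> v'" "w = ?\<Phi> w'" by (meson surjD)
  have t: "L0.\<theta> p x = gmult p (gtau (?\<Phi> x))" for p x by (simp only: L0.\<theta>_def L0.\<xi>_def)
  have "c gone * \<psi> gone [L0.\<theta> gone u', L0.\<theta> gone v', L0.\<theta> gone w'] =
      ce_d bracket (\<lambda>u v. A (?\<Phi> u) (?\<Phi> v)) u' v' w'"
    by (rule L0.ext_deriv_left_invariant[OF _ d gone_mem]) (simp only: t A)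
  also have "\<dots> = ce_d product_bracket A u v w" unfolding e ce_d_def L0.\<Phi>_br ..
  finally show ?thesis unfolding t gone_gmult e .
qed

lemma A_wedge: "wedge 2 (as_2form A) (as_3form (ce_d product_bracket A)) [x1, x2, x3, x4, x5] = 0"
proof -
  have "wedge 2 (as_2form A) (as_3form (ce_d product_bracket A)) [x1, x2, x3, x4, x5] =
     c gone * wedge 2 (\<omega> gone) (\<psi> gone) [gtau x1, gtau x2, gtau x3, gtau x4, gtau x5]"
    unfolding wedge_2_3 as_2form_def as_3form_def
    by (simp add: psi_gone[symmetric] A_def[symmetric] algebra_simps)
  also have "wedge 2 (\<omega> gone) (\<psi> gone) = (\<lambda>_. 0)"
    using su3 gone_mem by (simp add: su3_structure_def Let_def)
  finally show ?thesis by simp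
qed

end

text \<open>A coupled structure together with coordinates in which \<open>\<omega>\<close> has its normal form.\<close>

locale coupled_frame = left_invariant_coupled + left_frame +
  fixes a :: "real^3"
  assumes a: "\<And>i. a$i > 0" and A\<Phi>: "\<And>u v. A (\<Phi> u) (\<Phi> v) = omega_nf a u v"
begin

lemma \<theta>_eq: "\<theta> p u = gmult p (gtau (\<Phi> u))" by (simp only: \<theta>_def \<xi>_def)

lemma \<omega>_\<theta>: "p \<in> G \<Longrightarrow> \<omega> p [\<theta> p u, \<theta> p v] = omega_nf a u v"
  by (simp only: \<theta>_eq A A\<Phi>)

lemma c_psi: "p \<in> G \<Longrightarrow> c p * \<psi> p [\<theta> p u, \<theta> p v, \<theta> p w] = domega_nf a u v w"
  unfolding domega_nf_def by (rule ext_deriv_left_invariant[OF \<omega>_\<theta> d])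

lemma psi_const: "p \<in> G \<Longrightarrow> \<psi> p [\<theta> p u, \<theta> p v, \<theta> p w] = \<psi> gone [\<theta> gone u, \<theta> gone v, \<theta> gone w]"
  using left_inv[OF li(2), of p "[\<Phi> u, \<Phi> v, \<Phi> w]"] by (simp add: \<theta>_eq)

lemma \<psi>_\<theta>: "p \<in> G \<Longrightarrow> \<psi> p [\<theta> p u, \<theta> p v, \<theta> p w] = domega_nf a u v w / c gone"
  using c_psi[OF gone_mem, of u v w] psi_const[of p u v w] c0[OF gone_mem] by (simp add: field_simps)

text \<open>The form \<open>d\<omega> = c \<psi>\<close> has the nonzero constant value \<open>- \<sigma>\<close> on \<open>t\<^sub>1, t\<^sub>2, t\<^sub>3\<close>, and \<open>\<psi>\<close> is constant there as well.\<close>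

lemma c_const: assumes p: "p \<in> G" shows "c p = c gone"
proof -
  have "domega_nf a (0, e1) (0, e2) (0, e3) = - perimeter a"
    by (simp add: domega_nf_def ce_d_def bracket_def omega_nf_def sum_3 cross3_def vector_3 perimeter_def)
  moreover have "perimeter a > 0" using a unfolding perimeter_def by (intro add_pos_pos)
  ultimately have "domega_nf a (0, e1) (0, e2) (0, e3) \<noteq> 0" by simp
  moreover have "c p * (domega_nf a (0, e1) (0, e2) (0, e3) / c gone) = domega_nf a (0, e1) (0, e2) (0, e3)"
    using c_psi[OF p, of "(0, e1)" "(0, e2)" "(0, e3)"] \<psi>_\<theta>[OF p, of "(0, e1)" "(0, e2)" "(0, e3)"] by simp
  ultimately show ?thesis using c0[OF gone_mem] by (simp add: field_simps)
qed

lemma frame6_at: "p \<in> G \<Longrightarrow> frame6 (\<theta> p) (tangent_space G p) (\<omega> p) (\<psi> p) a (c gone)"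
  by (rule frame6.intro) (simp_all only: \<theta>_lin \<theta>_inj \<theta>_range[symmetric] forms_at \<omega>_\<theta> \<psi>_\<theta> a c0 gone_mem not_False_eq_True simp_thms)

lemma quartic_pos: "quartic a > 0"
proof -
  have "hitchin_lambda (tangent_space G gone) (cube (\<omega> gone)) (\<psi> gone) < 0"
    using su3 gone_mem by (simp add: su3_structure_def Let_def)
  then show ?thesis by (rule frame6.quartic_pos_if[OF frame6_at[OF gone_mem]])
qed

lemma metric_\<theta>:
  "p \<in> G \<Longrightarrow> su3_metric G \<omega> \<psi> p (\<theta> p u) (\<theta> p v) = (1 / sqrt (quartic a)) * diag_metric (metric_s a) (metric_t a) u v"
  unfolding su3_metric_def su3_J_def by (rule frame6.metric_frame[OF frame6_at quartic_pos])

lemma diag_metric_pos: assumes "u \<noteq> 0" shows "diag_metric (metric_s a) (metric_t a) u u > 0"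
proof -
  have "\<theta> gone u \<noteq> 0"
    using assms linear_0[OF \<theta>_lin] inj_eq[OF \<theta>_inj[OF gone_mem], of u 0] by simp
  from metric_pos[OF gone_mem \<theta>_tangent[OF gone_mem] this] show ?thesis
    using quartic_pos by (simp add: metric_\<theta>[OF gone_mem] zero_less_divide_iff)
qed

lemma metric_pos_st: "metric_s a $ i > 0" "metric_t a $ i > 0"
proof -
  have "diag_metric (metric_s a) (metric_t a) (axis i 1, 0) (axis i 1, 0) = metric_s a $ i"
    "diag_metric (metric_s a) (metric_t a) (0, axis i 1) (0, axis i 1) = metric_t a $ i"
    using exhaust_3[of i] by (auto simp: diag_metric_def axis_def sum_3)
  then show "metric_s a $ i > 0" "metric_t a $ i > 0"
    using diag_metric_pos[of "(axis i 1, 0)"] diag_metric_pos[of "(0, axis i 1)"] by (simp_all add: zero_prod_def axis_eq_0_iff)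
qed

lemma einstein_a_equal:
  assumes "einstein G (su3_metric G \<omega> \<psi>)" shows "a$1 = a$2" "a$2 = a$3"
proof -
  have "1 / sqrt (quartic a) > 0" using quartic_pos by simp
  from einstein_ricci_nf[OF metric_pos_st this metric_\<theta> assms] obtain \<mu>
    where "\<forall>u v. ricci_nf (metric_s a) (metric_t a) u v = \<mu> * diag_metric (metric_s a) (metric_t a) u v" by blast
  from einstein_equal_sides[OF a metric_pos_st this] show "a$1 = a$2" "a$2 = a$3" by auto
qed

lemma psi_minus_\<theta>:
  assumes eq: "a$1 = a$2" "a$2 = a$3" and p: "p \<in> G"
  shows "psi_minus G \<omega> \<psi> p [\<theta> p u, \<theta> p v, \<theta> p w] = (a$1 / (sqrt 3 * c gone)) * psi_minus_unit u v w"
proof -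
  have J: "su3_J G \<omega> \<psi> p (\<theta> p u) = \<theta> p (J_nf a u)" for u
    unfolding su3_J_def by (rule frame6.hitchin_J_frame[OF frame6_at[OF p] quartic_pos])
  have "psi_minus G \<omega> \<psi> p [\<theta> p u, \<theta> p v, \<theta> p w] = \<psi> p [\<theta> p (J_nf a u), \<theta> p (J_nf a v), \<theta> p (J_nf a w)]"
    by (simp add: psi_minus_def pullback_def \<theta>_tangent[OF p] J)
  then show ?thesis using domega_nf_J_nf[OF eq a, of u v w] by (simp add: \<psi>_\<theta>[OF p])
qed

text \<open>Both sides of \<open>\<psi> \<and> \<psi>\<^sub>- = 2/3 \<omega>\<^sup>3\<close> on the frame.\<close>

lemma normalization:
  assumes eq: "a$1 = a$2" "a$2 = a$3"
  shows "(c gone)\<^sup>2 * a$1 = sqrt 3"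
proof -
  let ?s = "a$1" and ?k = "a$1 / (sqrt 3 * c gone)"
  let ?frame_list = "[\<theta> gone (e1, 0), \<theta> gone (e2, 0), \<theta> gone (e3, 0), \<theta> gone (0, e1), \<theta> gone (0, e2), \<theta> gone (0, e3)]"
  have "wedge 3 (\<psi> gone) (psi_minus G \<omega> \<psi> gone) = (\<lambda>vs. 2/3 * cube (\<omega> gone) vs)"
    using su3 gone_mem by (simp add: su3_structure_def Let_def)
  from fun_cong[OF this, of ?frame_list]
  have 1: "wedge 3 (\<psi> gone) (psi_minus G \<omega> \<psi> gone) ?frame_list = - 4 * prod3 a"
    using frame6.cube_eval(1)[OF frame6_at[OF gone_mem], of "(e1, 0)"] by simp
  have 2: "wedge 3 (\<psi> gone) (psi_minus G \<omega> \<psi> gone) ?frame_list = - 12 * ?s / c gone * ?k"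
    unfolding wedge_3_3 \<psi>_\<theta>[OF gone_mem] psi_minus_\<theta>[OF eq gone_mem] domega_nf_const[OF eq]
    by (simp add: psi_minus_unit_def inner_vec_def sum_3 cross3_def vector_3) (simp only: mult_ac)
  have 3: "12 * ?s * ?s / (sqrt 3 * (c gone)\<^sup>2) = - (- 12 * ?s / c gone * ?k)"
    by (simp add: power2_eq_square)
  have "prod3 a = ?s * ?s * ?s" using eq by (simp add: prod3_def)
  with 1 2 3 have "12 * ?s * ?s / (sqrt 3 * (c gone)\<^sup>2) = 4 * (?s * ?s * ?s)" by linarith
  then have "12 = 4 * ?s * (sqrt 3 * (c gone)\<^sup>2)"
    using a[of 1] c0[OF gone_mem] by (simp add: field_simps)
  then have "3 = ?s * (sqrt 3 * (c gone)\<^sup>2)" by simp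
  then have "sqrt 3 * ((c gone)\<^sup>2 * ?s - sqrt 3) = 0" by (simp add: right_diff_distrib mult_ac)
  then show ?thesis by simp
qed

text \<open>The equation for \<open>d\<omega>\<close> requires \<open>w = - 2 c / 3\<close>. With \<open>k\<close> the factor of \<open>\<psi>\<^sub>-\<close>, the equation for \<open>d\<psi>\<^sub>-\<close>
  requires \<open>2 w a\<^sup>2 = - 4 k\<close> for the common value \<open>a\<close> of the sides, and this is the normalisation \<open>c\<^sup>2 a = sqrt 3\<close>.\<close>

lemma nearly_kaehler_if_equal:
  assumes eq: "a$1 = a$2" "a$2 = a$3"
  shows "nearly_kaehler G \<omega> \<psi>"
proof -
  define s where "s = a$1"
  define w where "w = - 2/3 * c gone"
  define k where "k = s / (sqrt 3 * c gone)"
  have s: "s > 0" using a by (simp add: s_def)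
  have n: "(c gone)\<^sup>2 * s = sqrt 3" using normalization[OF eq] by (simp add: s_def)
  have wk: "2 * (w * s\<^sup>2) = - 4 * k"
  proof -
    have "c gone * (sqrt 3 * c gone * s) = 3" using n by (simp add: power2_eq_square algebra_simps) 
        (simp add: mult.assoc[symmetric])
    then have "c gone * s = 3 / (sqrt 3 * c gone)" using c0[OF gone_mem] by (simp add: field_simps)
    moreover have "2 * (w * s\<^sup>2) = - 4/3 * (c gone * s) * s"
      by (simp add: w_def power2_eq_square)
    ultimately have "2 * (w * s\<^sup>2) = - 4/3 * (3 / (sqrt 3 * c gone)) * s" by simp
    then show ?thesis by (simp add: k_def)
  qed
  have d2: "has_ext_deriv G 2 \<omega> (\<lambda>p vs. - 3/2 * w * \<psi> p vs)"
    by (rule has_ext_deriv_cong[OF d]) (simp add: w_def c_const)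
  have "has_ext_deriv G 3 (psi_minus G \<omega> \<psi>) (\<lambda>p vs. w * wedge 2 (\<omega> p) (\<omega> p) vs)"
  proof (rule ext_deriv_trilinear[where F = "\<lambda>u v w. k * psi_minus_unit u v w"])
    show "psi_minus G \<omega> \<psi> q [\<theta> q u, \<theta> q v, \<theta> q w] = k * psi_minus_unit u v w" if "q \<in> G" for q u v w
      using psi_minus_\<theta>[OF eq that] by (simp add: k_def s_def)
    show "linear (\<lambda>u. k * psi_minus_unit u v w)" for v w
      using linear_compose_scale_right[OF psi_minus_unit_linear, of k] by simp
    show "bounded_bilinear (\<lambda>v w. k * psi_minus_unit u v w)" for u
    proof -
      have "bilinear (psi_minus_unit u)" using psi_minus_unit_bilinear by (simp only: bilinear_conv_bounded_bilinear)
      then have "linear (psi_minus_unit u v)" "linear (\<lambda>v. psi_minus_unit u v w)" for v w unfolding bilinear_def by blast+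
      from linear_compose_scale_right[OF this(1), of k] linear_compose_scale_right[OF this(2), of k]
      have "bilinear (\<lambda>v w. k *\<^sub>R psi_minus_unit u v w)" unfolding bilinear_def by simp
      then show ?thesis by (simp only: bilinear_conv_bounded_bilinear real_scaleR_def)
    qed
    show "k * psi_minus_unit v u w = - (k * psi_minus_unit u v w)" for u v w by (subst psi_minus_unit_skew) simp
    show "k * psi_minus_unit v w u = k * psi_minus_unit u v w" for u v w by (subst psi_minus_unit_cyclic) simp
    show "w * wedge 2 (\<omega> p) (\<omega> p) [\<theta> p x0, \<theta> p x1, \<theta> p x2, \<theta> p x3] =
        - (k * psi_minus_unit (bracket x0 x1) x2 x3) + k * psi_minus_unit (bracket x0 x2) x1 x3 - k * psi_minus_unit (bracket x0 x3) x1 x2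
        - k * psi_minus_unit (bracket x1 x2) x0 x3 + k * psi_minus_unit (bracket x1 x3) x0 x2 - k * psi_minus_unit (bracket x2 x3) x0 x1"
      if p: "p \<in> G" for p x0 x1 x2 x3
    proof -
      let ?o = "omega_unit x0 x1 * omega_unit x2 x3 - omega_unit x0 x2 * omega_unit x1 x3 + omega_unit x0 x3 * omega_unit x1 x2"
      have "wedge 2 (\<omega> p) (\<omega> p) [\<theta> p x0, \<theta> p x1, \<theta> p x2, \<theta> p x3] = 2 * s\<^sup>2 * ?o"
        unfolding wedge_2_2 \<omega>_\<theta>[OF p] omega_nf_const[OF eq]
        by (simp add: s_def power2_eq_square algebra_simps)
      then have "w * wedge 2 (\<omega> p) (\<omega> p) [\<theta> p x0, \<theta> p x1, \<theta> p x2, \<theta> p x3] = 2 * (w * s\<^sup>2) * ?o" by simp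
      also have "\<dots> = k * (- 4 * ?o)" unfolding wk by (simp only: mult_ac)
      also have "\<dots> = k * (- psi_minus_unit (bracket x0 x1) x2 x3 + psi_minus_unit (bracket x0 x2) x1 x3 - psi_minus_unit (bracket x0 x3) x1 x2
          - psi_minus_unit (bracket x1 x2) x0 x3 + psi_minus_unit (bracket x1 x3) x0 x2 - psi_minus_unit (bracket x2 x3) x0 x1)"
        unfolding d_psi_minus_unit ..
      finally show ?thesis by (simp add: algebra_simps)
    qed
  qed
  moreover have "w \<noteq> 0" using c0[OF gone_mem] by (simp add: w_def)
  ultimately show ?thesis unfolding nearly_kaehler_def using d2 by blast
qed

end

theorem einstein_imp_nearly_kaehler:
  assumes "su3_structure SU2xSU2 \<omega> \<psi>" "left_invariant \<omega>" "left_invariant \<psi>" "coupled SU2xSU2 \<omega> \<psi>"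
    and E: "einstein SU2xSU2 (su3_metric SU2xSU2 \<omega> \<psi>)"
  shows "nearly_kaehler SU2xSU2 \<omega> \<psi>"
proof -
  obtain c where c: "\<forall>p\<in>SU2xSU2. c p \<noteq> 0" "has_ext_deriv SU2xSU2 2 \<omega> (\<lambda>p vs. c p * \<psi> p vs)"
    using assms(4) unfolding coupled_def by blast
  interpret C: left_invariant_coupled \<omega> \<psi> c
    by unfold_locales (use assms c in auto)
  obtain \<Phi> a where f: "linear \<Phi>" "inj \<Phi>" "\<forall>u v. \<Phi> (bracket u v) = product_bracket (\<Phi> u) (\<Phi> v)"
    and a: "\<forall>i. a$i > 0" "\<forall>u v. C.A (\<Phi> u) (\<Phi> v) = omega_nf a u v"
    using coupled_normal_form[OF C.A_bilinear C.A_alt C.A_nondegenerate C.A_wedge] by blast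
  interpret F: coupled_frame \<omega> \<psi> c \<Phi> a
  proof (intro coupled_frame.intro left_frame.intro coupled_frame_axioms.intro)
    show "left_invariant_coupled \<omega> \<psi> c" by (rule C.left_invariant_coupled_axioms)
  qed (use f a in blast)+
  show ?thesis by (rule F.nearly_kaehler_if_equal[OF F.einstein_a_equal[OF E]])
qed

theorem theorem3p6:
  shows "\<not> (\<exists>\<omega> \<psi>.
      su3_structure SU2xSU2 \<omega> \<psi> \<and>
      left_invariant \<omega> \<and> left_invariant \<psi> \<and>
      coupled SU2xSU2 \<omega> \<psi> \<and> \<not> nearly_kaehler SU2xSU2 \<omega> \<psi> \<and>
      Ad_circle_invariant (su3_metric SU2xSU2 \<omega> \<psi>) \<and>
      einstein SU2xSU2 (su3_metric SU2xSU2 \<omega> \<psi>))"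
  using einstein_imp_nearly_kaehler by blast

end
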